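(* Let $R$ be a locally equidimensional excellent ring and let $I$ be an ideal of $R$. Then there exists an element $f \in R$ with $f \notin \bigcup_{P \in \operatorname{Minh}(I)} P$ such that $R_f/I^nR_f$ is Cohen-Macaulay for all $n \ge 1$.
   Context: Rings are commutative with identity; excellent rings are in particular Noetherian. $R$ is locally equidimensional if for every prime $\mathfrak p$ the local ring $R_{\mathfrak p}$ is equidimensional, i.e. $\dim R_{\mathfrak p}/\mathfrak q = \dim R_{\mathfrak p}$ for every minimal prime $\mathfrak q$ of $R_{\mathfrak p}$. For an ideal $I$, $\operatorname{Minh}(I)$ denotes the set of minimal primes $P$ of $I$ such that $\dim R/P = \dim R/I$. $R_f$ denotes the localization of $R$ at the powers of $f$. A Noetherian ring is Cohen-Macaulay if all its localizations at prime ideals are Cohen-Macaulay local rings (the zero ring is regarded as Cohen-Macaulay). *)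

theory Defs
  imports "HOL-Library.Extended_Nat" "HOL-Algebra.Ring_Divisibility" "HOL-Algebra.Generated_Rings"
    "HOL-Algebra.Embedded_Algebras" "HOL-Algebra.Ideal_Product"
begin

section \<open>Localization\<close>

definition loc_rel :: "('a, 'b) ring_scheme \<Rightarrow> 'a set \<Rightarrow> (('a \<times> 'a) \<times> ('a \<times> 'a)) set" where
  "loc_rel R S = {((a, s), (b, t)). a \<in> carrier R \<and> s \<in> S \<and> b \<in> carrier R \<and> t \<in> S \<and>
     (\<exists>u\<in>S. u \<otimes>\<^bsub>R\<^esub> (t \<otimes>\<^bsub>R\<^esub> a) = u \<otimes>\<^bsub>R\<^esub> (s \<otimes>\<^bsub>R\<^esub> b))}"

definition fraction :: "('a, 'b) ring_scheme \<Rightarrow> 'a set \<Rightarrow> 'a \<Rightarrow> 'a \<Rightarrow> ('a \<times> 'a) set" where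
  "fraction R S a s = loc_rel R S `` {(a, s)}"

text \<open>The set \<open>S\<close> is meant to be multiplicatively closed; it may contain zero divisors and zero.\<close>

definition localization :: "('a, 'b) ring_scheme \<Rightarrow> 'a set \<Rightarrow> (('a \<times> 'a) set) ring" where
  "localization R S =
     \<lparr> carrier = (carrier R \<times> S) // loc_rel R S,
       mult = (\<lambda>U V. \<Union>(a, s)\<in>U. \<Union>(b, t)\<in>V. fraction R S (a \<otimes>\<^bsub>R\<^esub> b) (s \<otimes>\<^bsub>R\<^esub> t)),
       one = fraction R S \<one>\<^bsub>R\<^esub> \<one>\<^bsub>R\<^esub>,
       zero = fraction R S \<zero>\<^bsub>R\<^esub> \<one>\<^bsub>R\<^esub>,
       add = (\<lambda>U V. \<Union>(a, s)\<in>U. \<Union>(b, t)\<in>V.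
                fraction R S ((t \<otimes>\<^bsub>R\<^esub> a) \<oplus>\<^bsub>R\<^esub> (s \<otimes>\<^bsub>R\<^esub> b)) (s \<otimes>\<^bsub>R\<^esub> t)) \<rparr>"

definition loc_map :: "('a, 'b) ring_scheme \<Rightarrow> 'a set \<Rightarrow> 'a \<Rightarrow> ('a \<times> 'a) set" where
  "loc_map R S a = fraction R S a \<one>\<^bsub>R\<^esub>"

abbreviation elem_powers :: "('a, 'b) ring_scheme \<Rightarrow> 'a \<Rightarrow> 'a set" where
  "elem_powers R f \<equiv> range (\<lambda>n::nat. f [^]\<^bsub>R\<^esub> n)"

abbreviation localization_away :: "('a, 'b) ring_scheme \<Rightarrow> 'a \<Rightarrow> (('a \<times> 'a) set) ring" where
  "localization_away R f \<equiv> localization R (elem_powers R f)"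

abbreviation localization_at :: "('a, 'b) ring_scheme \<Rightarrow> 'a set \<Rightarrow> (('a \<times> 'a) set) ring" where
  "localization_at R P \<equiv> localization R (carrier R - P)"

definition extended_ideal :: "('c, 'd) ring_scheme \<Rightarrow> ('a \<Rightarrow> 'c) \<Rightarrow> 'a set \<Rightarrow> 'c set" where
  "extended_ideal S h I = Idl\<^bsub>S\<^esub> (h ` I)"

abbreviation ideal_power :: "('a, 'b) ring_scheme \<Rightarrow> 'a set \<Rightarrow> nat \<Rightarrow> 'a set" where
  "ideal_power R I n \<equiv> I [^]\<^bsub>ideals_set R\<^esub> n"


section \<open>Primes and dimension\<close>

definition prime_chain :: "('a, 'b) ring_scheme \<Rightarrow> (nat \<Rightarrow> 'a set) \<Rightarrow> nat \<Rightarrow> bool" where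
  "prime_chain R C n \<longleftrightarrow> (\<forall>i\<le>n. primeideal (C i) R) \<and> (\<forall>i<n. C i \<subset> C (Suc i))"

text \<open>The zero ring gets dimension \<open>0\<close>, the supremum of the empty set.\<close>

definition krull_dim :: "('a, 'b) ring_scheme \<Rightarrow> enat" where
  "krull_dim R = Sup {enat n | n. \<exists>C. prime_chain R C n}"

definition minimal_primes :: "('a, 'b) ring_scheme \<Rightarrow> 'a set \<Rightarrow> 'a set set" where
  "minimal_primes R I = {P. primeideal P R \<and> I \<subseteq> P \<and>
     (\<forall>Q. primeideal Q R \<and> I \<subseteq> Q \<and> Q \<subseteq> P \<longrightarrow> Q = P)}"

definition Minh :: "('a, 'b) ring_scheme \<Rightarrow> 'a set \<Rightarrow> 'a set set" where
  "Minh R I = {P \<in> minimal_primes R I. krull_dim (R Quot P) = krull_dim (R Quot I)}"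

definition equidimensional :: "('a, 'b) ring_scheme \<Rightarrow> bool" where
  "equidimensional R \<longleftrightarrow>
     (\<forall>Q\<in>minimal_primes R {\<zero>\<^bsub>R\<^esub>}. krull_dim (R Quot Q) = krull_dim R)"

definition locally_equidimensional :: "('a, 'b) ring_scheme \<Rightarrow> bool" where
  "locally_equidimensional R \<longleftrightarrow>
     (\<forall>P. primeideal P R \<longrightarrow> equidimensional (localization_at R P))"


section \<open>Local rings, regular rings, Cohen--Macaulay rings\<close>

definition noetherian_cring :: "('a, 'b) ring_scheme \<Rightarrow> bool" where
  "noetherian_cring R \<longleftrightarrow> cring R \<and> noetherian_ring R"

definition local_ring :: "('a, 'b) ring_scheme \<Rightarrow> bool" where
  "local_ring R \<longleftrightarrow> cring R \<and> (\<exists>!M. maximalideal M R)"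

definition max_ideal :: "('a, 'b) ring_scheme \<Rightarrow> 'a set" where
  "max_ideal R = (THE M. maximalideal M R)"

definition regular_local_ring :: "('a, 'b) ring_scheme \<Rightarrow> bool" where
  "regular_local_ring R \<longleftrightarrow> noetherian_cring R \<and> local_ring R \<and>
     (\<exists>A\<subseteq>carrier R. finite A \<and> enat (card A) = krull_dim R \<and> max_ideal R = Idl\<^bsub>R\<^esub> A)"

definition regular_ring :: "('a, 'b) ring_scheme \<Rightarrow> bool" where
  "regular_ring R \<longleftrightarrow> noetherian_cring R \<and>
     (\<forall>P. primeideal P R \<longrightarrow> regular_local_ring (localization_at R P))"

definition regular_sequence :: "('a, 'b) ring_scheme \<Rightarrow> 'a list \<Rightarrow> bool" where
  "regular_sequence R xs \<longleftrightarrow> set xs \<subseteq> carrier R \<and>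
     (\<forall>i<length xs. \<forall>r\<in>carrier R.
        xs ! i \<otimes>\<^bsub>R\<^esub> r \<in> Idl\<^bsub>R\<^esub> (set (take i xs)) \<longrightarrow> r \<in> Idl\<^bsub>R\<^esub> (set (take i xs))) \<and>
     Idl\<^bsub>R\<^esub> (set xs) \<noteq> carrier R"

definition depth :: "('a, 'b) ring_scheme \<Rightarrow> enat" where
  "depth R = Sup {enat (length xs) | xs. set xs \<subseteq> max_ideal R \<and> regular_sequence R xs}"

definition cohen_macaulay_local_ring :: "('a, 'b) ring_scheme \<Rightarrow> bool" where
  "cohen_macaulay_local_ring R \<longleftrightarrow>
     noetherian_cring R \<and> local_ring R \<and> depth R = krull_dim R"

definition cohen_macaulay_ring :: "('a, 'b) ring_scheme \<Rightarrow> bool" where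
  "cohen_macaulay_ring R \<longleftrightarrow> noetherian_cring R \<and>
     (\<forall>P. primeideal P R \<longrightarrow> cohen_macaulay_local_ring (localization_at R P))"


section \<open>Algebras of finite type; universally catenary and J-2 rings\<close>

definition finite_type :: "('a, 'b) ring_scheme \<Rightarrow> ('c, 'd) ring_scheme \<Rightarrow> ('a \<Rightarrow> 'c) \<Rightarrow> bool" where
  "finite_type R S h \<longleftrightarrow> cring S \<and> h \<in> ring_hom R S \<and>
     (\<exists>E\<subseteq>carrier S. finite E \<and> generate_ring S (h ` carrier R \<union> E) = carrier S)"

definition saturated_chain :: "('a, 'b) ring_scheme \<Rightarrow> (nat \<Rightarrow> 'a set) \<Rightarrow> nat \<Rightarrow> bool" where
  "saturated_chain R C n \<longleftrightarrow> prime_chain R C n \<and>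
     (\<forall>i<n. \<nexists>P. primeideal P R \<and> C i \<subset> P \<and> P \<subset> C (Suc i))"

definition catenary :: "('a, 'b) ring_scheme \<Rightarrow> bool" where
  "catenary R \<longleftrightarrow> (\<forall>P Q. primeideal P R \<and> primeideal Q R \<and> P \<subseteq> Q \<longrightarrow>
     (\<exists>N. \<forall>C n. prime_chain R C n \<and> C 0 = P \<and> C n = Q \<longrightarrow> n \<le> N) \<and>
     (\<forall>C m D n. saturated_chain R C m \<and> C 0 = P \<and> C m = Q \<and>
                saturated_chain R D n \<and> D 0 = P \<and> D n = Q \<longrightarrow> m = n))"

text \<open>
  ``Every \<open>R\<close>-algebra of finite type'' is rendered by quantifying over the ring structures on
  subsets of the type \<^typ>\<open>nat \<Rightarrow> 'a\<close>, where \<^typ>\<open>'a\<close> is the type of elements of \<open>R\<close>.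
  Nothing is lost: a finite type \<open>R\<close>-algebra is trivial if \<open>R\<close> is, and otherwise its cardinality is
  at most the maximum of those of \<open>R\<close> and of the natural numbers, so that it is isomorphic
  to an algebra of this kind.
\<close>

definition universally_catenary :: "('a, 'b) ring_scheme \<Rightarrow> bool" where
  "universally_catenary R \<longleftrightarrow> noetherian_cring R \<and>
     (\<forall>(S :: (nat \<Rightarrow> 'a) ring) h. finite_type R S h \<longrightarrow> catenary S)"

definition zariski_open :: "('a, 'b) ring_scheme \<Rightarrow> 'a set set \<Rightarrow> bool" where
  "zariski_open R U \<longleftrightarrow> (\<exists>E\<subseteq>carrier R. U = {P. primeideal P R \<and> \<not> E \<subseteq> P})"

definition regular_locus :: "('a, 'b) ring_scheme \<Rightarrow> 'a set set" where
  "regular_locus R = {P. primeideal P R \<and> regular_local_ring (localization_at R P)}"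

definition J2_ring :: "('a, 'b) ring_scheme \<Rightarrow> bool" where
  "J2_ring R \<longleftrightarrow> noetherian_cring R \<and>
     (\<forall>(S :: (nat \<Rightarrow> 'a) ring) h. finite_type R S h \<longrightarrow> zariski_open S (regular_locus S))"


section \<open>Completion\<close>

text \<open>
  The inverse limit of the quotients \<open>R/I\<^sup>n\<close>. Its elements are sequences of cosets; the
  transition maps send the coset \<open>x (n + 1)\<close> to the unique coset of \<open>I\<^sup>n\<close> containing it.
\<close>

definition adic_completion :: "('a, 'b) ring_scheme \<Rightarrow> 'a set \<Rightarrow> (nat \<Rightarrow> 'a set) ring" where
  "adic_completion R I =
     \<lparr> carrier = {x. \<forall>n. x n \<in> carrier (R Quot ideal_power R I n) \<and> x (Suc n) \<subseteq> x n},
       mult = (\<lambda>x y n. x n \<otimes>\<^bsub>R Quot ideal_power R I n\<^esub> y n),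
       one = (\<lambda>n. \<one>\<^bsub>R Quot ideal_power R I n\<^esub>),
       zero = (\<lambda>n. \<zero>\<^bsub>R Quot ideal_power R I n\<^esub>),
       add = (\<lambda>x y n. x n \<oplus>\<^bsub>R Quot ideal_power R I n\<^esub> y n) \<rparr>"

definition completion_map :: "('a, 'b) ring_scheme \<Rightarrow> 'a set \<Rightarrow> 'a \<Rightarrow> (nat \<Rightarrow> 'a set)" where
  "completion_map R I a = (\<lambda>n. ideal_power R I n +>\<^bsub>R\<^esub> a)"


section \<open>Tensor products of algebras\<close>

definition int_monoid_ring :: "('m, 'd) monoid_scheme \<Rightarrow> ('m \<Rightarrow> int) ring" where
  "int_monoid_ring G =
     \<lparr> carrier = {F. finite {x. F x \<noteq> 0} \<and> {x. F x \<noteq> 0} \<subseteq> carrier G},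
       mult = (\<lambda>F H z. \<Sum>(x, y) | F x \<noteq> 0 \<and> H y \<noteq> 0 \<and> x \<otimes>\<^bsub>G\<^esub> y = z. F x * H y),
       one = (\<lambda>x. if x = \<one>\<^bsub>G\<^esub> then 1 else 0),
       zero = (\<lambda>x. 0),
       add = (\<lambda>F H x. F x + H x) \<rparr>"

definition basis_elem :: "'m \<Rightarrow> 'm \<Rightarrow> int" where
  "basis_elem x = (\<lambda>y. if y = x then 1 else 0)"

text \<open>
  For homomorphisms \<open>f : A \<rightarrow> B\<close> and \<open>g : A \<rightarrow> C\<close>, the tensor product of \<open>B\<close> and \<open>C\<close> over \<open>A\<close> is the
  free abelian group on the pairs \<open>(b, c)\<close> modulo the bilinearity relations. The free abelian group
  is the monoid ring of the multiplicative monoid of pairs, and the subgroup generated by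
  the relations is an ideal in it, since multiplying a relation by a pair gives a relation.
\<close>

definition tensor_relations ::
  "('a, 'r) ring_scheme \<Rightarrow> ('b, 's) ring_scheme \<Rightarrow> ('a \<Rightarrow> 'b) \<Rightarrow>
   ('c, 't) ring_scheme \<Rightarrow> ('a \<Rightarrow> 'c) \<Rightarrow> ('b \<times> 'c \<Rightarrow> int) set" where
  "tensor_relations A B f C g =
     {(\<lambda>z. basis_elem (b \<oplus>\<^bsub>B\<^esub> b', c) z - basis_elem (b, c) z - basis_elem (b', c) z)
        | b b' c. b \<in> carrier B \<and> b' \<in> carrier B \<and> c \<in> carrier C} \<union>
     {(\<lambda>z. basis_elem (b, c \<oplus>\<^bsub>C\<^esub> c') z - basis_elem (b, c) z - basis_elem (b, c') z)
        | b c c'. b \<in> carrier B \<and> c \<in> carrier C \<and> c' \<in> carrier C} \<union>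
     {(\<lambda>z. basis_elem (f a \<otimes>\<^bsub>B\<^esub> b, c) z - basis_elem (b, g a \<otimes>\<^bsub>C\<^esub> c) z)
        | a b c. a \<in> carrier A \<and> b \<in> carrier B \<and> c \<in> carrier C}"

definition tensor_ideal ::
  "('a, 'r) ring_scheme \<Rightarrow> ('b, 's) ring_scheme \<Rightarrow> ('a \<Rightarrow> 'b) \<Rightarrow>
   ('c, 't) ring_scheme \<Rightarrow> ('a \<Rightarrow> 'c) \<Rightarrow> ('b \<times> 'c \<Rightarrow> int) set" where
  "tensor_ideal A B f C g = Idl\<^bsub>int_monoid_ring (B \<times>\<times> C)\<^esub> (tensor_relations A B f C g)"

definition tensor_ring ::
  "('a, 'r) ring_scheme \<Rightarrow> ('b, 's) ring_scheme \<Rightarrow> ('a \<Rightarrow> 'b) \<Rightarrow>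
   ('c, 't) ring_scheme \<Rightarrow> ('a \<Rightarrow> 'c) \<Rightarrow> (('b \<times> 'c \<Rightarrow> int) set) ring" where
  "tensor_ring A B f C g = int_monoid_ring (B \<times>\<times> C) Quot tensor_ideal A B f C g"

definition pure_tensor ::
  "('a, 'r) ring_scheme \<Rightarrow> ('b, 's) ring_scheme \<Rightarrow> ('a \<Rightarrow> 'b) \<Rightarrow>
   ('c, 't) ring_scheme \<Rightarrow> ('a \<Rightarrow> 'c) \<Rightarrow> 'b \<Rightarrow> 'c \<Rightarrow> ('b \<times> 'c \<Rightarrow> int) set" where
  "pure_tensor A B f C g b c =
     tensor_ideal A B f C g +>\<^bsub>int_monoid_ring (B \<times>\<times> C)\<^esub> basis_elem (b, c)"


section \<open>Formal fibres and G-rings\<close>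

abbreviation (input) residue_kernel :: "('a, 'b) ring_scheme \<Rightarrow> 'a set \<Rightarrow> ('a \<times> 'a) set set" where
  "residue_kernel R P \<equiv> extended_ideal (localization_at R P) (loc_map R (carrier R - P)) P"

definition residue_field :: "('a, 'b) ring_scheme \<Rightarrow> 'a set \<Rightarrow> (('a \<times> 'a) set set) ring" where
  "residue_field R P = localization_at R P Quot residue_kernel R P"

definition residue_map :: "('a, 'b) ring_scheme \<Rightarrow> 'a set \<Rightarrow> 'a \<Rightarrow> ('a \<times> 'a) set set" where
  "residue_map R P a =
     residue_kernel R P +>\<^bsub>localization_at R P\<^esub> loc_map R (carrier R - P) a"

text \<open>
  A \<open>k\<close>-algebra \<open>B\<close>, with structure map \<open>h\<close>, is geometrically regular if its base change to every
  finite extension field of \<open>k\<close> is regular. Every finite extension of \<open>k\<close> has an isomorphic copy with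
  elements in the type \<^typ>\<open>nat \<Rightarrow> 'k\<close>, by taking coordinates with respect to a basis.
\<close>

definition geometrically_regular ::
  "('k, 'r) ring_scheme \<Rightarrow> ('b, 's) ring_scheme \<Rightarrow> ('k \<Rightarrow> 'b) \<Rightarrow> bool" where
  "geometrically_regular k B h \<longleftrightarrow>
     (\<forall>(L :: (nat \<Rightarrow> 'k) ring) j.
        field L \<and> j \<in> ring_hom k L \<and> ring.finite_dimension L (j ` carrier k) (carrier L) \<longrightarrow>
        regular_ring (tensor_ring k B h L j))"

definition geometrically_regular_fibres ::
  "('a, 'r) ring_scheme \<Rightarrow> ('b, 's) ring_scheme \<Rightarrow> ('a \<Rightarrow> 'b) \<Rightarrow> bool" where
  "geometrically_regular_fibres A B h \<longleftrightarrow>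
     (\<forall>Q. primeideal Q A \<longrightarrow>
        geometrically_regular (residue_field A Q)
          (tensor_ring A B h (residue_field A Q) (residue_map A Q))
          (pure_tensor A B h (residue_field A Q) (residue_map A Q) \<one>\<^bsub>B\<^esub>))"

text \<open>
  The homomorphism from a Noetherian local ring to its completion is always flat, so requiring it
  to be a regular homomorphism amounts to requiring geometrically regular fibres.
\<close>

definition G_ring :: "('a, 'b) ring_scheme \<Rightarrow> bool" where
  "G_ring R \<longleftrightarrow> noetherian_cring R \<and>
     (\<forall>P. primeideal P R \<longrightarrow>
        (let A = localization_at R P; M = max_ideal A
         in geometrically_regular_fibres A (adic_completion A M) (completion_map A M)))"

definition excellent_ring :: "('a, 'b) ring_scheme \<Rightarrow> bool" where
  "excellent_ring R \<longleftrightarrow>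
     noetherian_cring R \<and> universally_catenary R \<and> G_ring R \<and> J2_ring R"

end

theory Submission
  imports Defs "HOL-Algebra.Weak_Morphisms" "HOL-Library.List_Lexorder"
begin

text \<open>
  Fix a minimal prime \<open>P\<close> of \<open>I\<close>. Inverting a suitable element outside \<open>P\<close> makes \<open>P\<close> the only
  minimal prime of \<open>I\<close> and, by the openness of the regular locus of \<open>R/P\<close>, makes \<open>R/P\<close> regular,
  hence Cohen-Macaulay. It then suffices to filter every \<open>R/I\<^sup>n\<close> by ideals in such a way that the
  successive quotients are isomorphic to \<open>R/P\<close> or killed by the inverted element: a sequence that
  is regular on \<open>(R/P)\<^sub>Q\<close> is regular on every successive extension of copies of \<open>(R/P)\<^sub>Q\<close>, and
  \<open>R/P\<close> and \<open>R/I\<^sup>n\<close> have the same dimension at \<open>Q\<close>.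

  The point is to find one element that works for all \<open>n\<close>. Write \<open>I = (g\<^sub>1, ..., g\<^sub>m)\<close> and add the
  monomials of degree \<open>n\<close> in the \<open>g\<^sub>i\<close> to \<open>I\<^sup>n\<^sup>+\<^sup>1\<close> one at a time, in lexicographic order. The quotient
  added by the monomial \<open>g\<^sup>\<mu>\<close> is \<open>R/c\<^sub>\<mu>\<close> for a colon ideal \<open>c\<^sub>\<mu> \<supseteq> I\<close>, and \<open>c\<^sub>\<mu>\<close> grows with \<open>\<mu>\<close>
  under divisibility. By Dickson's lemma and the Noetherian property, only finitely many ideals
  occur among all \<open>c\<^sub>\<mu>\<close> (\<open>monotone_ideal_map_finite\<close>); this is a Groebner basis argument for generic
  freeness of the associated graded ring of \<open>I\<close>. Each of these finitely many \<open>R/c\<^sub>\<mu>\<close> has a prime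
  filtration, in which every prime other than \<open>P\<close> contains an element outside \<open>P\<close>
  (\<open>generic_cyclic_filtration\<close>). The product of these elements serves all \<open>n\<close>
  (\<open>generic_cyclic_filtration_powers\<close>).

  Finally, the elements \<open>f\<close> such that all \<open>R/I\<^sup>n\<close> are Cohen-Macaulay at the primes avoiding \<open>f\<close>
  form an ideal. It is contained in no minimal prime of \<open>I\<close>, so by prime avoidance it has an element
  outside all of them, in particular outside those of maximal dimension.

  Localizations are handled inside \<open>R\<close> as far as possible. An ideal of a fraction ring with
  denominators \<open>S\<close> is represented by its saturation \<open>sat R S J\<close> in \<open>R\<close>, and
  the locale \<open>fraction_hom\<close> describes all rings of the form \<open>S\<^sup>-\<^sup>1(R/J)\<close> at once, so that the iterated
  localizations and quotients in the statement need only be recognized as instances. The dimension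
  theory that enters is Krull's principal ideal theorem (\<open>krull_principal_ideal\<close>), from which it
  follows that a regular local ring has a regular sequence as long as its dimension
  (\<open>regular_parameters_regular\<close>), and the bound of the depth by the dimension
  (\<open>depth_le_krull_dim\<close>).
\<close>

section \<open>Ideals, colon ideals and saturations\<close>


context cring begin

lemma ideal_add: "ideal J R \<Longrightarrow> a \<in> J \<Longrightarrow> b \<in> J \<Longrightarrow> a \<oplus> b \<in> J"
  by (simp add: additive_subgroup.a_closed ideal.axioms(1))

lemma ideal_zero: "ideal J R \<Longrightarrow> \<zero> \<in> J"
  by (simp add: additive_subgroup.zero_closed ideal.axioms(1))

lemma ideal_minus: "ideal J R \<Longrightarrow> a \<in> J \<Longrightarrow> b \<in> J \<Longrightarrow> a \<ominus> b \<in> J"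
  by (simp add: a_minus_def additive_subgroup.a_closed additive_subgroup.a_inv_closed ideal.axioms(1))

lemma ideal_mult_left: "ideal J R \<Longrightarrow> a \<in> J \<Longrightarrow> r \<in> carrier R \<Longrightarrow> r \<otimes> a \<in> J"
  by (rule ideal.I_l_closed)

lemma ideal_mult_right: "ideal J R \<Longrightarrow> a \<in> J \<Longrightarrow> r \<in> carrier R \<Longrightarrow> a \<otimes> r \<in> J"
  by (rule ideal.I_r_closed)

lemma ideal_subset: "ideal J R \<Longrightarrow> J \<subseteq> carrier R"
  by (rule subsetI) (rule ideal.Icarr)

lemmas ideal_closed = ideal_add ideal_zero ideal_minus ideal_mult_left ideal_mult_right

lemma ideal_eq_carrier: "ideal J R \<Longrightarrow> \<one> \<in> J \<Longrightarrow> J = carrier R"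
  by (rule ideal.one_imp_carrier)

lemma ideal_addD: "ideal J R \<Longrightarrow> a \<in> J \<Longrightarrow> b \<in> carrier R \<Longrightarrow> a \<oplus> b \<in> J \<Longrightarrow> b \<in> J"
proof -
  assume J: "ideal J R" and a: "a \<in> J" and b: "b \<in> carrier R" and ab: "a \<oplus> b \<in> J"
  have "a \<in> carrier R" using J a by (rule ideal.Icarr)
  then have "b = (a \<oplus> b) \<ominus> a"
    using b by (simp add: a_comm[of a b] a_minus_def a_assoc r_neg)
  then show "b \<in> J" using ideal_minus[OF J ab a] by simp
qed

text \<open>
  All chains of ideals below are built by adjoining one element at a time; this is the normal form
  of the elements of the larger ideal.
\<close>

lemma mem_adjoin:
  assumes J: "ideal J R" and a: "a \<in> carrier R"
  shows "z \<in> Idl (insert a J) \<longleftrightarrow> (\<exists>j\<in>J. \<exists>r\<in>carrier R. z = j \<oplus> r \<otimes> a)"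
proof -
  have "Idl (insert a J) = Idl (J \<union> PIdl a)"
  proof (intro equalityI genideal_minimal genideal_ideal)
    have sub: "J \<union> PIdl a \<subseteq> carrier R"
      using ideal_subset[OF J] ideal_subset[OF cgenideal_ideal[OF a]] by blast
    then show "J \<union> PIdl a \<subseteq> carrier R" .
    show "insert a J \<subseteq> Idl (J \<union> PIdl a)"
      using genideal_self[OF sub] cgenideal_self[OF a] by blast
    have sub2: "insert a J \<subseteq> carrier R"
      using ideal_subset[OF J] a by blast
    then show "insert a J \<subseteq> carrier R" .
    have "PIdl a \<subseteq> Idl (insert a J)"
      using genideal_self[OF sub2] by (intro cgenideal_minimal genideal_ideal[OF sub2]) blast
    then show "J \<union> PIdl a \<subseteq> Idl (insert a J)"
      using genideal_self[OF sub2] by blast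
  qed
  also have "\<dots> = J <+> PIdl a"
    by (rule union_genideal[OF J cgenideal_ideal[OF a]])
  finally show ?thesis
    by (auto simp: set_add_def' cgenideal_def)
qed

lemma adjoin_ideal: "ideal J R \<Longrightarrow> a \<in> carrier R \<Longrightarrow> ideal (Idl (insert a J)) R"
  by (intro genideal_ideal insert_subsetI ideal_subset)

lemma adjoin_upper: "ideal J R \<Longrightarrow> a \<in> carrier R \<Longrightarrow> insert a J \<subseteq> Idl (insert a J)"
  by (intro genideal_self insert_subsetI ideal_subset)

lemma Idl_ideal: "ideal J R \<Longrightarrow> Idl J = J"
  by (intro equalityI genideal_minimal genideal_self ideal_subset order_refl)

lemma Idl_Un_ideal:
  assumes "A \<subseteq> carrier R" and "B \<subseteq> carrier R"
  shows "Idl (A \<union> Idl B) = Idl (A \<union> B)"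
proof (intro equalityI genideal_minimal genideal_ideal)
  have AB: "A \<union> B \<subseteq> carrier R" using assms by blast
  then show "A \<union> B \<subseteq> carrier R" .
  have "Idl B \<subseteq> Idl (A \<union> B)"
    by (intro genideal_minimal genideal_ideal AB) (use genideal_self[OF AB] in blast)
  then show "A \<union> Idl B \<subseteq> Idl (A \<union> B)" using genideal_self[OF AB] by blast
  have AB': "A \<union> Idl B \<subseteq> carrier R"
    using assms ideal_subset[OF genideal_ideal[OF assms(2)]] by blast
  then show "A \<union> Idl B \<subseteq> carrier R" .
  show "A \<union> B \<subseteq> Idl (A \<union> Idl B)"
    using genideal_self[OF AB'] genideal_self[OF assms(2)] by blast
qed

end

definition colon :: "('a, 'b) ring_scheme \<Rightarrow> 'a set \<Rightarrow> 'a \<Rightarrow> 'a set" where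
  "colon R J a = {r \<in> carrier R. r \<otimes>\<^bsub>R\<^esub> a \<in> J}"

text \<open>
  This is the contraction to \<open>R\<close> of the extension of \<open>J\<close> to the ring of fractions with denominators
  in \<open>S\<close>, so that membership in extended ideals can be discussed inside \<open>R\<close>.
\<close>

definition sat :: "('a, 'b) ring_scheme \<Rightarrow> 'a set \<Rightarrow> 'a set \<Rightarrow> 'a set" where
  "sat R S J = {r \<in> carrier R. \<exists>s\<in>S. s \<otimes>\<^bsub>R\<^esub> r \<in> J}"

context cring begin

lemma idealI':
  assumes sub: "J \<subseteq> carrier R" and z: "\<zero> \<in> J"
    and add: "\<And>a b. a \<in> J \<Longrightarrow> b \<in> J \<Longrightarrow> a \<oplus> b \<in> J"
    and mult: "\<And>r a. r \<in> carrier R \<Longrightarrow> a \<in> J \<Longrightarrow> r \<otimes> a \<in> J"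
  shows "ideal J R"
proof (rule idealI[OF ring_axioms])
  show "subgroup J (add_monoid R)"
  proof (rule subgroup.intro)
    fix a assume a: "a \<in> J"
    then have "(\<ominus> \<one>) \<otimes> a \<in> J" by (intro mult) auto
    moreover have "(\<ominus> \<one>) \<otimes> a = \<ominus> a" using a sub by (auto simp: l_minus)
    ultimately show "inv\<^bsub>add_monoid R\<^esub> a \<in> J" by (simp add: a_inv_def)
  qed (use sub z add in auto)
next
  fix a x assume "a \<in> J" "x \<in> carrier R"
  then show "x \<otimes> a \<in> J" "a \<otimes> x \<in> J"
    using mult[of x a] sub m_comm[of a x] by auto
qed

lemma colon_ideal:
  assumes J: "ideal J R" and a: "a \<in> carrier R"
  shows "ideal (colon R J a) R"
proof (rule idealI')
  fix r b assume "r \<in> carrier R" "b \<in> colon R J a"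
  then show "r \<otimes> b \<in> colon R J a"
    using a ideal_mult_left[OF J, of "b \<otimes> a" r] by (simp add: colon_def m_assoc)
qed (use a J in \<open>auto simp: colon_def l_distr ideal_zero intro: ideal_add\<close>)

lemma subset_colon: "ideal J R \<Longrightarrow> a \<in> carrier R \<Longrightarrow> J \<subseteq> colon R J a"
  by (auto simp: colon_def ideal_mult_right ideal.Icarr)

lemma sat_upper: "submonoid S R \<Longrightarrow> ideal J R \<Longrightarrow> J \<subseteq> sat R S J"
  unfolding sat_def by (auto intro!: bexI[of _ \<one>] submonoid.one_closed ideal.Icarr simp: ideal.Icarr)

lemma submonoid_carrier: "submonoid S R \<Longrightarrow> s \<in> S \<Longrightarrow> s \<in> carrier R"
  by (rule submonoid.mem_carrier)

lemma sat_ideal: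
  assumes S: "submonoid S R" and J: "ideal J R"
  shows "ideal (sat R S J) R"
proof (rule idealI')
  show "sat R S J \<subseteq> carrier R" by (auto simp: sat_def)
  show "\<zero> \<in> sat R S J" using sat_upper[OF assms] ideal_zero[OF J] by blast
next
  fix a b assume "a \<in> sat R S J" "b \<in> sat R S J"
  then obtain s t where st: "s \<in> S" "t \<in> S" "s \<otimes> a \<in> J" "t \<otimes> b \<in> J" "a \<in> carrier R" "b \<in> carrier R"
    by (auto simp: sat_def)
  then have c: "s \<in> carrier R" "t \<in> carrier R" using submonoid_carrier[OF S] by auto
  have "t \<otimes> (s \<otimes> a) \<oplus> s \<otimes> (t \<otimes> b) \<in> J"
    using st c by (simp add: ideal_closed[OF J])
  also have "t \<otimes> (s \<otimes> a) \<oplus> s \<otimes> (t \<otimes> b) = (s \<otimes> t) \<otimes> (a \<oplus> b)"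
    using st c by (simp add: r_distr m_ac)
  finally show "a \<oplus> b \<in> sat R S J"
    using st c submonoid.m_closed[OF S] by (auto simp: sat_def)
next
  fix r a assume ra: "r \<in> carrier R" "a \<in> sat R S J"
  then obtain s where s: "s \<in> S" "s \<otimes> a \<in> J" "a \<in> carrier R" by (auto simp: sat_def)
  then have c: "s \<in> carrier R" using submonoid_carrier[OF S] by auto
  have "r \<otimes> (s \<otimes> a) \<in> J" using s ra by (simp add: ideal_closed[OF J])
  also have "r \<otimes> (s \<otimes> a) = s \<otimes> (r \<otimes> a)" using s c ra by (simp add: m_ac)
  finally show "r \<otimes> a \<in> sat R S J" using s ra by (auto simp: sat_def)
qed

lemma sat_cancel:
  assumes S: "submonoid S R" and J: "ideal J R"
    and r: "r \<in> carrier R" and s: "s \<in> S" "s \<otimes> r \<in> sat R S J"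
  shows "r \<in> sat R S J"
proof -
  from s(2) obtain t where t: "t \<in> S" "t \<otimes> (s \<otimes> r) \<in> J" by (auto simp: sat_def)
  have "t \<otimes> (s \<otimes> r) = (t \<otimes> s) \<otimes> r"
    using submonoid_carrier[OF S] s t r by (simp add: m_ac)
  then show ?thesis
    using t s r submonoid.m_closed[OF S] by (auto simp: sat_def)
qed

lemma sat_idem:
  assumes S: "submonoid S R" and J: "ideal J R"
  shows "sat R S (sat R S J) = sat R S J"
  using sat_cancel[OF assms] sat_upper[OF S sat_ideal[OF assms]] by (auto simp: sat_def[of R S "sat R S J"])

lemma sat_mono: "J \<subseteq> K \<Longrightarrow> sat R S J \<subseteq> sat R S K"
  by (auto simp: sat_def)

lemma primeideal_complement_submonoid:
  assumes "primeideal P R" shows "submonoid (carrier R - P) R"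
proof -
  interpret primeideal P R by fact
  have "\<one> \<notin> P" using I_notcarr one_imp_carrier by blast
  then show ?thesis
    by (intro submonoid.intro) (auto dest: I_prime)
qed

lemma prime_ideal: "primeideal P R \<Longrightarrow> ideal P R"
  by (rule primeideal.axioms(1))

lemma prime_one: "primeideal P R \<Longrightarrow> \<one> \<notin> P"
  by (metis primeideal.I_notcarr ideal_eq_carrier prime_ideal)

lemma prime_mem: "primeideal P R \<Longrightarrow> a \<in> carrier R \<Longrightarrow> b \<in> carrier R \<Longrightarrow> a \<otimes> b \<in> P \<Longrightarrow> a \<in> P \<or> b \<in> P"
  by (rule primeideal.I_prime)

lemma prime_pow_mem: "primeideal P R \<Longrightarrow> a \<in> carrier R \<Longrightarrow> a [^] (n::nat) \<in> P \<Longrightarrow> a \<in> P"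
proof (induction n)
  case (Suc n)
  then have "a [^] n \<in> P \<or> a \<in> P" by (intro prime_mem) auto
  then show ?case using Suc by blast
qed (simp add: prime_one)

lemma sat_prime:
  assumes P: "primeideal P R" and S: "submonoid S R" and disj: "S \<inter> P = {}"
  shows "sat R S P = P"
proof (rule equalityI[OF subsetI sat_upper[OF S prime_ideal[OF P]]])
  fix r assume "r \<in> sat R S P"
  then obtain s where s: "r \<in> carrier R" "s \<in> S" "s \<otimes> r \<in> P" by (auto simp: sat_def)
  then have "s \<in> P \<or> r \<in> P" by (intro prime_mem[OF P] submonoid_carrier[OF S, of s])
  then show "r \<in> P" using s disj by blast
qed

end

section \<open>Noetherian rings\<close>

locale noeth_cring = cring + noetherian_ring

context noeth_cring begin

lemma ideal_maximal_exists:
  assumes ne: "X \<noteq> {}" and ideals: "\<And>J. J \<in> X \<Longrightarrow> ideal J R"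
  obtains M where "M \<in> X" "\<And>J. J \<in> X \<Longrightarrow> M \<subseteq> J \<Longrightarrow> J = M"
proof -
  have "\<exists>M\<in>X. \<forall>J\<in>X. M \<subseteq> J \<longrightarrow> J = M"
  proof (rule subset_Zorn)
    fix C assume C: "subset.chain X C"
    show "\<exists>U\<in>X. \<forall>J\<in>C. J \<subseteq> U"
    proof (cases "C = {}")
      case True then show ?thesis using ne by blast
    next
      case False
      have "subset.chain {I. ideal I R} C"
        using C ideals by (auto simp: subset.chain_def)
      then have "\<Union>C \<in> C" using False ideal_chain_is_trivial by blast
      then show ?thesis using C by (auto simp: subset.chain_def)
    qed
  qed
  then show ?thesis using that by blast
qed

lemma ideal_induct [consumes 1, case_names larger]:
  assumes "ideal J R"
    and "\<And>J. ideal J R \<Longrightarrow> (\<And>K. ideal K R \<Longrightarrow> J \<subset> K \<Longrightarrow> Q K) \<Longrightarrow> Q J"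
  shows "Q J"
proof (rule ccontr)
  assume "\<not> Q J"
  then have ne: "{J. ideal J R \<and> \<not> Q J} \<noteq> {}" using assms(1) by blast
  obtain M where M: "M \<in> {J. ideal J R \<and> \<not> Q J}"
    and max: "\<And>K. K \<in> {J. ideal J R \<and> \<not> Q J} \<Longrightarrow> M \<subseteq> K \<Longrightarrow> K = M"
    by (rule ideal_maximal_exists[OF ne]) auto
  have "Q K" if "ideal K R" "M \<subset> K" for K
    using max[of K] that by blast
  then have "Q M" using M assms(2)[of M] by simp
  then show False using M by simp
qed

lemma ascending_ideals_stationary:
  fixes J :: "nat \<Rightarrow> 'a set"
  assumes "\<And>n. ideal (J n) R" and "\<And>n. J n \<subseteq> J (Suc n)"
  shows "\<exists>N. \<forall>n\<ge>N. J n = J N"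
proof -
  have "range J \<noteq> {}" by simp
  then obtain M where M: "M \<in> range J" "\<And>K. K \<in> range J \<Longrightarrow> M \<subseteq> K \<Longrightarrow> K = M"
    by (rule ideal_maximal_exists) (use assms(1) in auto)
  then obtain N where "M = J N" by blast
  then have N: "J n = J N" if "J N \<subseteq> J n" for n
    using M(2)[of "J n"] that by simp
  then have "\<forall>n\<ge>N. J n = J N"
    using lift_Suc_mono_le[of J, OF assms(2)] by blast
  then show ?thesis by blast
qed

text \<open>
  An ideal maximal among those containing \<open>J\<close> and disjoint from \<open>S\<close> is prime.
\<close>

lemma prime_avoiding_submonoid:
  assumes J: "ideal J R" and S: "submonoid S R" and disj: "J \<inter> S = {}"
  obtains N where "primeideal N R" "J \<subseteq> N" "N \<inter> S = {}"
proof -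
  let ?X = "{K. ideal K R \<and> J \<subseteq> K \<and> K \<inter> S = {}}"
  have ne: "?X \<noteq> {}" using J disj by blast
  obtain M where M': "M \<in> ?X" and max: "\<And>K. K \<in> ?X \<Longrightarrow> M \<subseteq> K \<Longrightarrow> K = M"
    by (rule ideal_maximal_exists[OF ne]) auto
  then have M: "ideal M R" "J \<subseteq> M" "M \<inter> S = {}" by simp_all
  have hit: "\<exists>m\<in>M. \<exists>r\<in>carrier R. m \<oplus> r \<otimes> a \<in> S" if a: "a \<in> carrier R" "a \<notin> M" for a
  proof -
    have "Idl (insert a M) \<inter> S \<noteq> {}"
      using max[of "Idl (insert a M)"] adjoin_ideal[OF M(1) a(1)] adjoin_upper[OF M(1) a(1)] a(2) M(2)
      by auto
    then show ?thesis by (auto simp: mem_adjoin[OF M(1) a(1)])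
  qed
  have "primeideal M R"
  proof (rule primeidealI[OF M(1) is_cring])
    show "carrier R \<noteq> M" using M(3) submonoid.one_closed[OF S] by auto
    fix a b assume ab: "a \<in> carrier R" "b \<in> carrier R" "a \<otimes> b \<in> M"
    show "a \<in> M \<or> b \<in> M"
    proof (rule ccontr)
      assume "\<not> (a \<in> M \<or> b \<in> M)"
      then have "a \<notin> M" "b \<notin> M" by auto
      from hit[OF ab(1) this(1)] hit[OF ab(2) this(2)] obtain m r m' r'
        where *: "m \<in> M" "r \<in> carrier R" "m \<oplus> r \<otimes> a \<in> S"
          "m' \<in> M" "r' \<in> carrier R" "m' \<oplus> r' \<otimes> b \<in> S"
        by (elim bexE)
      have c: "m \<in> carrier R" "m' \<in> carrier R" using ideal.Icarr[OF M(1)] * by simp_all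
      have "(m\<oplus>r\<otimes>a)\<otimes>(m'\<oplus>r'\<otimes>b) = (m \<otimes> (m'\<oplus>r'\<otimes>b) \<oplus> (r\<otimes>a)\<otimes>m') \<oplus> (r\<otimes>r')\<otimes>(a\<otimes>b)"
        using * c ab by (simp add: l_distr r_distr m_ac a_ac)
      also have "\<dots> \<in> M" using * c ab by (simp add: ideal_closed[OF M(1)])
      finally show False using submonoid.m_closed[OF S *(3,6)] M(3) by blast
    qed
  qed
  then show ?thesis using M that by blast
qed

text \<open>
  A colon ideal that is maximal among the colon ideals of elements outside \<open>J\<close> is prime: if \<open>y\<close> does
  not kill \<open>a\<close> modulo \<open>J\<close>, then \<open>y \<otimes> a\<close> has the same annihilator as \<open>a\<close>.
\<close>

lemma associated_prime_exists:
  assumes J: "ideal J R" and ne: "J \<noteq> carrier R"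
  obtains a where "a \<in> carrier R" "a \<notin> J" "primeideal (colon R J a) R"
proof -
  let ?X = "colon R J ` (carrier R - J)"
  have "?X \<noteq> {}" using ne ideal_subset[OF J] by blast
  then obtain M where "M \<in> ?X" and max': "\<And>K. K \<in> ?X \<Longrightarrow> M \<subseteq> K \<Longrightarrow> K = M"
    by (rule ideal_maximal_exists) (auto intro: colon_ideal[OF J])
  then obtain a where a: "a \<in> carrier R" "a \<notin> J" and Ma: "M = colon R J a" by auto
  have max: "colon R J b = colon R J a"
    if "b \<in> carrier R" "b \<notin> J" "colon R J a \<subseteq> colon R J b" for b
    using max'[of "colon R J b"] that unfolding Ma by simp
  have "primeideal (colon R J a) R"
  proof (rule primeidealI[OF colon_ideal[OF J a(1)] is_cring])
    show "carrier R \<noteq> colon R J a" using a by (auto simp: colon_def dest!: equalityD1 subsetD[of _ _ \<one>])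
    fix x y assume xy: "x \<in> carrier R" "y \<in> carrier R" "x \<otimes> y \<in> colon R J a"
    show "x \<in> colon R J a \<or> y \<in> colon R J a"
    proof (rule disjCI)
      assume "y \<notin> colon R J a"
      then have n: "y \<otimes> a \<notin> J" using xy by (auto simp: colon_def)
      have "colon R J a \<subseteq> colon R J (y \<otimes> a)"
      proof
        fix r assume "r \<in> colon R J a"
        then have r: "r \<in> carrier R" "y \<otimes> (r \<otimes> a) \<in> J"
          using ideal_mult_left[OF J] xy by (auto simp: colon_def)
        have "y \<otimes> (r \<otimes> a) = r \<otimes> (y \<otimes> a)" using r(1) xy a by (simp add: m_ac)
        then show "r \<in> colon R J (y \<otimes> a)" using r by (simp add: colon_def)
      qed
      then have "colon R J (y \<otimes> a) = colon R J a" using max[of "y \<otimes> a"] n xy a by simp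
      moreover have "x \<in> colon R J (y \<otimes> a)" using xy a by (simp add: colon_def m_assoc)
      ultimately show "x \<in> colon R J a" by simp
    qed
  qed
  then show ?thesis using a that by blast
qed

end

section \<open>Nakayama's lemma and Krull's principal ideal theorem\<close>

context cring begin

lemma add_ideals_mem: "z \<in> J <+> K \<longleftrightarrow> (\<exists>j\<in>J. \<exists>k\<in>K. z = j \<oplus> k)"
  by (auto simp: set_add_def')

lemma add_ideals_upper:
  assumes J: "ideal J R" and K: "ideal K R"
  shows "J \<union> K \<subseteq> J <+> K"
proof -
  have "j = j \<oplus> \<zero>" if "j \<in> J" for j using ideal.Icarr[OF J that] by simp
  moreover have "k = \<zero> \<oplus> k" if "k \<in> K" for k using ideal.Icarr[OF K that] by simp
  ultimately show ?thesis
    using ideal_zero[OF J] ideal_zero[OF K] by (fastforce simp: add_ideals_mem)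
qed

lemma satI: "r \<in> carrier R \<Longrightarrow> s \<in> S \<Longrightarrow> s \<otimes> r \<in> J \<Longrightarrow> r \<in> sat R S J"
  by (auto simp: sat_def)

lemma diff_mult_distrib:
  "s \<in> carrier R \<Longrightarrow> r \<in> carrier R \<Longrightarrow> a \<in> carrier R \<Longrightarrow> (s \<ominus> r) \<otimes> a = s \<otimes> a \<ominus> r \<otimes> a"
  by (simp add: a_minus_def l_distr l_minus)

lemma add_diff_cancel: "a \<in> carrier R \<Longrightarrow> b \<in> carrier R \<Longrightarrow> (a \<oplus> b) \<ominus> b = a"
  by (simp add: a_minus_def a_assoc r_neg)

lemma diff_add_cancel: "a \<in> carrier R \<Longrightarrow> b \<in> carrier R \<Longrightarrow> (a \<ominus> b) \<oplus> b = a"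
  by (simp add: a_minus_def a_assoc l_neg)

lemma ideal_diffD:
  assumes J: "ideal J R" and "a \<in> carrier R" "b \<in> J" "a \<ominus> b \<in> J"
  shows "a \<in> J"
  using ideal_add[OF J assms(4,3)] diff_add_cancel[of a b] assms(2) ideal.Icarr[OF J assms(3)] by simp

lemma prime_diff_notin:
  assumes P: "primeideal P R" and "s \<in> carrier R" "s \<notin> P" "r \<in> P"
  shows "s \<ominus> r \<in> carrier R - P"
  using ideal_diffD[OF prime_ideal[OF P], of s r] assms ideal.Icarr[OF prime_ideal[OF P]] by auto

end

context noeth_cring begin

text \<open>
  Nakayama's lemma over the local ring at \<open>M\<close>, for the ideals \<open>K\<close> and \<open>N\<close>. The premise \<open>step\<close> says
  that \<open>N\<close> lies in the saturation of \<open>K + M N\<close>: this is the smallest \<open>L\<close> as described there. The reason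
  is that a saturated ideal \<open>L \<supseteq> K\<close> that is maximal subject to not containing \<open>N\<close> satisfies
  \<open>M N \<subseteq> L\<close>, because a nonzero finitely generated module modulo a maximal proper submodule is simple.
\<close>

lemma nakayama:
  assumes M: "primeideal M R" and N: "ideal N R" and K: "ideal K R"
    and K_sat: "sat R (carrier R - M) K \<subseteq> K"
    and step: "\<And>L. \<lbrakk>ideal L R; K \<subseteq> L; sat R (carrier R - M) L \<subseteq> L;
                 \<And>x a. x \<in> M \<Longrightarrow> a \<in> N \<Longrightarrow> x \<otimes> a \<in> L\<rbrakk> \<Longrightarrow> N \<subseteq> L"
  shows "N \<subseteq> K"
proof (rule ccontr)
  let ?S = "carrier R - M"
  let ?X = "{L. ideal L R \<and> K \<subseteq> L \<and> sat R ?S L \<subseteq> L \<and> \<not> N \<subseteq> L}"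
  note S = primeideal_complement_submonoid[OF M]
  assume "\<not> N \<subseteq> K"
  then have ne: "?X \<noteq> {}" using K K_sat by blast
  obtain L where L': "L \<in> ?X" and max: "\<And>L'. L' \<in> ?X \<Longrightarrow> L \<subseteq> L' \<Longrightarrow> L' = L"
    by (rule ideal_maximal_exists[OF ne]) auto
  then have L: "ideal L R" "K \<subseteq> L" "sat R ?S L \<subseteq> L" "\<not> N \<subseteq> L" by simp_all
  have "x \<otimes> a \<in> L" if x: "x \<in> M" and a: "a \<in> N" for x a
  proof (rule ccontr)
    assume xa: "x \<otimes> a \<notin> L"
    have c: "x \<in> carrier R" "a \<in> carrier R"
      using ideal.Icarr[OF prime_ideal[OF M] x] ideal.Icarr[OF N a] by simp_all
    let ?L1 = "Idl (insert (x \<otimes> a) L)"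
    let ?L2 = "sat R ?S ?L1"
    have L1: "ideal ?L1 R" "insert (x \<otimes> a) L \<subseteq> ?L1"
      using adjoin_ideal[OF L(1)] adjoin_upper[OF L(1)] c by simp_all
    have L2: "ideal ?L2 R" "?L1 \<subseteq> ?L2" "sat R ?S ?L2 \<subseteq> ?L2"
      using sat_ideal[OF S L1(1)] sat_upper[OF S L1(1)] sat_idem[OF S L1(1)] by simp_all
    have "?L2 \<noteq> L" "L \<subseteq> ?L2" using L1 L2 xa by auto
    \<comment> \<open>By maximality the saturation of \<open>L + (x a)\<close> contains \<open>a\<close>, and \<open>1 - r x\<close> is a unit at \<open>M\<close>.\<close>
    then have "?L2 \<notin> ?X" using max[of ?L2] by auto
    then have "N \<subseteq> ?L2" using L2 L(2) \<open>L \<subseteq> ?L2\<close> by auto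
    then obtain s where s: "s \<in> ?S" "s \<otimes> a \<in> ?L1" using a by (auto simp: sat_def)
    then obtain k r where k: "k \<in> L" "r \<in> carrier R" "s \<otimes> a = k \<oplus> r \<otimes> (x \<otimes> a)"
      using mem_adjoin[OF L(1), of "x \<otimes> a"] c by auto
    have kc: "k \<in> carrier R" using ideal.Icarr[OF L(1) k(1)] .
    have "(s \<ominus> r \<otimes> x) \<otimes> a = s \<otimes> a \<ominus> r \<otimes> (x \<otimes> a)"
      using s c k by (simp add: diff_mult_distrib m_assoc)
    also have "\<dots> = k" using k c kc by (simp add: add_diff_cancel)
    finally have "(s \<ominus> r \<otimes> x) \<otimes> a \<in> L" using k by simp
    moreover have "s \<ominus> r \<otimes> x \<in> ?S"
      using s c k x by (intro prime_diff_notin[OF M] ideal_mult_left[OF prime_ideal[OF M]]) auto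
    ultimately have "a \<in> sat R ?S L" using c by (auto simp: sat_def)
    then have "a \<in> L" using L(3) by blast
    then show False using xa ideal_mult_left[OF L(1)] c by blast
  qed
  then have "N \<subseteq> L" by (intro step L)
  then show False using L by blast
qed

text \<open>
  If \<open>M\<close> is the only prime between \<open>B0\<close> and \<open>M\<close>, then the local ring of \<open>R/B0\<close> at \<open>M\<close> is Artinian,
  hence every descending sequence of ideals becomes stationary in it. Instead of a
  composition series, the proof takes an ideal \<open>B \<supseteq> B0\<close> that is maximal among the saturated ideals
  for which the sequences \<open>J n \<inter> B\<close> become stationary modulo \<open>B0\<close>. If \<open>B\<close> were proper, it could be
  enlarged by a simple piece \<open>R/M\<close>, and in such a piece a descending sequence is either
  eventually zero or always everything.
\<close>

lemma descending_ideals_modulo: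
  fixes J :: "nat \<Rightarrow> 'a set"
  assumes M: "primeideal M R" and B0: "ideal B0 R"
    and min: "\<And>N. primeideal N R \<Longrightarrow> B0 \<subseteq> N \<Longrightarrow> N \<subseteq> M \<Longrightarrow> N = M"
    and J: "\<And>n. ideal (J n) R" and desc: "\<And>n. J (Suc n) \<subseteq> J n"
  shows "\<exists>n. J n \<subseteq> sat R (carrier R - M) (J (Suc n) <+> B0)"
proof -
  let ?S = "carrier R - M"
  let ?L = "\<lambda>n. sat R ?S (J (Suc n) <+> B0)"
  let ?X = "{B. ideal B R \<and> B0 \<subseteq> B \<and> sat R ?S B \<subseteq> B \<and> (\<exists>N. \<forall>n\<ge>N. J n \<inter> B \<subseteq> ?L n)}"
  note S = primeideal_complement_submonoid[OF M]
  have J_anti: "J m \<subseteq> J n" if "n \<le> m" for m n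
    using lift_Suc_antimono_le[of J, OF desc that] .
  have sum: "ideal (J n <+> B0) R" "J n \<subseteq> J n <+> B0" "B0 \<subseteq> J n <+> B0" for n
    using add_ideals[OF J B0] add_ideals_upper[OF J B0] by simp_all
  have L: "ideal (?L n) R" for n by (rule sat_ideal[OF S sum(1)])
  have L_upper: "J (Suc n) <+> B0 \<subseteq> ?L n" for n by (rule sat_upper[OF S sum(1)])
  have "sat R ?S B0 \<in> ?X"
    using sat_ideal[OF S B0] sat_upper[OF S B0] sat_idem[OF S B0] sat_mono[OF sum(3)]
    by (simp add: le_infI2)
  then have ne: "?X \<noteq> {}" by blast
  obtain B where B': "B \<in> ?X" and max: "\<And>L'. L' \<in> ?X \<Longrightarrow> B \<subseteq> L' \<Longrightarrow> L' = B"
    by (rule ideal_maximal_exists[OF ne]) auto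
  then obtain N where B: "ideal B R" "B0 \<subseteq> B" "sat R ?S B \<subseteq> B"
    and N: "\<And>n. n \<ge> N \<Longrightarrow> J n \<inter> B \<subseteq> ?L n" by auto
  have "B = carrier R"
  proof (rule ccontr)
    assume "B \<noteq> carrier R"
    then obtain a where a: "a \<in> carrier R" "a \<notin> B" and pr: "primeideal (colon R B a) R"
      using associated_prime_exists[OF B(1)] by metis
    have "B0 \<subseteq> colon R B a" using B(2) subset_colon[OF B(1) a(1)] by simp
    moreover have "colon R B a \<subseteq> M"
    proof
      fix s assume s: "s \<in> colon R B a"
      show "s \<in> M"
      proof (rule ccontr)
        assume "s \<notin> M"
        then have "a \<in> sat R ?S B" using s a by (auto simp: colon_def sat_def)
        then show False using B(3) a by blast
      qed
    qed
    ultimately have colon: "colon R B a = M" using min[OF pr] by simp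
    let ?B1 = "Idl (insert a B)"
    let ?B2 = "sat R ?S ?B1"
    have B1: "ideal ?B1 R" "insert a B \<subseteq> ?B1"
      using adjoin_ideal[OF B(1)] adjoin_upper[OF B(1)] a by simp_all
    have B2: "ideal ?B2 R" "?B1 \<subseteq> ?B2" "sat R ?S ?B2 \<subseteq> ?B2"
      using sat_ideal[OF S B1(1)] sat_upper[OF S B1(1)] sat_idem[OF S B1(1)] by simp_all
    have repr: "\<exists>s\<in>?S. \<exists>b\<in>B. \<exists>r\<in>carrier R. s \<otimes> z = b \<oplus> r \<otimes> a" if "z \<in> ?B2" for z
      using that by (auto simp: sat_def mem_adjoin[OF B(1) a(1)])
    have "\<exists>N. \<forall>n\<ge>N. J n \<inter> ?B2 \<subseteq> ?L n"
    proof (cases "\<exists>m. J m \<inter> ?B2 \<subseteq> B")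
      case True
      then obtain m where m: "J m \<inter> ?B2 \<subseteq> B" by blast
      have "J n \<inter> ?B2 \<subseteq> ?L n" if "n \<ge> max N m" for n
        using m N[of n] J_anti[of m n] that by auto
      then show ?thesis by blast
    next
      case False
      \<comment> \<open>The residue of \<open>w\<close> in the simple piece is a multiple of that of some \<open>z\<close> in the next term;
        subtracting this multiple leads into \<open>B\<close>, where the sequence is already stationary.\<close>
      have "w \<in> ?L n" if n: "n \<ge> N" and w: "w \<in> J n" "w \<in> ?B2" for n w
      proof -
        obtain z where z: "z \<in> J (Suc n)" "z \<in> ?B2" "z \<notin> B" using False by blast
        obtain s b r where s: "s \<in> ?S" "b \<in> B" "r \<in> carrier R" "s \<otimes> z = b \<oplus> r \<otimes> a"
          using repr[OF z(2)] by blast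
        obtain s' b' r' where s': "s' \<in> ?S" "b' \<in> B" "r' \<in> carrier R" "s' \<otimes> w = b' \<oplus> r' \<otimes> a"
          using repr[OF w(2)] by blast
        have c: "z \<in> carrier R" "w \<in> carrier R" "b \<in> carrier R" "b' \<in> carrier R"
          "s \<in> carrier R" "s' \<in> carrier R"
          using ideal.Icarr[OF J z(1)] ideal.Icarr[OF J w(1)] ideal.Icarr[OF B(1)] s s' by auto
        have "r \<notin> M"
        proof
          assume "r \<in> M"
          then have "r \<otimes> a \<in> B" using colon by (auto simp: colon_def)
          then have "s \<otimes> z \<in> B" using s ideal_add[OF B(1)] by simp
          then have "z \<in> sat R ?S B" using c s by (intro satI[of z s])
          then show False using B(3) z by blast
        qed
        then have rs: "r \<otimes> s' \<in> ?S" using submonoid.m_closed[OF S, of r s'] s s' by auto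
        have eq: "(r \<otimes> s') \<otimes> w \<ominus> (r' \<otimes> s) \<otimes> z = r \<otimes> b' \<ominus> r' \<otimes> b"
        proof -
          have "(r \<otimes> s') \<otimes> w = r \<otimes> b' \<oplus> r \<otimes> r' \<otimes> a"
            using c s s' a by (simp add: m_assoc r_distr)
          moreover have "(r' \<otimes> s) \<otimes> z = r' \<otimes> b \<oplus> r \<otimes> r' \<otimes> a"
            using c s s' a by (simp add: m_assoc r_distr m_lcomm)
          ultimately show ?thesis
            using c s s' a by (simp add: a_minus_def minus_add a_ac r_neg r_neg2)
        qed
        have "(r' \<otimes> s) \<otimes> z \<in> J (Suc n)" using z s s' c by (simp add: ideal_closed[OF J])
        then have 1: "(r' \<otimes> s) \<otimes> z \<in> ?L n" "(r' \<otimes> s) \<otimes> z \<in> J n"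
          using sum(2)[of "Suc n"] L_upper[of n] desc[of n] by auto
        have "(r \<otimes> s') \<otimes> w \<in> J n" using w s s' c by (simp add: ideal_closed[OF J])
        then have "(r \<otimes> s') \<otimes> w \<ominus> (r' \<otimes> s) \<otimes> z \<in> J n" using 1 by (simp add: ideal_closed[OF J])
        moreover have "(r \<otimes> s') \<otimes> w \<ominus> (r' \<otimes> s) \<otimes> z \<in> B"
          unfolding eq using s s' by (simp add: ideal_closed[OF B(1)])
        ultimately have "(r \<otimes> s') \<otimes> w \<ominus> (r' \<otimes> s) \<otimes> z \<in> ?L n" using N[OF n] by blast
        then have "(r \<otimes> s') \<otimes> w \<in> ?L n"
          using c s s' 1 by (intro ideal_diffD[OF L, of "(r \<otimes> s') \<otimes> w" "(r' \<otimes> s) \<otimes> z"]) auto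
        then show "w \<in> ?L n" using c rs by (auto intro: sat_cancel[OF S sum(1), of w "r \<otimes> s'"])
      qed
      then show ?thesis by blast
    qed
    then have "?B2 \<in> ?X" using B2 B1 B(2) by auto
    then have "?B2 = B" using B1 B2 by (intro max) auto
    then show False using a B1 B2 by auto
  qed
  then show ?thesis using N[of N] ideal_subset[OF J, of N] by (intro exI[of _ N]) auto
qed

text \<open>
  Krull's principal ideal theorem in relative form: above \<open>P\<close>, a prime \<open>M\<close> that is minimal over
  \<open>P + (x)\<close> has height at most one. Modulo \<open>P\<close>, for \<open>0 \<noteq> y \<in> Q\<close>, consider the descending sequence
  of the ideals \<open>J n\<close>, the contractions of \<open>(y\<^sup>n)\<close> from the local ring at \<open>Q\<close>. They
  become stationary modulo \<open>x\<close>, and since \<open>x\<close> is invertible at \<open>Q\<close>, this gives some \<open>n\<close> with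
  \<open>J n \<subseteq> J (n+1) + x J n\<close>. By Nakayama's lemma \<open>J n \<subseteq> J (n+1)\<close>, so \<open>y\<^sup>n \<in> (y\<^sup>n\<^sup>+\<^sup>1)\<close> at \<open>Q\<close>, which is
  absurd for an element of \<open>Q\<close>. The powers of \<open>y\<close> play the part of the symbolic powers of \<open>Q\<close> in
  the usual proof.
\<close>

lemma krull_principal_ideal:
  assumes P: "primeideal P R" and Q: "primeideal Q R" and M: "primeideal M R"
    and PQ: "P \<subset> Q" and QM: "Q \<subset> M" and x: "x \<in> M" "x \<notin> Q"
  shows "\<exists>N. primeideal N R \<and> P \<subseteq> N \<and> x \<in> N \<and> N \<subset> M"
proof (rule ccontr)
  assume no: "\<not> ?thesis"
  let ?S = "carrier R - M" and ?T = "carrier R - Q"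
  note S = primeideal_complement_submonoid[OF M]
  note T = primeideal_complement_submonoid[OF Q]
  note Pi = prime_ideal[OF P] and Qi = prime_ideal[OF Q] and Mi = prime_ideal[OF M]
  have xc: "x \<in> carrier R" using ideal.Icarr[OF Mi x(1)] .
  obtain y where y: "y \<in> Q" "y \<notin> P" using PQ by blast
  have yc: "y \<in> carrier R" using ideal.Icarr[OF Qi y(1)] .
  define J0 where "J0 n = Idl (insert (y [^] n) P)" for n :: nat
  define J where "J n = sat R ?T (J0 n)" for n :: nat
  have J0: "ideal (J0 n) R" "y [^] n \<in> J0 n" "P \<subseteq> J0 n" for n
    unfolding J0_def using adjoin_ideal[OF Pi] adjoin_upper[OF Pi] yc by simp_all
  have J: "ideal (J n) R" and J0J: "J0 n \<subseteq> J n" for n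
    unfolding J_def using sat_ideal[OF T J0(1)] sat_upper[OF T J0(1)] by simp_all
  have desc: "J (Suc n) \<subseteq> J n" for n
  proof -
    have "J0 (Suc n) \<subseteq> J0 n"
      unfolding J0_def[of "Suc n"] using J0[of n] yc
      by (intro genideal_minimal) (auto intro: ideal_mult_right[OF J0(1)])
    then show ?thesis unfolding J_def by (rule sat_mono)
  qed
  let ?B = "Idl (insert x P)"
  have B: "ideal ?B R" "insert x P \<subseteq> ?B" using adjoin_ideal[OF Pi xc] adjoin_upper[OF Pi xc] by simp_all
  have min: "N = M" if "primeideal N R" "?B \<subseteq> N" "N \<subseteq> M" for N
    using no that B(2) by blast
  have "\<exists>n. J n \<subseteq> sat R ?S (J (Suc n) <+> ?B)"
    by (rule descending_ideals_modulo[OF M B(1)]) (fact min J desc)+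
  then obtain n where n: "J n \<subseteq> sat R ?S (J (Suc n) <+> ?B)" by auto
  have ST: "?S \<subseteq> ?T" using QM by blast
  have "J n \<subseteq> J (Suc n)"
  proof (rule nakayama[OF M J J])
    have "sat R ?S (J (Suc n)) \<subseteq> sat R ?T (J (Suc n))" using ST by (auto simp: sat_def)
    also have "\<dots> = J (Suc n)" unfolding J_def by (rule sat_idem[OF T J0(1)])
    finally show "sat R ?S (J (Suc n)) \<subseteq> J (Suc n)" .
  next
    fix L assume L: "ideal L R" "J (Suc n) \<subseteq> L" "sat R ?S L \<subseteq> L"
      and mult: "\<And>x a. x \<in> M \<Longrightarrow> a \<in> J n \<Longrightarrow> x \<otimes> a \<in> L"
    show "J n \<subseteq> L"
    proof
      fix r assume r: "r \<in> J n"
      then have "r \<in> sat R ?S (J (Suc n) <+> ?B)" using n by blast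
      then obtain s j b where s: "s \<in> ?S" "s \<otimes> r = j \<oplus> b" "j \<in> J (Suc n)" "b \<in> ?B"
        by (auto simp: sat_def add_ideals_mem)
      then obtain p t where p: "b = p \<oplus> t \<otimes> x" "p \<in> P" "t \<in> carrier R"
        by (auto simp: mem_adjoin[OF Pi xc])
      have pJ: "p \<in> J (Suc n)" using p J0(3)[of "Suc n"] J0J[of "Suc n"] by blast
      have c: "r \<in> carrier R" "s \<in> carrier R" "j \<in> carrier R" "p \<in> carrier R"
        using ideal.Icarr[OF J r] ideal.Icarr[OF J s(3)] ideal.Icarr[OF J pJ] s(1) by auto
      have sr: "s \<otimes> r = (j \<oplus> p) \<oplus> t \<otimes> x" using s p c xc by (simp add: a_assoc)
      have jp: "j \<oplus> p \<in> J (Suc n)" using s(3) pJ by (rule ideal_add[OF J])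
      have "(j \<oplus> p) \<oplus> t \<otimes> x \<in> J n" unfolding sr[symmetric] using r c by (simp add: ideal_closed[OF J])
      then have "t \<otimes> x \<in> J n"
        using jp desc[of n] c p xc by (intro ideal_addD[OF J, of "j \<oplus> p" n "t \<otimes> x"]) auto
      then have "x \<otimes> t \<in> J n" using p xc by (simp add: m_comm)
      then have "t \<in> J n" using x xc p unfolding J_def by (auto intro: sat_cancel[OF T J0(1), of t x n])
      then have "x \<otimes> t \<in> L" by (rule mult[OF x(1)])
      then have "t \<otimes> x \<in> L" using p xc by (simp add: m_comm)
      then have "s \<otimes> r \<in> L" unfolding sr using jp L(2) by (intro ideal_add[OF L(1), of "j \<oplus> p"]) auto
      then have "r \<in> sat R ?S L" using s c by (intro satI[of r s])
      then show "r \<in> L" using L by blast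
    qed
  qed
  then have "y [^] n \<in> sat R ?T (J0 (Suc n))" using J0(2)[of n] J0J[of n] unfolding J_def by blast
  then obtain s where s: "s \<in> ?T" "s \<otimes> y [^] n \<in> J0 (Suc n)" by (auto simp: sat_def)
  then obtain p r where p: "p \<in> P" "r \<in> carrier R" "s \<otimes> y [^] n = p \<oplus> r \<otimes> y [^] Suc n"
    using mem_adjoin[OF Pi, of "y [^] Suc n"] yc unfolding J0_def by auto
  have pc: "p \<in> carrier R" using ideal.Icarr[OF Pi p(1)] .
  have "(s \<ominus> r \<otimes> y) \<otimes> y [^] n = s \<otimes> y [^] n \<ominus> r \<otimes> y [^] Suc n"
    using s(1) p(2) yc m_comm[of y "y [^] n"] by (simp add: diff_mult_distrib m_assoc)
  also have "\<dots> = p" using p yc pc by (simp add: add_diff_cancel)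
  finally have "(s \<ominus> r \<otimes> y) \<otimes> y [^] n \<in> P" using p by simp
  then have "s \<ominus> r \<otimes> y \<in> P \<or> y [^] n \<in> P"
    using s p yc by (intro prime_mem[OF P]) auto
  moreover have "y [^] n \<notin> P" using prime_pow_mem[OF P yc] y by blast
  moreover have "s \<ominus> r \<otimes> y \<in> carrier R - Q"
    using s p y yc by (intro prime_diff_notin[OF Q] ideal_mult_left[OF Qi]) auto
  ultimately show False using PQ by blast
qed

lemma prime_between_containing:
  assumes P: "primeideal P R" and Q: "primeideal Q R" and M: "primeideal M R"
    and PQ: "P \<subset> Q" and QM: "Q \<subset> M" and x: "x \<in> M"
  obtains N where "primeideal N R" "P \<subset> N" "N \<subset> M" "x \<in> N"
proof (cases "x \<in> Q")
  case True then show ?thesis using assms that by blast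
next
  case False
  then obtain N where N: "primeideal N R" "P \<subseteq> N" "x \<in> N" "N \<subset> M"
    using krull_principal_ideal[OF P Q M PQ QM x] by auto
  then show ?thesis using that[of N] False PQ by blast
qed

text \<open>
  A chain of primes can be deformed, link by link from the top, until its second member contains a
  given element of the top: cutting by one element lowers the dimension by at most one.
\<close>

lemma prime_chain_through:
  assumes "prime_chain R C (Suc n)" and "x \<in> C (Suc n)"
  shows "\<exists>D. prime_chain R D n \<and> D n = C (Suc n) \<and> x \<in> D 0 \<and> C 0 \<subset> D 0"
  using assms
proof (induction n arbitrary: C)
  case 0
  then show ?case by (intro exI[of _ "\<lambda>_. C 1"]) (auto simp: prime_chain_def)
next
  case (Suc n)
  then have "primeideal (C n) R" "primeideal (C (Suc n)) R" "primeideal (C (Suc (Suc n))) R"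
    "C n \<subset> C (Suc n)" "C (Suc n) \<subset> C (Suc (Suc n))"
    by (simp_all add: prime_chain_def)
  then obtain N where N: "primeideal N R" "C n \<subset> N" "N \<subset> C (Suc (Suc n))" "x \<in> N"
    using Suc.prems(2) by (rule prime_between_containing)
  have "prime_chain R (C(Suc n := N)) (Suc n)"
    using Suc.prems(1) N by (auto simp: prime_chain_def less_Suc_eq le_Suc_eq)
  moreover have "x \<in> (C(Suc n := N)) (Suc n)" using N by simp
  ultimately have "\<exists>D. prime_chain R D n \<and> D n = N \<and> x \<in> D 0 \<and> C 0 \<subset> D 0"
    by (drule_tac Suc.IH) simp_all
  then obtain D where D: "prime_chain R D n" "D n = N" "x \<in> D 0" "C 0 \<subset> D 0"
    by blast
  have "prime_chain R (D(Suc n := C (Suc (Suc n)))) (Suc n)"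
    using D N \<open>primeideal (C (Suc (Suc n))) R\<close> by (auto simp: prime_chain_def less_Suc_eq le_Suc_eq)
  moreover have "(D(Suc n := C (Suc (Suc n)))) (Suc n) = C (Suc (Suc n))"
    "(D(Suc n := C (Suc (Suc n)))) 0 = D 0" by simp_all
  ultimately show ?case using D by metis
qed

end

section \<open>Regular sequences\<close>

text \<open>
  The sequence is weakly regular, with a possibly zero final quotient, on the module of
  fractions of \<open>R/J\<close> with denominators in \<open>S\<close>. Recursion on the list, with \<open>J\<close> growing, replaces the
  indices in the definition of a regular sequence.
\<close>

primrec loc_regular :: "('a, 'b) ring_scheme \<Rightarrow> 'a set \<Rightarrow> 'a list \<Rightarrow> 'a set \<Rightarrow> bool" where
  "loc_regular R S [] J \<longleftrightarrow> True"
| "loc_regular R S (x # xs) J \<longleftrightarrow>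
     (\<forall>r\<in>carrier R. x \<otimes>\<^bsub>R\<^esub> r \<in> sat R S J \<longrightarrow> r \<in> sat R S J) \<and>
     loc_regular R S xs (Idl\<^bsub>R\<^esub> (insert x J))"

context cring begin

lemma one_submonoid: "submonoid {\<one>} R"
  by (intro submonoid.intro) auto

lemma sat_one: "ideal J R \<Longrightarrow> sat R {\<one>} J = J"
  using ideal_subset[of J] by (auto simp: sat_def)

lemma Idl_empty: "Idl {} = {\<zero>}"
proof
  show "Idl {} \<subseteq> {\<zero>}" by (rule genideal_minimal[OF zeroideal]) simp
  have "ideal (Idl {}) R" by (rule genideal_ideal) simp
  then show "{\<zero>} \<subseteq> Idl {}" using ideal_zero by simp
qed

lemma Idl_adjoin_Un:
  assumes "ideal J R" "x \<in> carrier R" "B \<subseteq> carrier R"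
  shows "Idl (Idl (insert x J) \<union> B) = Idl (J \<union> insert x B)"
  using Idl_Un_ideal[of B "insert x J"] ideal_subset[OF assms(1)] assms
  by (simp add: Un_commute)

lemma loc_regular_iff:
  assumes "ideal J R" and "set xs \<subseteq> carrier R"
  shows "loc_regular R S xs J \<longleftrightarrow>
    (\<forall>i<length xs. \<forall>r\<in>carrier R. xs ! i \<otimes> r \<in> sat R S (Idl (J \<union> set (take i xs))) \<longrightarrow>
       r \<in> sat R S (Idl (J \<union> set (take i xs))))"
  using assms
proof (induction xs arbitrary: J)
  case (Cons x xs)
  have x: "x \<in> carrier R" "set xs \<subseteq> carrier R" using Cons.prems by auto
  have eq: "Idl (Idl (insert x J) \<union> set (take i xs)) = Idl (J \<union> set (take (Suc i) (x # xs)))" for i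
    using Idl_adjoin_Un[OF Cons.prems(1) x(1), of "set (take i xs)"] x(2) set_take_subset[of i xs]
    by auto
  show ?case
    unfolding loc_regular.simps Cons.IH[OF adjoin_ideal[OF Cons.prems(1) x(1)] x(2)] eq
    using Idl_ideal[OF Cons.prems(1)]
    by (simp add: All_less_Suc2 del: take_Suc_Cons)
qed simp

lemma regular_sequence_iff_loc_regular:
  "regular_sequence R xs \<longleftrightarrow>
    set xs \<subseteq> carrier R \<and> loc_regular R {\<one>} xs {\<zero>} \<and> Idl (set xs) \<noteq> carrier R"
proof (cases "set xs \<subseteq> carrier R")
  case True
  have "Idl ({\<zero>} \<union> set (take i xs)) = Idl (set (take i xs))" for i
  proof -
    have t: "set (take i xs) \<subseteq> carrier R" using True set_take_subset[of i xs] by blast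
    show ?thesis using Idl_empty Idl_Un_ideal[of "set (take i xs)" "{}"] t by (simp add: Un_commute)
  qed
  moreover have "sat R {\<one>} (Idl (set (take i xs))) = Idl (set (take i xs))" for i
    using True set_take_subset[of i xs] by (intro sat_one genideal_ideal) blast
  ultimately show ?thesis using True
    by (simp add: regular_sequence_def loc_regular_iff[OF zeroideal True])
qed (auto simp: regular_sequence_def)

end

text \<open>
  A prime that is disjoint from this multiplicative set is contained in \<open>P\<close> and avoids \<open>x\<close>.
\<close>

definition complement_powers :: "('a, 'b) ring_scheme \<Rightarrow> 'a set \<Rightarrow> 'a \<Rightarrow> 'a set" where
  "complement_powers R P x =
     {s \<otimes>\<^bsub>R\<^esub> x [^]\<^bsub>R\<^esub> n | s (n::nat). s \<in> carrier R \<and> s \<notin> P}"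

lemma prime_chain_Cons:
  assumes "prime_chain R C n" "primeideal P R" "P \<subset> C 0"
  shows "prime_chain R (case_nat P C) (Suc n)"
  using assms by (auto simp: prime_chain_def split: nat.split)

lemma prime_chain_replace_top:
  assumes "prime_chain R C n" "primeideal M R" "C n \<subseteq> M"
  shows "prime_chain R (C(n := M)) n"
  using assms by (auto simp: prime_chain_def)

lemma prime_chain_mono: "prime_chain R C n \<Longrightarrow> i \<le> j \<Longrightarrow> j \<le> n \<Longrightarrow> C i \<subseteq> C j"
proof (induction j)
  case (Suc j)
  then show ?case
    using Suc.IH by (cases "i = Suc j") (auto simp: prime_chain_def le_Suc_eq dest!: spec[of _ j])
qed simp

lemma prime_chain_prime: "prime_chain R C n \<Longrightarrow> i \<le> n \<Longrightarrow> primeideal (C i) R"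
  by (simp add: prime_chain_def)

lemma le_krull_dim: "prime_chain R C n \<Longrightarrow> enat n \<le> krull_dim R"
  unfolding krull_dim_def by (rule Sup_upper) auto

lemma krull_dim_le: "(\<And>C n. prime_chain R C n \<Longrightarrow> n \<le> d) \<Longrightarrow> krull_dim R \<le> enat d"
  unfolding krull_dim_def by (rule Sup_least) auto

lemma prime_chain_of_dim:
  assumes d: "krull_dim R = enat d" and P: "primeideal P R"
  shows "\<exists>C. prime_chain R C d"
proof (rule ccontr)
  assume no: "\<nexists>C. prime_chain R C d"
  have lt: "n < d" if "prime_chain R C n" for C n
  proof -
    have "n \<le> d" using le_krull_dim[OF that] d by simp
    moreover have "n \<noteq> d" using no that by blast
    ultimately show ?thesis by simp
  qed
  have "prime_chain R (\<lambda>_. P) 0" using P by (simp add: prime_chain_def)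
  from lt[OF this] have "0 < d" .
  have "krull_dim R \<le> enat (d - 1)" by (rule krull_dim_le) (use lt in fastforce)
  then show False using d \<open>0 < d\<close> by simp
qed

section \<open>Regular local rings, depth and dimension\<close>

context noeth_cring begin

lemma maximalideal_above:
  assumes K: "ideal K R" and ne: "K \<noteq> carrier R"
  obtains M where "maximalideal M R" "K \<subseteq> M"
proof -
  let ?X = "{L. ideal L R \<and> K \<subseteq> L \<and> L \<noteq> carrier R}"
  have X: "?X \<noteq> {}" using K ne by blast
  obtain M where M: "M \<in> ?X" and max: "\<And>L. L \<in> ?X \<Longrightarrow> M \<subseteq> L \<Longrightarrow> L = M"
    by (rule ideal_maximal_exists[OF X]) auto
  have "maximalideal M R"
  proof (rule maximalidealI)
    fix L assume "ideal L R" "M \<subseteq> L"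
    then show "L = M \<or> L = carrier R" using M max[of L] by auto
  qed (use M in auto)
  then show ?thesis using that M by blast
qed

end

lemma (in cring) maximalideal_max_ideal:
  assumes "local_ring R"
  shows "maximalideal (max_ideal R) R" and "maximalideal M R \<Longrightarrow> M = max_ideal R"
  using theI'[of "\<lambda>M. maximalideal M R"] the1_equality[of "\<lambda>M. maximalideal M R" M] assms
  by (auto simp: local_ring_def max_ideal_def)

context noeth_cring begin

lemma local_ideal_subset_max:
  assumes loc: "local_ring R" and K: "ideal K R" and ne: "K \<noteq> carrier R"
  shows "K \<subseteq> max_ideal R"
  using maximalideal_above[OF K ne] maximalideal_max_ideal(2)[OF loc] by metis

lemma local_unit:
  assumes loc: "local_ring R" and s: "s \<in> carrier R" "s \<notin> max_ideal R"
  obtains t where "t \<in> carrier R" "t \<otimes> s = \<one>"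
proof -
  have "PIdl s = carrier R"
    using local_ideal_subset_max[OF loc cgenideal_ideal[OF s(1)]] cgenideal_self[OF s(1)] s by blast
  then have "\<one> \<in> PIdl s" by simp
  then show ?thesis using that by (auto simp: cgenideal_def)
qed

lemma local_sat:
  assumes loc: "local_ring R" and K: "ideal K R"
  shows "sat R (carrier R - max_ideal R) K \<subseteq> K"
proof
  fix r assume "r \<in> sat R (carrier R - max_ideal R) K"
  then obtain s where s: "r \<in> carrier R" "s \<in> carrier R" "s \<notin> max_ideal R" "s \<otimes> r \<in> K"
    by (auto simp: sat_def)
  obtain t where t: "t \<in> carrier R" "t \<otimes> s = \<one>" using local_unit[OF loc s(2,3)] .
  have "t \<otimes> (s \<otimes> r) = r" using s t m_assoc[of t s r] by simp
  then show "r \<in> K" using ideal_mult_left[OF K s(4) t(1)] by simp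
qed

lemma Idl_remove_generator:
  assumes J: "ideal J R" and ys: "set ys \<subseteq> carrier R" and y: "y \<in> set ys"
  shows "Idl (Idl (insert y J) \<union> set (remove1 y ys)) = Idl (J \<union> set ys)"
proof -
  have "insert y (set (remove1 y ys)) = set ys"
    using y set_remove1_subset[of y ys] in_set_remove1[of _ y ys] by blast
  then show ?thesis
    using Idl_adjoin_Un[OF J, of y "set (remove1 y ys)"] y ys set_remove1_subset[of y ys] by auto
qed

text \<open>
  The induction step shared by the next two results: trade one generator of \<open>M\<close> modulo \<open>J\<close> for one
  link of the chain. The generator is chosen outside the bottom prime of the chain.
\<close>

lemma generator_outside:
  assumes J: "ideal J R" and ys: "set ys \<subseteq> carrier R" and M: "M = Idl (J \<union> set ys)"
    and C: "prime_chain R C (Suc n)" "J \<subseteq> C 0" "C (Suc n) = M"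
  obtains y D where "y \<in> set ys" "y \<notin> C 0" "prime_chain R D n" "D n = M"
    "Idl (insert y J) \<subseteq> D 0" "C 0 \<subset> D 0"
proof -
  have sub: "J \<union> set ys \<subseteq> carrier R" using ideal_subset[OF J] ys by blast
  have C0: "ideal (C 0) R" using prime_ideal prime_chain_prime[OF C(1), of 0] by simp
  have "C 0 \<subset> C 1" "C 1 \<subseteq> M"
    using C prime_chain_mono[OF C(1), of 1 "Suc n"] by (auto simp: prime_chain_def)
  then have "\<not> M \<subseteq> C 0" by blast
  then have "\<not> J \<union> set ys \<subseteq> C 0" unfolding M using genideal_minimal[OF C0] by blast
  then obtain y where y: "y \<in> set ys" "y \<notin> C 0" using C(2) by blast
  have "y \<in> C (Suc n)" using C M y genideal_self[OF sub] by blast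
  then obtain D where D: "prime_chain R D n" "D n = M" "y \<in> D 0" "C 0 \<subset> D 0"
    using prime_chain_through[OF C(1)] C(3) by metis
  have "Idl (insert y J) \<subseteq> D 0"
    using D C(2) by (intro genideal_minimal prime_ideal prime_chain_prime[OF D(1)]) auto
  then show ?thesis using that y D by blast
qed

lemma prime_chain_length_le_generators:
  assumes M: "primeideal M R" and J: "ideal J R" and ys: "set ys \<subseteq> carrier R"
    and gen: "M = Idl (J \<union> set ys)"
    and C: "prime_chain R C n" "J \<subseteq> C 0" "C n \<subseteq> M"
  shows "n \<le> length ys"
  using J ys gen C
proof (induction n arbitrary: J ys C)
  case (Suc n)
  define C' where "C' = C(Suc n := M)"
  have C': "prime_chain R C' (Suc n)" "J \<subseteq> C' 0" "C' (Suc n) = M"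
    using prime_chain_replace_top[OF Suc.prems(4) M] Suc.prems by (auto simp: C'_def)
  obtain y D where y: "y \<in> set ys" and D: "prime_chain R D n" "D n = M" "Idl (insert y J) \<subseteq> D 0"
    using generator_outside[OF Suc.prems(1-3) C'] by metis
  have yc: "y \<in> carrier R" using y Suc.prems by blast
  have "n \<le> length (remove1 y ys)"
  proof (rule Suc.IH)
    show "ideal (Idl (insert y J)) R" by (rule adjoin_ideal[OF Suc.prems(1) yc])
    show "set (remove1 y ys) \<subseteq> carrier R" using Suc.prems(2) set_remove1_subset[of y ys] by blast
    show "M = Idl (Idl (insert y J) \<union> set (remove1 y ys))"
      unfolding Idl_remove_generator[OF Suc.prems(1,2) y] by (rule Suc.prems(3))
  qed (use D in auto)
  then show ?case using y length_pos_if_in_set[OF y] by (simp add: length_remove1 Suc_le_eq less_Suc_eq_le[symmetric])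
qed simp

text \<open>
  A local ring modulo \<open>J\<close> whose maximal ideal has as many generators as the length of some chain of
  primes is a domain, and its generators form, in a suitable order, a regular sequence. By induction
  \<open>J' = J + (y)\<close> is prime, for a generator \<open>y\<close> outside the bottom prime \<open>P\<close> of a chain of maximal
  length. The chain, deformed to pass through \<open>y\<close>, starts at a prime containing \<open>J'\<close>,
  and in fact at \<open>J'\<close>: otherwise it could be extended by \<open>J'\<close> to a chain with more links than the
  maximal ideal has generators modulo \<open>J'\<close>. Hence \<open>P \<subset> J'\<close>, so \<open>P = J + y P\<close>, and \<open>P = J\<close> by
  Nakayama's lemma.
\<close>

lemma regular_parameters_regular:
  assumes loc: "local_ring R" and J: "ideal J R" and ys: "set ys \<subseteq> carrier R"
    and gen: "max_ideal R = Idl (J \<union> set ys)"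
    and C: "prime_chain R C (length ys)" "J \<subseteq> C 0" "C (length ys) \<subseteq> max_ideal R"
  shows "primeideal J R \<and>
    (\<exists>xs. length xs = length ys \<and> set xs \<subseteq> max_ideal R \<and> loc_regular R {\<one>} xs J)"
  using J ys gen C
proof (induction "length ys" arbitrary: J ys C)
  case 0
  have "max_ideal R = J" using 0 Idl_ideal by simp
  then show ?case
    using 0 maximalideal_prime[OF maximalideal_max_ideal(1)[OF loc]] by auto
next
  case (Suc n)
  let ?M = "max_ideal R"
  have M: "primeideal ?M R" by (rule maximalideal_prime[OF maximalideal_max_ideal(1)[OF loc]])
  note J = Suc.prems(1)
  define C' where "C' = C(Suc n := ?M)"
  have C': "prime_chain R C' (Suc n)" "J \<subseteq> C' 0" "C' (Suc n) = ?M"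
    using prime_chain_replace_top[of R C "length ys", OF Suc.prems(4) M] Suc.prems(5,6) Suc.hyps(2)
    by (auto simp: C'_def)
  obtain y D where y: "y \<in> set ys" "y \<notin> C' 0"
    and D: "prime_chain R D n" "D n = ?M" "Idl (insert y J) \<subseteq> D 0" "C' 0 \<subset> D 0"
    using generator_outside[OF Suc.prems(1-3) C'] by metis
  let ?J = "Idl (insert y J)" and ?ys = "remove1 y ys"
  have yc: "y \<in> carrier R" using y Suc.prems by blast
  have J1: "ideal ?J R" "insert y J \<subseteq> ?J"
    using adjoin_ideal[OF J yc] adjoin_upper[OF J yc] by simp_all
  have ys1: "set ?ys \<subseteq> carrier R" using Suc.prems(2) set_remove1_subset[of y ys] by blast
  have gen1: "?M = Idl (?J \<union> set ?ys)"
    unfolding Idl_remove_generator[OF Suc.prems(1,2) y(1)] by (rule Suc.prems(3))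
  have len: "n = length ?ys" using y(1) Suc.hyps(2) by (simp add: length_remove1)
  have "primeideal ?J R \<and>
    (\<exists>xs. length xs = length ?ys \<and> set xs \<subseteq> ?M \<and> loc_regular R {\<one>} xs ?J)"
    using D len by (intro Suc.hyps(1)[OF len J1(1) ys1 gen1, of D]) auto
  then obtain xs where J1p: "primeideal ?J R"
    and xs: "length xs = length ?ys" "set xs \<subseteq> ?M" "loc_regular R {\<one>} xs ?J" by blast
  \<comment> \<open>Otherwise \<open>?J\<close> could be put below the chain \<open>D\<close>.\<close>
  have "?J = D 0"
  proof (rule ccontr)
    assume "?J \<noteq> D 0"
    then have "prime_chain R (case_nat ?J D) (Suc n)"
      using D J1p by (intro prime_chain_Cons) auto
    then have "Suc n \<le> length ?ys"
      using D by (intro prime_chain_length_le_generators[OF M J1(1) ys1 gen1, of "case_nat ?J D"]) auto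
    then show False using len by simp
  qed
  then have below: "C' 0 \<subseteq> ?J" using D by blast
  have C0: "primeideal (C' 0) R" using prime_chain_prime[OF C'(1), of 0] by simp
  note C0i = prime_ideal[OF C0]
  \<comment> \<open>An element \<open>j + t y\<close> of the bottom prime has \<open>t\<close> in the bottom prime, since \<open>y\<close> is not.\<close>
  have "C' 0 \<subseteq> J"
  proof (rule nakayama[OF M C0i J local_sat[OF loc J]])
    fix L assume L: "ideal L R" "J \<subseteq> L" and mult: "\<And>x a. x \<in> ?M \<Longrightarrow> a \<in> C' 0 \<Longrightarrow> x \<otimes> a \<in> L"
    show "C' 0 \<subseteq> L"
    proof
      fix z assume z: "z \<in> C' 0"
      then have "z \<in> ?J" using below by blast
      then obtain j t where j: "j \<in> J" "t \<in> carrier R" "z = j \<oplus> t \<otimes> y"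
        using mem_adjoin[OF J yc] by blast
      have "t \<otimes> y \<in> C' 0"
      proof (rule ideal_addD[OF C0i])
        show "j \<in> C' 0" using C'(2) j(1) by blast
        show "t \<otimes> y \<in> carrier R" using j(2) yc by simp
        show "j \<oplus> t \<otimes> y \<in> C' 0" using z unfolding j(3) .
      qed
      then have "t \<in> C' 0" using prime_mem[OF C0 j(2) yc] y(2) by blast
      moreover have "y \<in> ?M"
        using D prime_chain_mono[OF D(1), of 0 n] J1(2) by blast
      ultimately have "y \<otimes> t \<in> L" by (intro mult)
      then have "t \<otimes> y \<in> L" using j yc by (simp add: m_comm)
      then show "z \<in> L" using j L by (auto simp: ideal_add[OF L(1)])
    qed
  qed
  then have JC: "J = C' 0" using C'(2) by blast
  then have Jp: "primeideal J R" using C0 by simp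
  have yM: "y \<in> ?M" using D prime_chain_mono[OF D(1), of 0 n] J1(2) by blast
  have "loc_regular R {\<one>} (y # xs) J"
    using xs(3) prime_mem[OF Jp yc] y(2)[folded JC] by (auto simp: sat_one[OF J])
  then show ?case using Jp xs yM len Suc.hyps(2) by (intro conjI exI[of _ "y # xs"]) auto
qed

lemma regular_local_ring_regular_sequence:
  assumes reg: "regular_local_ring R"
  obtains xs where "enat (length xs) = krull_dim R" "set xs \<subseteq> max_ideal R"
    "loc_regular R {\<one>} xs {\<zero>}"
proof -
  have loc: "local_ring R" using reg by (simp add: regular_local_ring_def)
  obtain A where A: "A \<subseteq> carrier R" "finite A" "enat (card A) = krull_dim R" "max_ideal R = Idl A"
    using reg by (auto simp: regular_local_ring_def)
  obtain ys where ys: "set ys = A" "length ys = card A"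
    using finite_distinct_list[OF A(2)] distinct_card by metis
  have M: "primeideal (max_ideal R) R"
    by (rule maximalideal_prime[OF maximalideal_max_ideal(1)[OF loc]])
  obtain C where C: "prime_chain R C (length ys)"
    using prime_chain_of_dim[OF _ M] A(3) ys(2) by metis
  have top: "primeideal (C (length ys)) R" and bot: "primeideal (C 0) R"
    using prime_chain_prime[OF C] by simp_all
  have "Idl ({\<zero>} \<union> set ys) = Idl (set ys)"
  proof (intro equalityI genideal_minimal genideal_ideal)
    have "\<zero> \<in> Idl (set ys)" using ideal_zero genideal_ideal A ys by simp
    then show "{\<zero>} \<union> set ys \<subseteq> Idl (set ys)" using genideal_self A ys by auto
    show "set ys \<subseteq> Idl ({\<zero>} \<union> set ys)" using genideal_self[of "{\<zero>} \<union> set ys"] A ys by auto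
  qed (use A ys in auto)
  then have gen: "max_ideal R = Idl ({\<zero>} \<union> set ys)" using A ys by simp
  have "\<exists>xs. length xs = length ys \<and> set xs \<subseteq> max_ideal R \<and> loc_regular R {\<one>} xs {\<zero>}"
  proof (rule conjunct2[OF regular_parameters_regular[OF loc zeroideal _ gen C]])
    show "{\<zero>} \<subseteq> C 0" using ideal_zero[OF prime_ideal[OF bot]] by simp
    show "C (length ys) \<subseteq> max_ideal R"
      by (intro local_ideal_subset_max[OF loc] prime_ideal top) (use prime_one[OF top] in auto)
  qed (use A ys in auto)
  then show ?thesis using that A ys by metis
qed

lemma complement_powers_complement:
  assumes "primeideal P R" "x \<in> carrier R"
  shows "carrier R - P \<subseteq> complement_powers R P x"
proof
  fix s assume "s \<in> carrier R - P"
  moreover from this have "s = s \<otimes> x [^] (0::nat)" by simp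
  ultimately show "s \<in> complement_powers R P x" unfolding complement_powers_def by blast
qed

lemma complement_powers_self:
  assumes P: "primeideal P R" and x: "x \<in> carrier R"
  shows "x \<in> complement_powers R P x"
  unfolding complement_powers_def
  using x submonoid.one_closed[OF primeideal_complement_submonoid[OF P]]
  by (intro CollectI exI[of _ \<one>] exI[of _ "1::nat"]) auto

lemma complement_powers_submonoid:
  assumes P: "primeideal P R" and x: "x \<in> carrier R"
  shows "submonoid (complement_powers R P x) R"
proof (rule submonoid.intro)
  note m = primeideal_complement_submonoid[OF P]
  show "complement_powers R P x \<subseteq> carrier R" using x by (auto simp: complement_powers_def)
  show "\<one> \<in> complement_powers R P x"
    using complement_powers_complement[OF P x] submonoid.one_closed[OF m] by blast
  fix u v assume "u \<in> complement_powers R P x" "v \<in> complement_powers R P x"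
  then obtain s t n m where *: "s \<in> carrier R - P" "t \<in> carrier R - P"
    "u = s \<otimes> x [^] (n::nat)" "v = t \<otimes> x [^] (m::nat)" by (auto simp: complement_powers_def)
  have "u \<otimes> v = (s \<otimes> t) \<otimes> x [^] (n + m)"
    using * x by (simp add: nat_pow_mult[symmetric] m_ac)
  moreover have "s \<otimes> t \<in> carrier R - P" using submonoid.m_closed[OF m *(1,2)] .
  ultimately show "u \<otimes> v \<in> complement_powers R P x" unfolding complement_powers_def by blast
qed

text \<open>
  A nonzerodivisor modulo \<open>J\<close> lies in no minimal prime of \<open>J\<close>, so each member of the sequence
  lengthens a chain of primes ending in \<open>N\<close> downwards by one. The new bottom prime is obtained as a
  prime that contains \<open>J\<close> and is disjoint from the products of powers of the nonzerodivisor with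
  elements outside the old bottom prime.
\<close>

lemma prime_chain_of_loc_regular:
  assumes S: "submonoid S R" and J: "ideal J R" and xs: "set xs \<subseteq> carrier R"
    and reg: "loc_regular R S xs J"
    and N: "primeideal N R" "J \<union> set xs \<subseteq> N" "N \<inter> S = {}"
  shows "\<exists>C. prime_chain R C (length xs) \<and> J \<subseteq> C 0 \<and> C (length xs) = N"
  using J xs reg N(2)
proof (induction xs arbitrary: J)
  case Nil
  then show ?case using N by (intro exI[of _ "\<lambda>_. N"]) (auto simp: prime_chain_def)
next
  case (Cons x xs)
  note J = Cons.prems(1)
  have x: "x \<in> carrier R" using Cons.prems by simp
  have "Idl (insert x J) \<subseteq> N"
    using Cons.prems by (intro genideal_minimal prime_ideal N) auto
  then obtain C where C: "prime_chain R C (length xs)" "Idl (insert x J) \<subseteq> C 0" "C (length xs) = N"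
    using Cons.IH[OF adjoin_ideal[OF J x]] Cons.prems by auto
  have C0: "primeideal (C 0) R" using prime_chain_prime[OF C(1)] by simp
  have C0S: "C 0 \<inter> S = {}" using prime_chain_mono[OF C(1), of 0 "length xs"] C(3) N(3) by auto
  have JC: "J \<subseteq> C 0" "x \<in> C 0" using adjoin_upper[OF J x] C(2) by auto
  let ?T = "complement_powers R (C 0) x"
  have T: "submonoid ?T R" by (rule complement_powers_submonoid[OF C0 x])
  have pow: "r \<in> sat R S J" if "r \<in> carrier R" "r \<otimes> x [^] n \<in> sat R S J" for r and n :: nat
    using that
  proof (induction n)
    case (Suc n)
    have "x \<otimes> (r \<otimes> x [^] n) \<in> sat R S J" using Suc.prems x by (simp add: m_ac)
    then have "r \<otimes> x [^] n \<in> sat R S J" using Cons.prems(3) Suc.prems(1) x by auto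
    then show ?case using Suc by simp
  qed simp
  have "J \<inter> ?T = {}"
  proof (rule ccontr)
    assume "J \<inter> ?T \<noteq> {}"
    then obtain s n where s: "s \<in> carrier R" "s \<notin> C 0" "s \<otimes> x [^] (n::nat) \<in> J"
      by (auto simp: complement_powers_def)
    then have "s \<otimes> x [^] n \<in> sat R S J" using sat_upper[OF S J] by blast
    then have "s \<in> sat R S J" by (rule pow[OF s(1)])
    then have "s \<in> sat R S (C 0)" using sat_mono[OF JC(1)] by blast
    then show False using sat_prime[OF C0 S] C0S s by blast
  qed
  then obtain P where P: "primeideal P R" "J \<subseteq> P" "P \<inter> ?T = {}"
    using prime_avoiding_submonoid[OF J T] by blast
  have "P \<subseteq> C 0"
    using P(3) complement_powers_complement[OF C0 x] ideal_subset[OF prime_ideal[OF P(1)]] by blast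
  moreover have "x \<in> ?T" by (rule complement_powers_self[OF C0 x])
  ultimately have "P \<subset> C 0" using JC P(3) by blast
  then show ?case using prime_chain_Cons[OF C(1) P(1)] P(2) C(3)
    by (intro exI[of _ "case_nat P C"]) auto
qed

lemma depth_le_krull_dim: "depth R \<le> krull_dim R"
  unfolding depth_def
proof (rule Sup_least, clarify)
  fix xs assume "regular_sequence R xs"
  then have xs: "set xs \<subseteq> carrier R" "loc_regular R {\<one>} xs {\<zero>}" "Idl (set xs) \<noteq> carrier R"
    by (simp_all add: regular_sequence_iff_loc_regular)
  obtain N where N: "maximalideal N R" "Idl (set xs) \<subseteq> N"
    using maximalideal_above[OF genideal_ideal[OF xs(1)] xs(3)] .
  have Np: "primeideal N R" by (rule maximalideal_prime[OF N(1)])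
  have "\<exists>C. prime_chain R C (length xs) \<and> {\<zero>} \<subseteq> C 0 \<and> C (length xs) = N"
    using N(2) genideal_self[OF xs(1)] ideal_zero[OF prime_ideal[OF Np]] prime_one[OF Np]
    by (intro prime_chain_of_loc_regular[OF one_submonoid zeroideal xs(1,2) Np]) auto
  then show "enat (length xs) \<le> krull_dim R" using le_krull_dim by blast
qed

end

section \<open>Filtrations with cyclic quotients\<close>

text \<open>
  Each step \<open>J \<subseteq> J + (a)\<close> has quotient \<open>R/(J : a)\<close>. This is either \<open>R/P\<close>, or it vanishes once \<open>f\<close> is
  inverted.
\<close>

inductive cyclic_filtration ::
  "('a, 'b) ring_scheme \<Rightarrow> 'a set \<Rightarrow> 'a \<Rightarrow> 'a set \<Rightarrow> 'a set \<Rightarrow> bool"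
  for R P f where
    refl: "ideal J R \<Longrightarrow> cyclic_filtration R P f J J"
  | step: "\<lbrakk>ideal J R; a \<in> carrier R; colon R J a = P \<or> f \<otimes>\<^bsub>R\<^esub> a \<in> J;
            cyclic_filtration R P f (Idl\<^bsub>R\<^esub> (insert a J)) K\<rbrakk>
           \<Longrightarrow> cyclic_filtration R P f J K"

context cring begin

lemma cyclic_filtration_trans:
  "cyclic_filtration R P f J K \<Longrightarrow> cyclic_filtration R P f K L \<Longrightarrow> cyclic_filtration R P f J L"
  by (induction rule: cyclic_filtration.induct) (auto intro: cyclic_filtration.step)

lemma cyclic_filtration_mult:
  assumes "cyclic_filtration R P f J K" "f \<in> carrier R" "u \<in> carrier R"
  shows "cyclic_filtration R P (f \<otimes> u) J K"
  using assms(1)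
proof (induction rule: cyclic_filtration.induct)
  case (step J a K)
  have "(f \<otimes> u) \<otimes> a \<in> J" if "f \<otimes> a \<in> J"
  proof -
    have "(f \<otimes> u) \<otimes> a = u \<otimes> (f \<otimes> a)" using assms step by (simp add: m_ac)
    then show ?thesis using ideal_mult_left[OF step(1) that assms(3)] by simp
  qed
  then show ?case using step by (intro cyclic_filtration.step[of J R a]) auto
qed (rule cyclic_filtration.refl)

text \<open>
  The ideal \<open>F + B g\<close>. Under multiplication by \<open>g\<close>, the ideals \<open>B \<supseteq> (F : g)\<close> correspond to the ideals
  between \<open>F\<close> and \<open>F + (g)\<close>, with the same successive quotients.
\<close>

definition translate :: "'a set \<Rightarrow> 'a \<Rightarrow> 'a set \<Rightarrow> 'a set" where
  "translate F g B = {u \<oplus> b \<otimes> g | u b. u \<in> F \<and> b \<in> B}"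

lemma translateI: "u \<in> F \<Longrightarrow> b \<in> B \<Longrightarrow> u \<oplus> b \<otimes> g \<in> translate F g B"
  unfolding translate_def by blast

lemma translate_ideal:
  assumes F: "ideal F R" and g: "g \<in> carrier R" and B: "ideal B R"
  shows "ideal (translate F g B) R"
proof (rule idealI')
  note c = ideal.Icarr[OF F] ideal.Icarr[OF B]
  show "translate F g B \<subseteq> carrier R" using c g by (auto simp: translate_def)
  show "\<zero> \<in> translate F g B"
    using ideal_zero[OF F] ideal_zero[OF B] g
    by (auto simp: translate_def intro!: exI[of _ \<zero>])
next
  note c = ideal.Icarr[OF F] ideal.Icarr[OF B]
  fix y z assume "y \<in> translate F g B" "z \<in> translate F g B"
  then obtain u b v d where *: "u \<in> F" "b \<in> B" "v \<in> F" "d \<in> B"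
    "y = u \<oplus> b \<otimes> g" "z = v \<oplus> d \<otimes> g" by (auto simp: translate_def)
  have "y \<oplus> z = (u \<oplus> v) \<oplus> (b \<oplus> d) \<otimes> g" using * c g by (simp add: l_distr a_ac)
  then show "y \<oplus> z \<in> translate F g B"
    using * by (simp add: translateI ideal_add[OF F] ideal_add[OF B])
next
  note c = ideal.Icarr[OF F] ideal.Icarr[OF B]
  fix r z assume r: "r \<in> carrier R" and "z \<in> translate F g B"
  then obtain v d where *: "v \<in> F" "d \<in> B" "z = v \<oplus> d \<otimes> g" by (auto simp: translate_def)
  have "r \<otimes> z = r \<otimes> v \<oplus> (r \<otimes> d) \<otimes> g" using * c g r by (simp add: r_distr m_assoc)
  then show "r \<otimes> z \<in> translate F g B"
    using * r ideal_mult_left[OF F] ideal_mult_left[OF B] unfolding translate_def by blast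
qed

lemma translate_adjoin:
  assumes F: "ideal F R" and g: "g \<in> carrier R" and B: "ideal B R" and a: "a \<in> carrier R"
  shows "translate F g (Idl (insert a B)) = Idl (insert (a \<otimes> g) (translate F g B))"
proof (intro equalityI subsetI)
  note c = ideal.Icarr[OF F] ideal.Icarr[OF B]
  have ag: "a \<otimes> g \<in> carrier R" using a g by simp
  note T = translate_ideal[OF F g B]
  fix z
  {
    assume "z \<in> translate F g (Idl (insert a B))"
    then obtain u b r where *: "u \<in> F" "b \<in> B" "r \<in> carrier R" "z = u \<oplus> (b \<oplus> r \<otimes> a) \<otimes> g"
      by (auto simp: translate_def mem_adjoin[OF B a])
    then have "z = (u \<oplus> b \<otimes> g) \<oplus> r \<otimes> (a \<otimes> g)" using c a g by (simp add: l_distr a_ac m_assoc)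
    then show "z \<in> Idl (insert (a \<otimes> g) (translate F g B))"
      unfolding mem_adjoin[OF T ag] using *(3) translateI[OF *(1,2)] by blast
  next
    assume "z \<in> Idl (insert (a \<otimes> g) (translate F g B))"
    then obtain y r where y: "y \<in> translate F g B" "r \<in> carrier R" "z = y \<oplus> r \<otimes> (a \<otimes> g)"
      unfolding mem_adjoin[OF T ag] by blast
    then obtain u b where "u \<in> F" "b \<in> B" "y = u \<oplus> b \<otimes> g" unfolding translate_def by blast
    with y have *: "u \<in> F" "b \<in> B" "r \<in> carrier R" "z = (u \<oplus> b \<otimes> g) \<oplus> r \<otimes> (a \<otimes> g)" by simp_all
    then have "z = u \<oplus> (b \<oplus> r \<otimes> a) \<otimes> g" using c a g by (simp add: l_distr a_ac m_assoc)
    moreover have "b \<oplus> r \<otimes> a \<in> Idl (insert a B)" using * unfolding mem_adjoin[OF B a] by blast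
    ultimately show "z \<in> translate F g (Idl (insert a B))" using * unfolding translate_def by blast
  }
qed

lemma colon_translate:
  assumes F: "ideal F R" and g: "g \<in> carrier R" and B: "ideal B R" and a: "a \<in> carrier R"
    and FB: "colon R F g \<subseteq> B"
  shows "colon R (translate F g B) (a \<otimes> g) = colon R B a"
proof (intro equalityI subsetI)
  note c = ideal.Icarr[OF F] ideal.Icarr[OF B]
  fix r
  {
    assume "r \<in> colon R (translate F g B) (a \<otimes> g)"
    then obtain u b where *: "r \<in> carrier R" "u \<in> F" "b \<in> B" "r \<otimes> (a \<otimes> g) = u \<oplus> b \<otimes> g"
      by (auto simp: colon_def translate_def)
    have "(r \<otimes> a \<ominus> b) \<otimes> g = r \<otimes> (a \<otimes> g) \<ominus> b \<otimes> g"
      using * c a g by (simp add: diff_mult_distrib m_assoc)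
    also have "\<dots> = u" using * c g by (simp add: add_diff_cancel)
    finally have "r \<otimes> a \<ominus> b \<in> colon R F g" using * c a by (simp add: colon_def)
    then have "r \<otimes> a \<ominus> b \<in> B" using FB by blast
    then have "r \<otimes> a \<in> B" using * a by (intro ideal_diffD[OF B, of "r \<otimes> a" b]) auto
    then show "r \<in> colon R B a" using * by (simp add: colon_def)
  next
    assume "r \<in> colon R B a"
    then have *: "r \<in> carrier R" "r \<otimes> a \<in> B" by (simp_all add: colon_def)
    then have "r \<otimes> (a \<otimes> g) = \<zero> \<oplus> (r \<otimes> a) \<otimes> g" using a g by (simp add: m_assoc)
    then show "r \<in> colon R (translate F g B) (a \<otimes> g)"
      using * ideal_zero[OF F] unfolding colon_def translate_def by blast
  }
qed

lemma cyclic_filtration_translate: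
  assumes "cyclic_filtration R P f B K" and F: "ideal F R" and g: "g \<in> carrier R"
    and f: "f \<in> carrier R" and FB: "colon R F g \<subseteq> B"
  shows "cyclic_filtration R P f (translate F g B) (translate F g K)"
  using assms(1) FB
proof (induction rule: cyclic_filtration.induct)
  case (refl J)
  then show ?case by (intro cyclic_filtration.refl translate_ideal F g)
next
  case (step J a K)
  have "f \<otimes> (a \<otimes> g) \<in> translate F g J" if "f \<otimes> a \<in> J"
  proof -
    have "f \<otimes> (a \<otimes> g) = \<zero> \<oplus> (f \<otimes> a) \<otimes> g" using step g f by (simp add: m_assoc)
    then show ?thesis using that ideal_zero[OF F] unfolding translate_def by blast
  qed
  moreover have "cyclic_filtration R P f (Idl (insert (a \<otimes> g) (translate F g J))) (translate F g K)"
    unfolding translate_adjoin[OF F g step(1,2), symmetric]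
    using step.prems adjoin_upper[OF step(1,2)] by (intro step.IH) auto
  moreover have "colon R (translate F g J) (a \<otimes> g) = P \<or> f \<otimes> (a \<otimes> g) \<in> translate F g J"
    using step.hyps(3) colon_translate[OF F g step(1,2) step.prems] calculation(1) by auto
  ultimately show ?case
    using step.hyps(2) g
    by (intro cyclic_filtration.step[OF translate_ideal[OF F g step(1)], of "a \<otimes> g"]) simp_all
qed

text \<open>
  Since \<open>(F + (g)) / F\<close> is isomorphic to \<open>R/(F : g)\<close>, a filtration of the latter gives one of the
  former.
\<close>

lemma cyclic_filtration_adjoin:
  assumes filt: "cyclic_filtration R P f (colon R F g) (carrier R)"
    and F: "ideal F R" and g: "g \<in> carrier R" and f: "f \<in> carrier R"
  shows "cyclic_filtration R P f F (Idl (insert g F))"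
proof -
  note c = ideal.Icarr[OF F]
  have "translate F g (colon R F g) = F"
  proof (intro equalityI subsetI)
    fix u assume "u \<in> F"
    then show "u \<in> translate F g (colon R F g)"
      using ideal_zero[OF colon_ideal[OF F g]] c g unfolding translate_def
      by (intro CollectI exI[of _ u] exI[of _ \<zero>]) auto
  qed (auto simp: translate_def colon_def ideal_add[OF F])
  moreover have "translate F g (carrier R) = Idl (insert g F)"
    unfolding set_eq_iff mem_adjoin[OF F g] translate_def by blast
  ultimately show ?thesis
    using cyclic_filtration_translate[OF filt F g f] by simp
qed

lemma loc_regular_carrier: "submonoid S R \<Longrightarrow> set xs \<subseteq> carrier R \<Longrightarrow> loc_regular R S xs (carrier R)"
proof (induction xs)
  case (Cons x xs)
  have "sat R S (carrier R) = carrier R"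
    using sat_upper[OF Cons.prems(1) oneideal] by (auto simp: sat_def)
  moreover have "Idl (insert x (carrier R)) = carrier R"
    using Cons.prems by (simp add: insert_absorb Idl_ideal[OF oneideal])
  ultimately show ?case using Cons by simp
qed simp

lemma adjoin_swap:
  assumes "ideal J R" "a \<in> carrier R" "x \<in> carrier R"
  shows "Idl (insert x (Idl (insert a J))) = Idl (insert a (Idl (insert x J)))"
  using Idl_Un_ideal[of "{x}" "insert a J"] Idl_Un_ideal[of "{a}" "insert x J"]
    assms ideal_subset[OF assms(1)] by (simp add: insert_commute)

text \<open>
  The exact sequence \<open>0 \<rightarrow> R/N \<rightarrow> R/J \<rightarrow> R/(J + (a)) \<rightarrow> 0\<close>, where the first map is multiplication by \<open>a\<close>
  and the premise \<open>colon\<close> expresses injectivity after localization. An element that is regular on both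
  ends is regular on the middle, and then the sequence stays exact modulo that element, which lets the
  induction on the list continue with \<open>N + (x)\<close> and \<open>J + (x)\<close>.
\<close>

lemma loc_regular_extension:
  assumes S: "submonoid S R" and xs: "set xs \<subseteq> carrier R" and a: "a \<in> carrier R"
    and J: "ideal J R" and N: "ideal N R"
    and colon: "\<And>r. r \<in> carrier R \<Longrightarrow> r \<otimes> a \<in> sat R S J \<longleftrightarrow> r \<in> sat R S N"
    and regN: "loc_regular R S xs N" and regK: "loc_regular R S xs (Idl (insert a J))"
  shows "loc_regular R S xs J"
  using xs J N colon regN regK
proof (induction xs arbitrary: J N)
  case (Cons x xs)
  note J = Cons.prems(2) and N = Cons.prems(3) and colon = Cons.prems(4)
  have x: "x \<in> carrier R" "set xs \<subseteq> carrier R" using Cons.prems(1) by auto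
  let ?K = "Idl (insert a J)" and ?J = "Idl (insert x J)" and ?N = "Idl (insert x N)"
  note sJ = sat_ideal[OF S J] and sN = sat_ideal[OF S N]
  have K: "ideal ?K R" by (rule adjoin_ideal[OF J a])
  have J': "ideal ?J R" by (rule adjoin_ideal[OF J x(1)])
  have N': "ideal ?N R" by (rule adjoin_ideal[OF N x(1)])
  have SC: "s \<in> carrier R" if "s \<in> S" for s using submonoid_carrier[OF S that] .
  have regN: "r \<in> sat R S N" if "r \<in> carrier R" "x \<otimes> r \<in> sat R S N" for r
    using Cons.prems(5) that by simp
  have regK: "\<exists>s\<in>S. \<exists>j\<in>J. \<exists>t\<in>carrier R. s \<otimes> r = j \<oplus> t \<otimes> a"
    if "r \<in> carrier R" "x \<otimes> r \<in> ?K" for r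
  proof -
    have "x \<otimes> r \<in> sat R S ?K" using that(2) sat_upper[OF S K] by blast
    then have "r \<in> sat R S ?K" using Cons.prems(6) that by simp
    then show ?thesis unfolding sat_def mem_adjoin[OF J a] by blast
  qed
  have JK: "J \<subseteq> ?K" using adjoin_upper[OF J a] by blast
  have regJ: "r \<in> sat R S J" if r: "r \<in> carrier R" "x \<otimes> r \<in> sat R S J" for r
  proof -
    obtain s0 where s0: "s0 \<in> S" "s0 \<otimes> (x \<otimes> r) \<in> J" using r(2) by (auto simp: sat_def)
    have "x \<otimes> (s0 \<otimes> r) \<in> ?K" using s0 JK SC[OF s0(1)] x r by (auto simp: m_lcomm)
    then obtain s j t where s: "s \<in> S" "j \<in> J" "t \<in> carrier R" "s \<otimes> (s0 \<otimes> r) = j \<oplus> t \<otimes> a"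
      using regK[of "s0 \<otimes> r"] SC[OF s0(1)] r by auto
    have c: "j \<in> carrier R" "s \<in> carrier R" "s0 \<in> carrier R"
      using ideal.Icarr[OF J s(2)] SC s s0 by auto
    have jJ: "j \<in> sat R S J" using sat_upper[OF S J] s by blast
    have "x \<otimes> j \<oplus> (x \<otimes> t) \<otimes> a = (s \<otimes> s0) \<otimes> (x \<otimes> r)"
    proof -
      have "(s \<otimes> s0) \<otimes> (x \<otimes> r) = x \<otimes> (s \<otimes> (s0 \<otimes> r))" using c x r by (simp add: m_ac)
      also have "\<dots> = x \<otimes> j \<oplus> (x \<otimes> t) \<otimes> a"
        unfolding s(4) using c x s a by (simp add: r_distr m_assoc)
      finally show ?thesis ..
    qed
    also have "\<dots> \<in> sat R S J" using r(2) c by (simp add: ideal_mult_left[OF sJ])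
    finally have 1: "x \<otimes> j \<oplus> (x \<otimes> t) \<otimes> a \<in> sat R S J" .
    have 2: "x \<otimes> j \<in> sat R S J" by (rule ideal_mult_left[OF sJ jJ x(1)])
    have "(x \<otimes> t) \<otimes> a \<in> sat R S J"
      by (rule ideal_addD[OF sJ 2 _ 1]) (use x s a in simp)
    then have "x \<otimes> t \<in> sat R S N" using colon x s by simp
    then have "t \<in> sat R S N" by (rule regN[OF s(3)])
    then have "t \<otimes> a \<in> sat R S J" using colon s by simp
    then have "s \<otimes> (s0 \<otimes> r) \<in> sat R S J" unfolding s(4) by (rule ideal_add[OF sJ jJ])
    then have "s0 \<otimes> r \<in> sat R S J" using sat_cancel[OF S J _ s(1)] c r by simp
    then show ?thesis by (rule sat_cancel[OF S J r(1) s0(1)])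
  qed
  have "r \<otimes> a \<in> sat R S ?J \<longleftrightarrow> r \<in> sat R S ?N" if r: "r \<in> carrier R" for r
  proof
    assume "r \<in> sat R S ?N"
    then obtain s n t where s: "s \<in> S" "n \<in> N" "t \<in> carrier R" "s \<otimes> r = n \<oplus> t \<otimes> x"
      unfolding sat_def mem_adjoin[OF N x(1)] by blast
    have c: "n \<in> carrier R" "s \<in> carrier R" using ideal.Icarr[OF N s(2)] SC s by auto
    have "n \<in> sat R S N" using sat_upper[OF S N] s by blast
    then have "n \<otimes> a \<in> sat R S J" using colon c by simp
    then have 1: "n \<otimes> a \<in> sat R S ?J"
      using sat_mono[of J ?J S] adjoin_upper[OF J x(1)] by blast
    have "x \<in> sat R S ?J" using sat_upper[OF S J'] adjoin_upper[OF J x(1)] by blast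
    then have 2: "(t \<otimes> a) \<otimes> x \<in> sat R S ?J"
      using s a by (intro ideal_mult_left[OF sat_ideal[OF S J']]) auto
    have "s \<otimes> (r \<otimes> a) = (n \<oplus> t \<otimes> x) \<otimes> a" using c r a s(4)[symmetric] by (simp add: m_assoc)
    also have "\<dots> = n \<otimes> a \<oplus> (t \<otimes> a) \<otimes> x" using c s(3) a x by (simp add: l_distr r_distr m_ac)
    finally have "s \<otimes> (r \<otimes> a) \<in> sat R S ?J" using ideal_add[OF sat_ideal[OF S J'] 1 2] by simp
    then show "r \<otimes> a \<in> sat R S ?J" using r a by (intro sat_cancel[OF S J' _ s(1), of "r \<otimes> a"]) simp_all
  next
    assume "r \<otimes> a \<in> sat R S ?J"
    then obtain s j w where s: "s \<in> S" "j \<in> J" "w \<in> carrier R" "s \<otimes> (r \<otimes> a) = j \<oplus> w \<otimes> x"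
      unfolding sat_def mem_adjoin[OF J x(1)] by blast
    have c: "j \<in> carrier R" "s \<in> carrier R" using ideal.Icarr[OF J s(2)] SC s by auto
    have "a \<in> ?K" using adjoin_upper[OF J a] by blast
    then have "(s \<otimes> r) \<otimes> a \<in> ?K" using c r by (intro ideal_mult_left[OF K]) auto
    then have "j \<oplus> w \<otimes> x \<in> ?K" unfolding s(4)[symmetric] using c r a by (simp add: m_assoc)
    then have "w \<otimes> x \<in> ?K"
      using s JK c x by (intro ideal_addD[OF K, of j "w \<otimes> x"]) auto
    then have "x \<otimes> w \<in> ?K" using s x by (simp add: m_comm)
    then obtain s' j' t where s': "s' \<in> S" "j' \<in> J" "t \<in> carrier R" "s' \<otimes> w = j' \<oplus> t \<otimes> a"
      using regK[OF s(3)] by auto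
    have c': "j' \<in> carrier R" "s' \<in> carrier R" using ideal.Icarr[OF J s'(2)] SC s' by auto
    have "s' \<otimes> (s \<otimes> (r \<otimes> a)) = (s' \<otimes> j \<oplus> x \<otimes> j') \<oplus> (t \<otimes> x) \<otimes> a"
    proof -
      have "s' \<otimes> (s \<otimes> (r \<otimes> a)) = s' \<otimes> j \<oplus> x \<otimes> (s' \<otimes> w)"
        unfolding s(4) using c c' s x by (simp add: r_distr m_ac)
      also have "\<dots> = (s' \<otimes> j \<oplus> x \<otimes> j') \<oplus> (t \<otimes> x) \<otimes> a"
        unfolding s'(4) using c c' s s' x a by (simp add: r_distr m_ac a_assoc)
      finally show ?thesis .
    qed
    then have "(s' \<otimes> s \<otimes> r) \<otimes> a \<ominus> (t \<otimes> x) \<otimes> a = s' \<otimes> j \<oplus> x \<otimes> j'"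
      using c c' s s' r x a by (simp add: m_assoc add_diff_cancel)
    then have "(s' \<otimes> s \<otimes> r \<ominus> t \<otimes> x) \<otimes> a = s' \<otimes> j \<oplus> x \<otimes> j'"
      using c c' s s' r x a by (simp add: diff_mult_distrib)
    also have "\<dots> \<in> J" using s s' c c' x by (simp add: ideal_closed[OF J])
    finally have "(s' \<otimes> s \<otimes> r \<ominus> t \<otimes> x) \<otimes> a \<in> sat R S J" using sat_upper[OF S J] by blast
    then have "s' \<otimes> s \<otimes> r \<ominus> t \<otimes> x \<in> sat R S N"
      using colon[of "s' \<otimes> s \<otimes> r \<ominus> t \<otimes> x"] c c' r s' x by simp
    then have 1: "s' \<otimes> s \<otimes> r \<ominus> t \<otimes> x \<in> sat R S ?N"
      using sat_mono[of N ?N S] adjoin_upper[OF N x(1)] by blast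
    have "x \<in> sat R S ?N" using sat_upper[OF S N'] adjoin_upper[OF N x(1)] by blast
    then have 2: "t \<otimes> x \<in> sat R S ?N"
      by (rule ideal_mult_left[OF sat_ideal[OF S N'] _ s'(3)])
    have 3: "(s' \<otimes> s) \<otimes> r \<in> sat R S ?N"
      using c c' r by (intro ideal_diffD[OF sat_ideal[OF S N'] _ 2 1]) auto
    show "r \<in> sat R S ?N"
      by (rule sat_cancel[OF S N' r submonoid.m_closed[OF S s'(1) s(1)] 3])
  qed
  then have "loc_regular R S xs ?J"
    using Cons.prems(5,6) adjoin_swap[OF J a x(1)] by (intro Cons.IH[OF x(2) J' N']) auto
  then show ?case using regJ by simp
qed simp

text \<open>
  Climbing the filtration from the top \<open>R\<close>, where the quotient is zero and every sequence is weakly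
  regular. A step killed by \<open>f \<in> S\<close> does not change the localization.
\<close>

lemma loc_regular_filtration:
  assumes "cyclic_filtration R P f J K" and K: "K = carrier R" and P: "ideal P R"
    and S: "submonoid S R" and f: "f \<in> S"
    and xs: "set xs \<subseteq> carrier R" and reg: "loc_regular R S xs P"
  shows "loc_regular R S xs J"
  using assms(1) K
proof (induction rule: cyclic_filtration.induct)
  case (refl J)
  then show ?case using loc_regular_carrier[OF S xs] by simp
next
  case (step J a K)
  have regK: "loc_regular R S xs (Idl (insert a J))" using step by simp
  note J = step(1) and a = step(2)
  from step(3) show ?case
  proof
    assume colon: "colon R J a = P"
    have "r \<otimes> a \<in> sat R S J \<longleftrightarrow> r \<in> sat R S P" if r: "r \<in> carrier R" for r
      using r a submonoid_carrier[OF S] unfolding colon[symmetric]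
      by (auto simp: sat_def colon_def m_assoc)
    then show ?thesis by (rule loc_regular_extension[OF S xs a J P _ reg regK])
  next
    assume fa: "f \<otimes> a \<in> J"
    have fc: "f \<in> carrier R" using submonoid_carrier[OF S f] .
    have "r \<otimes> a \<in> sat R S J \<longleftrightarrow> r \<in> sat R S (carrier R)" if r: "r \<in> carrier R" for r
    proof -
      have "f \<otimes> (r \<otimes> a) = r \<otimes> (f \<otimes> a)" using r a fc by (simp add: m_ac)
      then have "f \<otimes> (r \<otimes> a) \<in> J" using ideal_mult_left[OF J fa r] by simp
      then show ?thesis using r a f fc by (auto simp: sat_def)
    qed
    then show ?thesis
      by (rule loc_regular_extension[OF S xs a J oneideal _ loc_regular_carrier[OF S xs] regK])
  qed
qed

end

context noeth_cring begin

text \<open>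
  In a prime filtration of \<open>R/c\<close> all primes contain \<open>I\<close>, so by minimality \<open>P\<close> is the only one of them
  contained in \<open>P\<close>. From each of the others one takes an element outside \<open>P\<close> and collects these elements
  in \<open>f\<close>.
\<close>

lemma generic_cyclic_filtration:
  assumes P: "P \<in> minimal_primes R I" and c: "ideal c R" and Ic: "I \<subseteq> c"
  shows "\<exists>f\<in>carrier R - P. cyclic_filtration R P f c (carrier R)"
  using c Ic
proof (induction rule: ideal_induct)
  case (larger c)
  have Pp: "primeideal P R" using P by (simp add: minimal_primes_def)
  note m = primeideal_complement_submonoid[OF Pp]
  show ?case
  proof (cases "c = carrier R")
    case True
    then show ?thesis
      using submonoid.one_closed[OF m] cyclic_filtration.refl[OF larger(1)] by auto
  next
    case False
    obtain a where a: "a \<in> carrier R" "a \<notin> c" "primeideal (colon R c a) R"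
      using associated_prime_exists[OF larger(1) False] .
    let ?c = "Idl (insert a c)"
    have c': "ideal ?c R" "insert a c \<subseteq> ?c"
      using adjoin_ideal[OF larger(1) a(1)] adjoin_upper[OF larger(1) a(1)] by simp_all
    have "c \<subset> ?c" "I \<subseteq> ?c" using c'(2) a(2) larger(3) by auto
    then obtain f where f: "f \<in> carrier R - P" "cyclic_filtration R P f ?c (carrier R)"
      using larger(2)[OF c'(1)] by blast
    have Ia: "I \<subseteq> colon R c a" using larger(3) subset_colon[OF larger(1) a(1)] by simp
    show ?thesis
    proof (cases "colon R c a \<subseteq> P")
      case True
      then have "colon R c a = P" using P a(3) Ia by (auto simp: minimal_primes_def)
      then show ?thesis using f a cyclic_filtration.step[OF larger(1) a(1), of P f] by auto
    next
      case False
      then obtain u where u: "u \<in> carrier R" "u \<notin> P" "u \<otimes> a \<in> c" by (auto simp: colon_def)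
      have "(f \<otimes> u) \<otimes> a \<in> c"
        using ideal_mult_left[OF larger(1) u(3), of f] f u a by (simp add: m_assoc)
      then have "cyclic_filtration R P (f \<otimes> u) c (carrier R)"
        using f u cyclic_filtration_mult[OF f(2)] cyclic_filtration.step[OF larger(1) a(1)] by simp
      moreover have "f \<otimes> u \<in> carrier R - P" using submonoid.m_closed[OF m f(1), of u] u by simp
      ultimately show ?thesis by blast
    qed
  qed
qed

lemma generic_cyclic_filtration_finite:
  assumes P: "P \<in> minimal_primes R I" and "finite X" and "\<And>c. c \<in> X \<Longrightarrow> ideal c R \<and> I \<subseteq> c"
  shows "\<exists>f\<in>carrier R - P. \<forall>c\<in>X. cyclic_filtration R P f c (carrier R)"
  using assms(2,3)
proof (induction X)
  case empty
  have "primeideal P R" using P by (simp add: minimal_primes_def)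
  then show ?case using submonoid.one_closed[OF primeideal_complement_submonoid] by blast
next
  case (insert c X)
  have Pp: "primeideal P R" using P by (simp add: minimal_primes_def)
  obtain f where f: "f \<in> carrier R - P" "\<forall>c\<in>X. cyclic_filtration R P f c (carrier R)"
    using insert by auto
  obtain u where u: "u \<in> carrier R - P" "cyclic_filtration R P u c (carrier R)"
    using generic_cyclic_filtration[OF P, of c] insert.prems by auto
  have uf: "u \<otimes> f = f \<otimes> u" using u f by (simp add: m_comm)
  show ?case
  proof (intro bexI[of _ "f \<otimes> u"] ballI)
    show "f \<otimes> u \<in> carrier R - P"
      using submonoid.m_closed[OF primeideal_complement_submonoid[OF Pp] f(1) u(1)] .
    fix d assume "d \<in> insert c X"
    then show "cyclic_filtration R P (f \<otimes> u) d (carrier R)"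
      using cyclic_filtration_mult[of P u c "carrier R" f] cyclic_filtration_mult[of P f d "carrier R" u]
        f u uf by auto
  qed
qed

end

section \<open>Powers of an ideal and monomials in its generators\<close>

lemma nat_sequence_monotone_subsequence:
  fixes a :: "nat \<Rightarrow> nat"
  shows "\<exists>\<phi> :: nat \<Rightarrow> nat. strict_mono \<phi> \<and> (\<forall>i j. i \<le> j \<longrightarrow> a (\<phi> i) \<le> a (\<phi> j))"
proof -
  obtain \<psi> where \<psi>: "strict_mono \<psi>" "monoseq (\<lambda>n. a (\<psi> n))"
    using seq_monosub[of a] by blast
  from \<psi>(2)[unfolded monoseq_def] show ?thesis
  proof
    assume "\<forall>m. \<forall>n\<ge>m. a (\<psi> m) \<le> a (\<psi> n)"
    then show ?thesis using \<psi>(1) by (intro exI[of _ \<psi>]) simp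
  next
    assume dec: "\<forall>m. \<forall>n\<ge>m. a (\<psi> n) \<le> a (\<psi> m)"
    obtain N where N: "\<And>n. a (\<psi> N) \<le> a (\<psi> n)"
      using ex_has_least_nat[of "\<lambda>_. True" 0 "\<lambda>n. a (\<psi> n)"] by auto
    have "a (\<psi> (i + N)) = a (\<psi> N)" for i
      using dec N[of "i + N"] by (simp add: antisym)
    moreover have "strict_mono (\<lambda>i. \<psi> (i + N))" using \<psi>(1) by (simp add: strict_mono_def)
    ultimately show ?thesis by (intro exI[of _ "\<lambda>i. \<psi> (i + N)"]) auto
  qed
qed

text \<open>
  Dickson's lemma in the form used with ascending chain conditions: every sequence of exponent vectors
  has a subsequence that ascends in all coordinates.
\<close>

lemma dickson:
  fixes a :: "nat \<Rightarrow> nat list"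
  assumes "\<And>n. length (a n) = m"
  shows "\<exists>\<phi> :: nat \<Rightarrow> nat. strict_mono \<phi> \<and> (\<forall>i j. i \<le> j \<longrightarrow> list_all2 (\<le>) (a (\<phi> i)) (a (\<phi> j)))"
  using assms
proof (induction m arbitrary: a)
  case 0
  then show ?case by (intro exI[of _ id]) (auto simp: strict_mono_def)
next
  case (Suc m)
  obtain \<phi> :: "nat \<Rightarrow> nat" where \<phi>: "strict_mono \<phi>" "\<And>i j. i \<le> j \<Longrightarrow> hd (a (\<phi> i)) \<le> hd (a (\<phi> j))"
    using nat_sequence_monotone_subsequence[of "\<lambda>n. hd (a n)"] by auto
  have "length (tl (a (\<phi> n))) = m" for n using Suc.prems by simp
  from Suc.IH[of "\<lambda>n. tl (a (\<phi> n))", OF this] obtain \<psi> :: "nat \<Rightarrow> nat" where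
    \<psi>: "strict_mono \<psi>" "\<And>i j. i \<le> j \<Longrightarrow> list_all2 (\<le>) (tl (a (\<phi> (\<psi> i)))) (tl (a (\<phi> (\<psi> j))))"
    by auto
  have cons: "a n = hd (a n) # tl (a n)" for n
    using Suc.prems[of n] by (cases "a n") auto
  have "list_all2 (\<le>) (a (\<phi> (\<psi> i))) (a (\<phi> (\<psi> j)))" if "i \<le> j" for i j
    using \<phi>(2)[of "\<psi> i" "\<psi> j"] \<psi>(2)[OF that] strict_mono_less_eq[OF \<psi>(1)] that
    by (subst (1 2) cons) simp
  then show ?case
    using \<phi>(1) \<psi>(1) by (intro exI[of _ "\<phi> \<circ> \<psi>"]) (simp add: strict_mono_def)
qed

lemma list_all2_le_imp_add:
  fixes \<mu> \<nu> :: "nat list"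
  assumes "list_all2 (\<le>) \<mu> \<nu>"
  shows "\<exists>\<delta>. length \<delta> = length \<mu> \<and> \<nu> = map2 (+) \<mu> \<delta>"
  using assms
proof (induction rule: list_all2_induct)
  case (Cons x xs y ys)
  then obtain \<delta> where "length \<delta> = length xs" "ys = map2 (+) xs \<delta>" by auto
  then show ?case using Cons by (intro exI[of _ "(y - x) # \<delta>"]) auto
qed simp

lemma sum_list_map2_add:
  fixes \<mu> \<nu> :: "nat list"
  shows "length \<mu> = length \<nu> \<Longrightarrow> sum_list (map2 (+) \<mu> \<nu>) = sum_list \<mu> + sum_list \<nu>"
  by (induction \<mu> \<nu> rule: list_induct2) auto

lemma map2_add_strict_mono:
  fixes \<mu> \<nu> \<delta> :: "nat list"
  assumes "length \<mu> = length \<nu>" "length \<nu> = length \<delta>" "\<mu> < \<nu>"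
  shows "map2 (+) \<mu> \<delta> < map2 (+) \<nu> \<delta>"
  using assms by (induction \<mu> \<nu> \<delta> rule: list_induct3) auto

lemma finite_exponents: "finite {\<mu> :: nat list. length \<mu> = m \<and> sum_list \<mu> = n}"
proof (rule finite_subset)
  show "{\<mu>. length \<mu> = m \<and> sum_list \<mu> = n} \<subseteq> {\<mu>. set \<mu> \<subseteq> {..n} \<and> length \<mu> = m}"
    by (auto intro: member_le_sum_list)
  show "finite {\<mu> :: nat list. set \<mu> \<subseteq> {..n} \<and> length \<mu> = m}"
    by (rule finite_lists_length_eq) simp
qed

text \<open>
  Exponent vectors are lists: the lexicographic order on lists is linear and, for lists of equal length,
  compatible with addition.
\<close>

fun monomial :: "('a, 'b) ring_scheme \<Rightarrow> 'a list \<Rightarrow> nat list \<Rightarrow> 'a" where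
  "monomial R (g # gs) (e # es) = g [^]\<^bsub>R\<^esub> e \<otimes>\<^bsub>R\<^esub> monomial R gs es"
| "monomial R _ _ = \<one>\<^bsub>R\<^esub>"

definition exponents :: "nat \<Rightarrow> nat \<Rightarrow> nat list set" where
  "exponents m n = {\<mu>. length \<mu> = m \<and> sum_list \<mu> = n}"

context cring begin

lemma monomial_closed: "set gs \<subseteq> carrier R \<Longrightarrow> monomial R gs es \<in> carrier R"
proof (induction gs arbitrary: es)
  case (Cons g gs)
  then show ?case by (cases es) auto
qed simp

lemma monomial_add:
  assumes "length gs = length \<mu>" "length \<mu> = length \<nu>" "set gs \<subseteq> carrier R"
  shows "monomial R gs (map2 (+) \<mu> \<nu>) = monomial R gs \<mu> \<otimes> monomial R gs \<nu>"
  using assms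
proof (induction gs \<mu> \<nu> rule: list_induct3)
  case (Cons g gs e \<mu> d \<nu>)
  then show ?case
    using monomial_closed[of gs \<mu>] monomial_closed[of gs \<nu>]
    by (simp add: nat_pow_mult[symmetric] m_ac)
qed simp

lemma monomial_factor_aux:
  assumes "length gs = length \<mu>" "set gs \<subseteq> carrier R" "sum_list \<mu> = Suc n"
  shows "\<exists>\<nu>\<in>exponents (length gs) n. \<exists>g\<in>set gs. monomial R gs \<mu> = monomial R gs \<nu> \<otimes> g"
  using assms
proof (induction gs \<mu> arbitrary: n rule: list_induct2)
  case (Cons g gs e \<mu>)
  have c: "g \<in> carrier R" "set gs \<subseteq> carrier R" using Cons.prems by auto
  show ?case
  proof (cases e)
    case 0
    then obtain \<nu> h where \<nu>: "\<nu> \<in> exponents (length gs) n" "h \<in> set gs"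
      "monomial R gs \<mu> = monomial R gs \<nu> \<otimes> h"
      using Cons.IH[OF c(2), of n] Cons.prems by (elim meta_impE) auto
    have "monomial R (g # gs) (e # \<mu>) = monomial R (g # gs) (0 # \<nu>) \<otimes> h"
      using 0 \<nu> c monomial_closed[OF c(2)] by auto
    then show ?thesis using \<nu> by (intro bexI[of _ "0 # \<nu>"] bexI[of _ h]) (auto simp: exponents_def)
  next
    case (Suc e')
    have "monomial R (g # gs) (e # \<mu>) = monomial R (g # gs) (e' # \<mu>) \<otimes> g"
      using Suc c monomial_closed[OF c(2), of \<mu>] by (simp add: m_ac)
    then show ?thesis using Suc Cons by (intro bexI[of _ "e' # \<mu>"] bexI[of _ g]) (auto simp: exponents_def)
  qed
qed simp

lemma monomial_factor:
  assumes "set gs \<subseteq> carrier R" "\<mu> \<in> exponents (length gs) (Suc n)"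
  shows "\<exists>\<nu>\<in>exponents (length gs) n. \<exists>g\<in>set gs. monomial R gs \<mu> = monomial R gs \<nu> \<otimes> g"
  by (rule monomial_factor_aux) (use assms in \<open>simp_all add: exponents_def\<close>)

lemma monomial_generator:
  assumes "set gs \<subseteq> carrier R" "g \<in> set gs"
  shows "\<exists>\<mu>\<in>exponents (length gs) 1. monomial R gs \<mu> = g"
  using assms
proof (induction gs)
  case (Cons h gs)
  have c: "h \<in> carrier R" "set gs \<subseteq> carrier R" using Cons.prems by auto
  have zero: "monomial R gs (replicate (length gs) 0) = \<one>" using c(2) by (induction gs) auto
  show ?case
  proof (cases "g = h")
    case True
    then show ?thesis
      using c zero by (intro bexI[of _ "1 # replicate (length gs) 0"])
        (auto simp: exponents_def sum_list_replicate)
  next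
    case False
    then obtain \<mu> where "\<mu> \<in> exponents (length gs) 1" "monomial R gs \<mu> = g"
      using Cons.IH[OF c(2)] Cons.prems by auto
    then show ?thesis
      using c monomial_closed[OF c(2)] by (intro bexI[of _ "0 # \<mu>"]) (auto simp: exponents_def)
  qed
qed simp

lemma monomial_degree_zero:
  assumes "\<mu> \<in> exponents (length gs) 0"
  shows "monomial R gs \<mu> = \<one>"
proof -
  have "monomial R gs \<mu> = \<one>" if "length gs = length \<mu>" "\<forall>e\<in>set \<mu>. e = 0" for gs
    using that by (induction gs \<mu> rule: list_induct2) (auto simp: l_one)
  then show ?thesis using assms by (auto simp: exponents_def)
qed

definition monomial_ideal :: "'a list \<Rightarrow> nat \<Rightarrow> 'a set" where
  "monomial_ideal gs n = Idl (monomial R gs ` exponents (length gs) n)"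

lemma monomial_ideal_ideal: "set gs \<subseteq> carrier R \<Longrightarrow> ideal (monomial_ideal gs n) R"
  unfolding monomial_ideal_def using monomial_closed by (intro genideal_ideal) auto

lemma monomial_mem: "set gs \<subseteq> carrier R \<Longrightarrow> \<mu> \<in> exponents (length gs) n \<Longrightarrow>
    monomial R gs \<mu> \<in> monomial_ideal gs n"
  unfolding monomial_ideal_def using monomial_closed
  by (intro subsetD[OF genideal_self]) auto

lemma Idl_subset_colon:
  assumes "A \<subseteq> carrier R" "ideal J R" "t \<in> carrier R" "\<And>a. a \<in> A \<Longrightarrow> a \<otimes> t \<in> J"
  shows "Idl A \<subseteq> colon R J t"
  using assms by (intro genideal_minimal colon_ideal) (auto simp: colon_def)

lemma monomial_ideal_Suc_subset:
  assumes gs: "set gs \<subseteq> carrier R"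
  shows "monomial_ideal gs (Suc n) \<subseteq> monomial_ideal gs n"
proof -
  have "monomial R gs \<mu> \<in> monomial_ideal gs n" if \<mu>: "\<mu> \<in> exponents (length gs) (Suc n)" for \<mu>
  proof -
    obtain \<nu> g where "\<nu> \<in> exponents (length gs) n" "g \<in> set gs"
      "monomial R gs \<mu> = monomial R gs \<nu> \<otimes> g"
      using monomial_factor[OF gs \<mu>] by blast
    then show ?thesis
      using ideal_mult_right[OF monomial_ideal_ideal[OF gs] monomial_mem[OF gs]] gs by auto
  qed
  then show ?thesis
    unfolding monomial_ideal_def[of gs "Suc n"]
    by (intro genideal_minimal monomial_ideal_ideal gs) auto
qed

lemma monomial_ideal_mult:
  assumes gs: "set gs \<subseteq> carrier R" and z: "z \<in> monomial_ideal gs n" and y: "y \<in> Idl (set gs)"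
  shows "z \<otimes> y \<in> monomial_ideal gs (Suc n)"
proof -
  let ?W = "monomial_ideal gs (Suc n)"
  note W = monomial_ideal_ideal[OF gs, of "Suc n"]
  have yc: "y \<in> carrier R" using ideal.Icarr[OF genideal_ideal[OF gs] y] .
  have gen: "monomial R gs \<mu> \<otimes> g \<in> ?W" if "\<mu> \<in> exponents (length gs) n" "g \<in> set gs" for \<mu> g
  proof -
    obtain \<nu> where \<nu>: "\<nu> \<in> exponents (length gs) 1" "monomial R gs \<nu> = g"
      using monomial_generator[OF gs \<open>g \<in> set gs\<close>] by blast
    then have "monomial R gs \<mu> \<otimes> g = monomial R gs (map2 (+) \<mu> \<nu>)"
      using monomial_add[of gs \<mu> \<nu>] that gs by (simp add: exponents_def)
    moreover have "map2 (+) \<mu> \<nu> \<in> exponents (length gs) (Suc n)"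
      using that \<nu> sum_list_map2_add[of \<mu> \<nu>] by (simp add: exponents_def)
    ultimately show ?thesis using monomial_mem[OF gs] by simp
  qed
  have "y \<otimes> monomial R gs \<mu> \<in> ?W" if \<mu>: "\<mu> \<in> exponents (length gs) n" for \<mu>
  proof -
    have mc: "monomial R gs \<mu> \<in> carrier R" by (rule monomial_closed[OF gs])
    have "g \<otimes> monomial R gs \<mu> \<in> ?W" if "g \<in> set gs" for g
      using gen[OF \<mu> that] mc gs that by (simp add: m_comm subset_iff)
    then have "Idl (set gs) \<subseteq> colon R ?W (monomial R gs \<mu>)"
      by (intro Idl_subset_colon gs W mc)
    then show ?thesis using y by (auto simp: colon_def)
  qed
  then have "monomial R gs \<mu> \<otimes> y \<in> ?W" if "\<mu> \<in> exponents (length gs) n" for \<mu>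
    using that monomial_closed[OF gs, of \<mu>] yc by (simp add: m_comm)
  then have "monomial_ideal gs n \<subseteq> colon R ?W y"
    unfolding monomial_ideal_def[of gs n] using monomial_closed[OF gs]
    by (intro Idl_subset_colon W yc) auto
  then show ?thesis using z by (auto simp: colon_def)
qed

lemma ideal_power_eq_monomial_ideal:
  assumes gs: "set gs \<subseteq> carrier R"
  shows "ideal_power R (Idl (set gs)) n = monomial_ideal gs n"
proof (induction n)
  case 0
  have "replicate (length gs) 0 \<in> exponents (length gs) 0"
    by (simp add: exponents_def sum_list_replicate)
  then have "\<one> \<in> monomial_ideal gs 0"
    using monomial_mem[OF gs] monomial_degree_zero by metis
  then have "monomial_ideal gs 0 = carrier R"
    by (rule ideal_eq_carrier[OF monomial_ideal_ideal[OF gs]])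
  then show ?case by (simp add: nat_pow_def ideals_set_def)
next
  case (Suc n)
  note I = genideal_ideal[OF gs]
  have "ideal_power R (Idl (set gs)) (Suc n) = ideal_prod R (monomial_ideal gs n) (Idl (set gs))"
    using Suc by (simp add: nat_pow_def ideals_set_def)
  also have "\<dots> = monomial_ideal gs (Suc n)"
  proof
    show "ideal_prod R (monomial_ideal gs n) (Idl (set gs)) \<subseteq> monomial_ideal gs (Suc n)"
    proof
      fix z assume "z \<in> ideal_prod R (monomial_ideal gs n) (Idl (set gs))"
      then show "z \<in> monomial_ideal gs (Suc n)"
        by (induction rule: ideal_prod.induct)
          (simp_all add: monomial_ideal_mult[OF gs] ideal_add[OF monomial_ideal_ideal[OF gs]])
    qed
    have "monomial R gs \<mu> \<in> ideal_prod R (monomial_ideal gs n) (Idl (set gs))"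
      if \<mu>: "\<mu> \<in> exponents (length gs) (Suc n)" for \<mu>
    proof -
      obtain \<nu> g where *: "\<nu> \<in> exponents (length gs) n" "g \<in> set gs"
        "monomial R gs \<mu> = monomial R gs \<nu> \<otimes> g"
        using monomial_factor[OF gs \<mu>] by blast
      show ?thesis
        using ideal_prod.prod[OF monomial_mem[OF gs *(1)], of g "Idl (set gs)" R]
          genideal_self[OF gs] *(2) unfolding *(3) by blast
    qed
    then show "monomial_ideal gs (Suc n) \<subseteq> ideal_prod R (monomial_ideal gs n) (Idl (set gs))"
      unfolding monomial_ideal_def[of gs "Suc n"]
      by (intro genideal_minimal ideal_prod_is_ideal monomial_ideal_ideal gs I) auto
  qed
  finally show ?case .
qed

text \<open>
  These generate \<open>I\<^sup>n\<^sup>+\<^sup>1\<close>, with \<open>n\<close> the degree of \<open>\<mu>\<close>, together with all monomials of degree \<open>n\<close> that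
  precede \<open>\<mu>\<close>. The colon ideal defined next consists of the possible leading coefficients at \<open>\<mu>\<close> of
  the relations between the monomials of degree \<open>n\<close> modulo \<open>I\<^sup>n\<^sup>+\<^sup>1\<close>.
\<close>

definition leading_generators :: "'a list \<Rightarrow> nat list \<Rightarrow> 'a set" where
  "leading_generators gs \<mu> = monomial R gs `
     (exponents (length gs) (Suc (sum_list \<mu>)) \<union> {\<nu> \<in> exponents (length gs) (sum_list \<mu>). \<nu> < \<mu>})"

definition leading_colon :: "'a list \<Rightarrow> nat list \<Rightarrow> 'a set" where
  "leading_colon gs \<mu> = colon R (Idl (leading_generators gs \<mu>)) (monomial R gs \<mu>)"

lemma leading_generators_carrier:
  "set gs \<subseteq> carrier R \<Longrightarrow> leading_generators gs \<mu> \<subseteq> carrier R"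
  using monomial_closed by (auto simp: leading_generators_def)

lemma leading_colon_ideal: "set gs \<subseteq> carrier R \<Longrightarrow> ideal (leading_colon gs \<mu>) R"
  unfolding leading_colon_def
  by (intro colon_ideal genideal_ideal leading_generators_carrier monomial_closed)

text \<open>
  Multiplying a relation with leading monomial \<open>\<mu>\<close> by the monomial \<open>\<delta>\<close> gives a relation with leading
  monomial \<open>\<mu> + \<delta>\<close> and the same leading coefficient.
\<close>

lemma leading_colon_mono:
  assumes gs: "set gs \<subseteq> carrier R" and len: "length \<mu> = length gs" "length \<delta> = length gs"
  shows "leading_colon gs \<mu> \<subseteq> leading_colon gs (map2 (+) \<mu> \<delta>)"
proof
  let ?F = "Idl (leading_generators gs (map2 (+) \<mu> \<delta>))"
  have F: "ideal ?F R" by (intro genideal_ideal leading_generators_carrier gs)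
  have dc: "monomial R gs \<delta> \<in> carrier R" "monomial R gs \<mu> \<in> carrier R"
    by (simp_all add: monomial_closed[OF gs])
  have "a \<otimes> monomial R gs \<delta> \<in> ?F" if a: "a \<in> leading_generators gs \<mu>" for a
  proof -
    obtain \<nu> where \<nu>: "a = monomial R gs \<nu>" "length \<nu> = length gs"
      "sum_list \<nu> = Suc (sum_list \<mu>) \<or> sum_list \<nu> = sum_list \<mu> \<and> \<nu> < \<mu>"
      using a unfolding leading_generators_def exponents_def by blast
    then have "map2 (+) \<nu> \<delta> \<in> exponents (length gs) (Suc (sum_list (map2 (+) \<mu> \<delta>))) \<union>
      {\<nu> \<in> exponents (length gs) (sum_list (map2 (+) \<mu> \<delta>)). \<nu> < map2 (+) \<mu> \<delta>}"
      using len map2_add_strict_mono[of \<nu> \<mu> \<delta>] by (auto simp: exponents_def sum_list_map2_add)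
    then have "monomial R gs (map2 (+) \<nu> \<delta>) \<in> leading_generators gs (map2 (+) \<mu> \<delta>)"
      unfolding leading_generators_def by (rule imageI)
    then have "monomial R gs (map2 (+) \<nu> \<delta>) \<in> ?F"
      using genideal_self[OF leading_generators_carrier[OF gs]] by blast
    then show ?thesis using monomial_add[of gs \<nu> \<delta>] \<nu> len gs by simp
  qed
  then have sub: "Idl (leading_generators gs \<mu>) \<subseteq> colon R ?F (monomial R gs \<delta>)"
    by (intro Idl_subset_colon leading_generators_carrier gs F dc)
  fix r assume "r \<in> leading_colon gs \<mu>"
  then have r: "r \<in> carrier R" "r \<otimes> monomial R gs \<mu> \<otimes> monomial R gs \<delta> \<in> ?F"
    using sub by (auto simp: leading_colon_def colon_def)
  then show "r \<in> leading_colon gs (map2 (+) \<mu> \<delta>)"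
    using monomial_add[of gs \<mu> \<delta>] len gs dc by (simp add: leading_colon_def colon_def m_assoc)
qed

lemma subset_leading_colon:
  assumes gs: "set gs \<subseteq> carrier R" and len: "length \<mu> = length gs"
  shows "Idl (set gs) \<subseteq> leading_colon gs \<mu>"
proof
  fix y assume y: "y \<in> Idl (set gs)"
  have yc: "y \<in> carrier R" using ideal.Icarr[OF genideal_ideal[OF gs] y] .
  have "monomial R gs \<mu> \<otimes> y \<in> monomial_ideal gs (Suc (sum_list \<mu>))"
    using monomial_ideal_mult[OF gs monomial_mem[OF gs] y] len by (simp add: exponents_def)
  also have "\<dots> \<subseteq> Idl (leading_generators gs \<mu>)"
    unfolding monomial_ideal_def
    by (intro subset_Idl_subset leading_generators_carrier gs) (auto simp: leading_generators_def)
  finally show "y \<in> leading_colon gs \<mu>"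
    using yc monomial_closed[OF gs, of \<mu>] by (simp add: leading_colon_def colon_def m_comm)
qed

text \<open>
  The monomials of degree \<open>n\<close> are adjoined to \<open>I\<^sup>n\<^sup>+\<^sup>1\<close> in increasing order. The induction runs over the
  initial segments \<open>Y\<close> of the set of these monomials, removing the largest element.
\<close>

lemma cyclic_filtration_power_step:
  assumes gs: "set gs \<subseteq> carrier R" and f: "f \<in> carrier R"
    and filt: "\<And>\<mu>. length \<mu> = length gs \<Longrightarrow> cyclic_filtration R P f (leading_colon gs \<mu>) (carrier R)"
  shows "cyclic_filtration R P f (monomial_ideal gs (Suc n)) (monomial_ideal gs n)"
proof -
  let ?E = "exponents (length gs)"
  let ?H = "\<lambda>Y. Idl (monomial R gs ` (?E (Suc n) \<union> Y))"
  have sub: "monomial R gs ` A \<subseteq> carrier R" for A using monomial_closed[OF gs] by auto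
  have "cyclic_filtration R P f (?H {}) (?H Y)"
    if "finite Y" "Y \<subseteq> ?E n" "\<And>\<mu> \<nu>. \<mu> \<in> Y \<Longrightarrow> \<nu> \<in> ?E n \<Longrightarrow> \<nu> < \<mu> \<Longrightarrow> \<nu> \<in> Y" for Y
    using that
  proof (induction Y rule: finite_psubset_induct)
    case (psubset Y)
    show ?case
    proof (cases "Y = {}")
      case True
      then show ?thesis using sub by (auto intro!: cyclic_filtration.refl genideal_ideal)
    next
      case False
      define \<mu> where "\<mu> = Max Y"
      have \<mu>: "\<mu> \<in> Y" "\<And>\<nu>. \<nu> \<in> Y \<Longrightarrow> \<nu> \<le> \<mu>"
        using Max_in[OF psubset.hyps(1) False] Max_ge[OF psubset.hyps(1)] by (simp_all add: \<mu>_def)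
      have \<mu>E: "length \<mu> = length gs" "sum_list \<mu> = n"
        using \<mu>(1) psubset.prems(1) by (auto simp: exponents_def)
      \<comment> \<open>An initial segment without its largest element \<open>\<mu>\<close> consists of all exponents below \<open>\<mu>\<close>.\<close>
      have Y': "Y - {\<mu>} = {\<nu> \<in> ?E n. \<nu> < \<mu>}"
        using \<mu> psubset.prems by (auto simp: order_less_le)
      have "cyclic_filtration R P f (?H {}) (?H (Y - {\<mu>}))"
        using \<mu>(1) psubset.prems by (intro psubset.IH) (auto simp: Y' intro: less_trans)
      moreover have "?H (Y - {\<mu>}) = Idl (leading_generators gs \<mu>)"
        using \<mu>E by (simp add: Y' leading_generators_def)
      moreover have "cyclic_filtration R P f (Idl (leading_generators gs \<mu>))
        (Idl (insert (monomial R gs \<mu>) (Idl (leading_generators gs \<mu>))))"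
        using filt[OF \<mu>E(1)] unfolding leading_colon_def
        by (intro cyclic_filtration_adjoin genideal_ideal leading_generators_carrier gs f monomial_closed)
      moreover have "Idl (insert (monomial R gs \<mu>) (Idl (leading_generators gs \<mu>))) = ?H Y"
      proof -
        have "?H Y = Idl (insert (monomial R gs \<mu>) (leading_generators gs \<mu>))"
          using \<mu>E \<mu>(1) Y' unfolding leading_generators_def
          by (intro arg_cong[of _ _ "genideal R"]) auto
        then show ?thesis
          using Idl_Un_ideal[of "{monomial R gs \<mu>}" "leading_generators gs \<mu>"]
            leading_generators_carrier[OF gs] monomial_closed[OF gs] by simp
      qed
      ultimately show ?thesis using cyclic_filtration_trans by metis
    qed
  qed
  from this[of "?E n"] have "cyclic_filtration R P f (?H {}) (?H (?E n))"
    using finite_exponents by (simp add: exponents_def)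
  moreover have "?H (?E n) = monomial_ideal gs n"
  proof
    have "monomial R gs ` ?E (Suc n) \<subseteq> monomial_ideal gs n"
      using monomial_mem[OF gs] monomial_ideal_Suc_subset[OF gs] by blast
    moreover have "monomial R gs ` ?E n \<subseteq> monomial_ideal gs n"
      using monomial_mem[OF gs] by blast
    ultimately show "?H (?E n) \<subseteq> monomial_ideal gs n"
      by (intro genideal_minimal monomial_ideal_ideal gs) auto
    show "monomial_ideal gs n \<subseteq> ?H (?E n)"
      unfolding monomial_ideal_def by (intro subset_Idl_subset sub) auto
  qed
  ultimately show ?thesis by (simp add: monomial_ideal_def)
qed

end

context noeth_cring begin

text \<open>
  Infinitely many values would contain an infinite sequence of distinct ones, and by Dickson's lemma a
  strictly ascending chain of ideals.
\<close>

lemma monotone_ideal_map_finite: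
  assumes ideals: "\<And>\<mu>. length \<mu> = m \<Longrightarrow> ideal (c \<mu>) R"
    and mono: "\<And>\<mu> \<delta>. length \<mu> = m \<Longrightarrow> length \<delta> = m \<Longrightarrow> c \<mu> \<subseteq> c (map2 (+) \<mu> \<delta> :: nat list)"
  shows "finite (c ` {\<mu>. length \<mu> = m})"
proof (rule ccontr)
  assume "infinite (c ` {\<mu>. length \<mu> = m})"
  then obtain b :: "nat \<Rightarrow> 'a set" where b: "inj b" "range b \<subseteq> c ` {\<mu>. length \<mu> = m}"
    unfolding infinite_iff_countable_subset by (elim exE conjE)
  have "\<forall>n. \<exists>\<mu>. length \<mu> = m \<and> b n = c \<mu>"
  proof
    fix n
    have "b n \<in> c ` {\<mu>. length \<mu> = m}" using b(2) by blast
    then show "\<exists>\<mu>. length \<mu> = m \<and> b n = c \<mu>" by auto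
  qed
  then obtain a where a: "\<And>n. length (a n) = m" "\<And>n. b n = c (a n)" by metis
  obtain \<phi> :: "nat \<Rightarrow> nat" where \<phi>: "strict_mono \<phi>" "\<And>i j. i \<le> j \<Longrightarrow> list_all2 (\<le>) (a (\<phi> i)) (a (\<phi> j))"
    using dickson[of a m, OF a(1)] by auto
  have asc: "b (\<phi> i) \<subseteq> b (\<phi> (Suc i))" for i
  proof -
    obtain \<delta> where "length \<delta> = m" "a (\<phi> (Suc i)) = map2 (+) (a (\<phi> i)) \<delta>"
      using list_all2_le_imp_add[OF \<phi>(2)[of i "Suc i"]] a(1) by auto
    then show ?thesis using mono[of "a (\<phi> i)" \<delta>] a by simp
  qed
  have "ideal (b (\<phi> i)) R" for i using ideals a by simp
  from ascending_ideals_stationary[of "\<lambda>i. b (\<phi> i)", OF this asc]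
  obtain N where N: "\<forall>n\<ge>N. b (\<phi> n) = b (\<phi> N)" ..
  have "b (\<phi> (Suc N)) = b (\<phi> N)" by (rule N[rule_format]) simp
  then have "\<phi> (Suc N) = \<phi> N" using b(1) by (simp add: inj_eq)
  then show False using \<phi>(1) by (simp add: strict_mono_eq)
qed

lemma generic_cyclic_filtration_powers:
  assumes P: "P \<in> minimal_primes R I" and I: "ideal I R"
  shows "\<exists>f\<in>carrier R - P. \<forall>n. cyclic_filtration R P f (ideal_power R I n) (carrier R)"
proof -
  obtain A where A: "A \<subseteq> carrier R" "finite A" "I = Idl A" using finetely_gen[OF I] by blast
  then obtain gs where gs: "set gs = A" using finite_list by blast
  have gsc: "set gs \<subseteq> carrier R" using gs A by simp
  let ?X = "leading_colon gs ` {\<mu>. length \<mu> = length gs}"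
  have "finite ?X"
    by (rule monotone_ideal_map_finite) (simp_all add: leading_colon_ideal[OF gsc] leading_colon_mono[OF gsc])
  moreover have "ideal c R \<and> I \<subseteq> c" if "c \<in> ?X" for c
    using that leading_colon_ideal[OF gsc] subset_leading_colon[OF gsc] gs A by auto
  ultimately obtain f where f: "f \<in> carrier R - P"
    and filt: "\<And>c. c \<in> ?X \<Longrightarrow> cyclic_filtration R P f c (carrier R)"
    using generic_cyclic_filtration_finite[OF P, of ?X] by auto
  have fc: "f \<in> carrier R" using f by simp
  have "cyclic_filtration R P f (monomial_ideal gs n) (carrier R)" for n
  proof (induction n)
    case 0
    have "monomial_ideal gs 0 = carrier R"
      using ideal_power_eq_monomial_ideal[OF gsc, of 0] by (simp add: nat_pow_def ideals_set_def)
    then show ?case by (simp add: cyclic_filtration.refl oneideal)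
  next
    case (Suc n)
    have "cyclic_filtration R P f (monomial_ideal gs (Suc n)) (monomial_ideal gs n)"
      by (rule cyclic_filtration_power_step[OF gsc fc]) (use filt in auto)
    then show ?case using Suc by (rule cyclic_filtration_trans)
  qed
  then show ?thesis using f ideal_power_eq_monomial_ideal[OF gsc] gs A by auto
qed

end

section \<open>Rings of fractions of quotients\<close>

text \<open>
  Up to isomorphism \<open>T\<close> is the ring of fractions of \<open>R/J\<close> with denominators in \<open>S\<close>, with \<open>h\<close> the
  canonical map. The axioms say that denominators become invertible, that every element is a
  fraction, and that \<open>h\<close> has the correct kernel. Both ideal quotients and localizations are of this kind, and so
  are their iterations. The equation \<open>h s \<otimes> t = h a\<close> stands for \<open>t = a/s\<close>.
\<close>

locale fraction_hom = ring_hom_cring R T h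
  for R (structure) and T (structure) and h +
  fixes S J
  assumes submonoid: "submonoid S R"
    and kernel_ideal: "ideal J R"
    and unit: "s \<in> S \<Longrightarrow> \<exists>u\<in>carrier T. u \<otimes>\<^bsub>T\<^esub> h s = \<one>\<^bsub>T\<^esub>"
    and fraction: "t \<in> carrier T \<Longrightarrow> \<exists>s\<in>S. \<exists>a\<in>carrier R. h s \<otimes>\<^bsub>T\<^esub> t = h a"
    and hom_eq_zero: "a \<in> carrier R \<Longrightarrow> h a = \<zero>\<^bsub>T\<^esub> \<longleftrightarrow> a \<in> sat R S J"
begin

definition contraction :: "_ set \<Rightarrow> _ set" where
  "contraction K = {a \<in> carrier R. h a \<in> K}"

definition extension :: "_ set \<Rightarrow> _ set" where
  "extension B = {t \<in> carrier T. \<exists>s\<in>S. \<exists>b\<in>B. h s \<otimes>\<^bsub>T\<^esub> t = h b}"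

lemma denominator_carrier: "s \<in> S \<Longrightarrow> s \<in> carrier R"
  by (rule R.submonoid_carrier[OF submonoid])

lemma cancel_mem:
  assumes K: "ideal K T" and s: "s \<in> S" and t: "t \<in> carrier T" and st: "h s \<otimes>\<^bsub>T\<^esub> t \<in> K"
  shows "t \<in> K"
proof -
  obtain u where u: "u \<in> carrier T" "u \<otimes>\<^bsub>T\<^esub> h s = \<one>\<^bsub>T\<^esub>" using unit[OF s] by blast
  have "u \<otimes>\<^bsub>T\<^esub> (h s \<otimes>\<^bsub>T\<^esub> t) = t"
    using u t denominator_carrier[OF s] by (simp add: S.m_assoc[symmetric])
  then show ?thesis using ideal.I_l_closed[OF K st u(1)] by simp
qed

lemma contraction_ideal: "ideal K T \<Longrightarrow> ideal (contraction K) R"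
  unfolding contraction_def by (rule ring.ideal_vimage)

lemma kernel_subset_contraction:
  assumes K: "ideal K T" shows "sat R S J \<subseteq> contraction K"
proof
  fix a assume a: "a \<in> sat R S J"
  then have ac: "a \<in> carrier R" by (simp add: sat_def)
  then have "h a = \<zero>\<^bsub>T\<^esub>" using hom_eq_zero a by simp
  then show "a \<in> contraction K" using ac S.ideal_zero[OF K] by (simp add: contraction_def)
qed

lemma contraction_sat:
  assumes K: "ideal K T" shows "sat R S (contraction K) = contraction K"
proof
  show "contraction K \<subseteq> sat R S (contraction K)"
    by (rule R.sat_upper[OF submonoid contraction_ideal[OF K]])
  show "sat R S (contraction K) \<subseteq> contraction K"
  proof
    fix a assume "a \<in> sat R S (contraction K)"
    then obtain s where s: "a \<in> carrier R" "s \<in> S" "h (s \<otimes> a) \<in> K"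
      by (auto simp: sat_def contraction_def)
    then have "h s \<otimes>\<^bsub>T\<^esub> h a \<in> K" using denominator_carrier by simp
    then show "a \<in> contraction K" using cancel_mem[OF K s(2)] s(1) by (simp add: contraction_def)
  qed
qed

lemma mem_iff_numerator:
  assumes K: "ideal K T" and t: "t \<in> carrier T" and s: "s \<in> S" and a: "a \<in> carrier R"
    and eq: "h s \<otimes>\<^bsub>T\<^esub> t = h a"
  shows "t \<in> K \<longleftrightarrow> a \<in> contraction K"
proof
  assume "t \<in> K"
  then have "h s \<otimes>\<^bsub>T\<^esub> t \<in> K" using ideal.I_l_closed[OF K] denominator_carrier[OF s] by simp
  then show "a \<in> contraction K" using eq a by (simp add: contraction_def)
next
  assume "a \<in> contraction K"
  then show "t \<in> K" using cancel_mem[OF K s t] eq by (simp add: contraction_def)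
qed

lemma contraction_subset_iff:
  assumes K: "ideal K T" and L: "ideal L T"
  shows "contraction K \<subseteq> contraction L \<longleftrightarrow> K \<subseteq> L"
proof
  assume sub: "contraction K \<subseteq> contraction L"
  show "K \<subseteq> L"
  proof
    fix t assume t: "t \<in> K"
    have tc: "t \<in> carrier T" using ideal.Icarr[OF K t] .
    obtain s a where sa: "s \<in> S" "a \<in> carrier R" "h s \<otimes>\<^bsub>T\<^esub> t = h a"
      using fraction[OF tc] by blast
    show "t \<in> L"
      using t sub mem_iff_numerator[OF K tc sa] mem_iff_numerator[OF L tc sa] by blast
  qed
qed (auto simp: contraction_def)

lemma contraction_psubset:
  assumes "ideal K T" "ideal L T" "K \<subset> L"
  shows "contraction K \<subset> contraction L"
  using assms contraction_subset_iff[OF assms(1,2)] contraction_subset_iff[OF assms(2,1)] by blast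

lemma contraction_prime:
  assumes N: "primeideal N T"
  shows "primeideal (contraction N) R" and "contraction N \<inter> S = {}"
proof -
  note Ni = primeideal.axioms(1)[OF N]
  have 1: "\<one>\<^bsub>T\<^esub> \<notin> N" by (rule S.prime_one[OF N])
  show "primeideal (contraction N) R"
  proof (rule primeidealI[OF contraction_ideal[OF Ni] R.is_cring])
    have "\<one> \<notin> contraction N" using 1 by (simp add: contraction_def)
    then show "carrier R \<noteq> contraction N" by auto
    fix a b assume "a \<in> carrier R" "b \<in> carrier R" "a \<otimes> b \<in> contraction N"
    then show "a \<in> contraction N \<or> b \<in> contraction N"
      using S.prime_mem[OF N, of "h a" "h b"] by (simp add: contraction_def)
  qed
  show "contraction N \<inter> S = {}"
  proof (rule ccontr)
    assume "contraction N \<inter> S \<noteq> {}"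
    then obtain s where s: "s \<in> S" "h s \<in> N" by (auto simp: contraction_def)
    have "h s \<otimes>\<^bsub>T\<^esub> \<one>\<^bsub>T\<^esub> \<in> N" using s denominator_carrier by simp
    then show False using cancel_mem[OF Ni s(1) S.one_closed] 1 by blast
  qed
qed

lemma extension_ideal:
  assumes B: "ideal B R" shows "ideal (extension B) T"
proof (rule S.idealI')
  note c = denominator_carrier ideal.Icarr[OF B]
  show "extension B \<subseteq> carrier T" by (auto simp: extension_def)
  have "h \<one> \<otimes>\<^bsub>T\<^esub> \<zero>\<^bsub>T\<^esub> = h \<zero>" by simp
  then show "\<zero>\<^bsub>T\<^esub> \<in> extension B"
    using R.ideal_zero[OF B] submonoid.one_closed[OF submonoid] unfolding extension_def by blast
  fix y z assume "y \<in> extension B" "z \<in> extension B"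
  then obtain s a t b where *: "y \<in> carrier T" "z \<in> carrier T" "s \<in> S" "a \<in> B" "t \<in> S" "b \<in> B"
    "h s \<otimes>\<^bsub>T\<^esub> y = h a" "h t \<otimes>\<^bsub>T\<^esub> z = h b" by (auto simp: extension_def)
  have "h (s \<otimes> t) \<otimes>\<^bsub>T\<^esub> (y \<oplus>\<^bsub>T\<^esub> z) = h t \<otimes>\<^bsub>T\<^esub> (h s \<otimes>\<^bsub>T\<^esub> y) \<oplus>\<^bsub>T\<^esub> h s \<otimes>\<^bsub>T\<^esub> (h t \<otimes>\<^bsub>T\<^esub> z)"
    using *(1-6) c by (simp add: S.r_distr S.m_ac)
  also have "\<dots> = h (t \<otimes> a \<oplus> s \<otimes> b)" unfolding *(7,8) using *(3-6) c by simp
  finally show "y \<oplus>\<^bsub>T\<^esub> z \<in> extension B"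
    using *(1-6) c submonoid.m_closed[OF submonoid *(3,5)] unfolding extension_def
    by (intro CollectI conjI bexI[of _ "s \<otimes> t"] bexI[of _ "t \<otimes> a \<oplus> s \<otimes> b"])
      (simp_all add: R.ideal_closed[OF B])
next
  note c = denominator_carrier ideal.Icarr[OF B]
  fix r z assume r: "r \<in> carrier T" and "z \<in> extension B"
  then obtain t b where *: "z \<in> carrier T" "t \<in> S" "b \<in> B" "h t \<otimes>\<^bsub>T\<^esub> z = h b"
    by (auto simp: extension_def)
  obtain s a where sa: "s \<in> S" "a \<in> carrier R" "h s \<otimes>\<^bsub>T\<^esub> r = h a" using fraction[OF r] by blast
  have "h (s \<otimes> t) \<otimes>\<^bsub>T\<^esub> (r \<otimes>\<^bsub>T\<^esub> z) = (h s \<otimes>\<^bsub>T\<^esub> r) \<otimes>\<^bsub>T\<^esub> (h t \<otimes>\<^bsub>T\<^esub> z)"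
    using *(1-3) sa(1,2) r c by (simp add: S.m_ac)
  also have "\<dots> = h (a \<otimes> b)" unfolding *(4) sa(3) using *(3) sa c by simp
  finally show "r \<otimes>\<^bsub>T\<^esub> z \<in> extension B"
    using *(1-3) sa r c submonoid.m_closed[OF submonoid sa(1) *(2)] unfolding extension_def
    by (intro CollectI conjI bexI[of _ "s \<otimes> t"] bexI[of _ "a \<otimes> b"])
      (simp_all add: R.ideal_closed[OF B])
qed

lemma contraction_extension:
  assumes B: "ideal B R" and JB: "J \<subseteq> sat R S B"
  shows "contraction (extension B) = sat R S B"
proof (intro equalityI subsetI)
  note c = denominator_carrier ideal.Icarr[OF B]
  note sB = R.sat_ideal[OF submonoid B]
  have JB': "sat R S J \<subseteq> sat R S B"
    using R.sat_mono[OF JB, of S] R.sat_idem[OF submonoid B] by simp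
  fix r
  {
    assume "r \<in> contraction (extension B)"
    then obtain s b where *: "r \<in> carrier R" "s \<in> S" "b \<in> B" "h s \<otimes>\<^bsub>T\<^esub> h r = h b"
      by (auto simp: contraction_def extension_def)
    have "h (s \<otimes> r \<ominus> b) = h s \<otimes>\<^bsub>T\<^esub> h r \<ominus>\<^bsub>T\<^esub> h b"
      using *(1-3) c by (simp add: a_minus_def)
    also have "\<dots> = \<zero>\<^bsub>T\<^esub>" unfolding *(4) using *(3) c by (simp add: S.r_neg a_minus_def)
    finally have "s \<otimes> r \<ominus> b \<in> sat R S J" using hom_eq_zero[of "s \<otimes> r \<ominus> b"] * c by simp
    then have 1: "s \<otimes> r \<ominus> b \<in> sat R S B" using JB' by blast
    have 2: "b \<in> sat R S B" using R.sat_upper[OF submonoid B] * by blast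
    have "s \<otimes> r \<in> sat R S B" using * c by (intro R.ideal_diffD[OF sB _ 2 1]) auto
    then show "r \<in> sat R S B" by (rule R.sat_cancel[OF submonoid B *(1,2)])
  next
    assume "r \<in> sat R S B"
    then obtain s where s: "r \<in> carrier R" "s \<in> S" "s \<otimes> r \<in> B" by (auto simp: sat_def)
    then have "h s \<otimes>\<^bsub>T\<^esub> h r = h (s \<otimes> r)" using c by simp
    then show "r \<in> contraction (extension B)"
      using s unfolding contraction_def extension_def by auto
  }
qed

lemma extension_prime:
  assumes B: "primeideal B R" and JB: "J \<subseteq> B" and disj: "B \<inter> S = {}"
  shows "primeideal (extension B) T" and "contraction (extension B) = B"
proof -
  note Bi = R.prime_ideal[OF B]
  have sB: "sat R S B = B" using R.sat_prime[OF B submonoid] disj by blast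
  show cB: "contraction (extension B) = B"
    using contraction_extension[OF Bi] JB sB by simp
  note E = extension_ideal[OF Bi]
  show "primeideal (extension B) T"
  proof (rule primeidealI[OF E S.is_cring])
    have "\<one>\<^bsub>T\<^esub> \<notin> extension B"
    proof
      assume "\<one>\<^bsub>T\<^esub> \<in> extension B"
      then have "\<one> \<in> contraction (extension B)" by (simp add: contraction_def)
      then show False using cB R.prime_one[OF B] by simp
    qed
    then show "carrier T \<noteq> extension B" by auto
    fix y z assume yz: "y \<in> carrier T" "z \<in> carrier T" "y \<otimes>\<^bsub>T\<^esub> z \<in> extension B"
    obtain s a where sa: "s \<in> S" "a \<in> carrier R" "h s \<otimes>\<^bsub>T\<^esub> y = h a" using fraction[OF yz(1)] by blast
    obtain t b where tb: "t \<in> S" "b \<in> carrier R" "h t \<otimes>\<^bsub>T\<^esub> z = h b" using fraction[OF yz(2)] by blast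
    have "h (s \<otimes> t) \<otimes>\<^bsub>T\<^esub> (y \<otimes>\<^bsub>T\<^esub> z) = (h s \<otimes>\<^bsub>T\<^esub> y) \<otimes>\<^bsub>T\<^esub> (h t \<otimes>\<^bsub>T\<^esub> z)"
      using sa(1) tb(1) yz denominator_carrier by (simp add: S.m_ac)
    also have "\<dots> = h (a \<otimes> b)" unfolding sa(3) tb(3) using sa tb by simp
    finally have "a \<otimes> b \<in> B"
      using mem_iff_numerator[OF E, of "y \<otimes>\<^bsub>T\<^esub> z" "s \<otimes> t" "a \<otimes> b"] sa tb yz cB
        submonoid.m_closed[OF submonoid sa(1) tb(1)] by simp
    then have "a \<in> B \<or> b \<in> B" using R.prime_mem[OF B] sa tb by blast
    then show "y \<in> extension B \<or> z \<in> extension B"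
      using mem_iff_numerator[OF E yz(1) sa] mem_iff_numerator[OF E yz(2) tb] cB by simp
  qed
qed

lemma contraction_chain:
  assumes "prime_chain T C n"
  shows "prime_chain R (\<lambda>i. contraction (C i)) n" and "J \<subseteq> contraction (C 0)"
    and "contraction (C n) \<inter> S = {}"
proof -
  have C: "primeideal (C i) T" if "i \<le> n" for i using assms that by (simp add: prime_chain_def)
  have "C i \<subset> C (Suc i)" if "i < n" for i using assms that by (simp add: prime_chain_def)
  then show "prime_chain R (\<lambda>i. contraction (C i)) n"
    using C unfolding prime_chain_def
    by (simp add: contraction_prime(1) contraction_psubset primeideal.axioms(1))
  show "J \<subseteq> contraction (C 0)"
    using kernel_subset_contraction[OF primeideal.axioms(1)[OF C[of 0]]]
      R.sat_upper[OF submonoid kernel_ideal] by simp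
  show "contraction (C n) \<inter> S = {}" by (rule contraction_prime(2)[OF C]) simp
qed

lemma extension_chain:
  assumes C: "prime_chain R C n" and JC: "J \<subseteq> C 0" and disj: "C n \<inter> S = {}"
  shows "prime_chain T (\<lambda>i. extension (C i)) n"
proof -
  have Ci: "primeideal (C i) R" "J \<subseteq> C i" "C i \<inter> S = {}" if "i \<le> n" for i
    using prime_chain_prime[OF C that] prime_chain_mono[OF C, of 0 i] prime_chain_mono[OF C that]
      that JC disj by auto
  note E = extension_prime[OF Ci]
  have "extension (C i) \<subset> extension (C (Suc i))" if "i < n" for i
  proof -
    have i: "i \<le> n" "Suc i \<le> n" using that by simp_all
    note ideals = primeideal.axioms(1)[OF E(1)[OF i(1) i(1) i(1)]]
      primeideal.axioms(1)[OF E(1)[OF i(2) i(2) i(2)]]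
    have "C i \<subset> C (Suc i)" using C that by (simp add: prime_chain_def)
    then show ?thesis
      using contraction_subset_iff[OF ideals] contraction_subset_iff[OF ideals(2,1)]
      unfolding E(2)[OF i(1) i(1) i(1)] E(2)[OF i(2) i(2) i(2)] by blast
  qed
  then show ?thesis using E(1) by (simp add: prime_chain_def)
qed

lemma noetherian:
  assumes R: "noeth_cring R" shows "noeth_cring T"
proof -
  interpret N: noeth_cring R by (rule R)
  have "noetherian_ring T"
  proof (rule S.noetherian_ringI)
    fix K assume K: "ideal K T"
    obtain A where A: "A \<subseteq> carrier R" "finite A" "contraction K = Idl A"
      using N.finetely_gen[OF contraction_ideal[OF K]] by blast
    have hA: "h ` A \<subseteq> carrier T" using A by auto
    note L = S.genideal_ideal[OF hA]
    have "A \<subseteq> contraction K" using A R.genideal_self by blast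
    then have "Idl\<^bsub>T\<^esub> (h ` A) \<subseteq> K"
      by (intro S.genideal_minimal K) (auto simp: contraction_def)
    moreover have "A \<subseteq> contraction (Idl\<^bsub>T\<^esub> (h ` A))"
      using S.genideal_self[OF hA] A by (auto simp: contraction_def)
    then have "contraction K \<subseteq> contraction (Idl\<^bsub>T\<^esub> (h ` A))"
      unfolding A(3) by (intro R.genideal_minimal contraction_ideal L)
    then have "K \<subseteq> Idl\<^bsub>T\<^esub> (h ` A)" using contraction_subset_iff[OF K L] by blast
    ultimately show "\<exists>A\<subseteq>carrier T. finite A \<and> K = Idl\<^bsub>T\<^esub> A"
      using hA A(2) by (intro exI[of _ "h ` A"]) auto
  qed
  then show ?thesis by (simp add: noeth_cring_def S.is_cring)
qed

text \<open>
  Adjoining a fraction to an ideal of \<open>T\<close> corresponds to adjoining its numerator in \<open>R\<close>. This is the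
  step by which regular sequences are moved between \<open>T\<close> and \<open>R\<close>.
\<close>

lemma contraction_adjoin:
  assumes B: "ideal B R" and K: "ideal K T" and KB: "contraction K = sat R S B"
    and t: "t \<in> carrier T" and s: "s \<in> S" and a: "a \<in> carrier R" and st: "h s \<otimes>\<^bsub>T\<^esub> t = h a"
  shows "contraction (Idl\<^bsub>T\<^esub> (insert t K)) = sat R S (Idl (insert a B))"
proof (intro equalityI subsetI)
  let ?K = "Idl\<^bsub>T\<^esub> (insert t K)" and ?B = "Idl (insert a B)"
  have K': "ideal ?K T" "insert t K \<subseteq> ?K"
    using S.adjoin_ideal[OF K t] S.adjoin_upper[OF K t] by simp_all
  have B': "ideal ?B R" "insert a B \<subseteq> ?B"
    using R.adjoin_ideal[OF B a] R.adjoin_upper[OF B a] by simp_all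
  note sB' = R.sat_ideal[OF submonoid B'(1)]
  note c = denominator_carrier
  have BB: "sat R S B \<subseteq> sat R S ?B" using R.sat_mono[of B ?B S] B' by blast
  have J: "sat R S J \<subseteq> sat R S ?B" using kernel_subset_contraction[OF K] KB BB by simp
  fix r
  {
    assume "r \<in> contraction ?K"
    then obtain k z where *: "r \<in> carrier R" "k \<in> K" "z \<in> carrier T" "h r = k \<oplus>\<^bsub>T\<^esub> z \<otimes>\<^bsub>T\<^esub> t"
      unfolding contraction_def S.mem_adjoin[OF K t] by blast
    have kc: "k \<in> carrier T" using ideal.Icarr[OF K *(2)] .
    obtain s1 b where 1: "s1 \<in> S" "b \<in> carrier R" "h s1 \<otimes>\<^bsub>T\<^esub> k = h b" using fraction[OF kc] by blast
    obtain s2 d where 2: "s2 \<in> S" "d \<in> carrier R" "h s2 \<otimes>\<^bsub>T\<^esub> z = h d" using fraction[OF *(3)] by blast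
    have b: "b \<in> sat R S ?B"
      using mem_iff_numerator[OF K kc 1] *(2) KB BB by blast
    \<comment> \<open>Clearing denominators in \<open>h r = k + z t\<close> turns the right hand side into \<open>h ?w\<close>.\<close>
    let ?w = "s2 \<otimes> s \<otimes> b \<oplus> s1 \<otimes> d \<otimes> a"
    have c': "s \<in> carrier R" "s1 \<in> carrier R" "s2 \<in> carrier R" using s 1 2 c by auto
    have "h ((s1 \<otimes> s2 \<otimes> s) \<otimes> r)
      = h s2 \<otimes>\<^bsub>T\<^esub> h s \<otimes>\<^bsub>T\<^esub> (h s1 \<otimes>\<^bsub>T\<^esub> k) \<oplus>\<^bsub>T\<^esub> h s1 \<otimes>\<^bsub>T\<^esub> (h s2 \<otimes>\<^bsub>T\<^esub> z) \<otimes>\<^bsub>T\<^esub> (h s \<otimes>\<^bsub>T\<^esub> t)"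
      using * c' kc t by (simp add: S.r_distr S.m_ac)
    also have "\<dots> = h ?w" unfolding 1(3) 2(3) st using c' 1 2 a by simp
    finally have eq: "h ((s1 \<otimes> s2 \<otimes> s) \<otimes> r) = h ?w" .
    have wc: "?w \<in> carrier R" using c' 1 2 a by simp
    have "h ((s1 \<otimes> s2 \<otimes> s) \<otimes> r \<ominus> ?w) = h ((s1 \<otimes> s2 \<otimes> s) \<otimes> r) \<ominus>\<^bsub>T\<^esub> h ?w"
      using * c' wc by (simp only: a_minus_def hom_add hom_a_inv R.m_closed R.a_inv_closed)
    also have "\<dots> = \<zero>\<^bsub>T\<^esub>" unfolding eq using hom_closed[OF wc] by (simp add: S.r_neg a_minus_def)
    finally have "(s1 \<otimes> s2 \<otimes> s) \<otimes> r \<ominus> ?w \<in> sat R S J"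
      using hom_eq_zero[of "(s1 \<otimes> s2 \<otimes> s) \<otimes> r \<ominus> ?w"] * c' wc by simp
    then have d1: "(s1 \<otimes> s2 \<otimes> s) \<otimes> r \<ominus> ?w \<in> sat R S ?B" using J by blast
    have "a \<in> sat R S ?B" using R.sat_upper[OF submonoid B'(1)] B'(2) by blast
    then have d2: "?w \<in> sat R S ?B" using b c' 1 2 by (simp add: R.ideal_closed[OF sB'])
    have "(s1 \<otimes> s2 \<otimes> s) \<otimes> r \<in> sat R S ?B"
      using * c' by (intro R.ideal_diffD[OF sB' _ d2 d1]) simp
    moreover have "s1 \<otimes> s2 \<otimes> s \<in> S" using s 1 2 submonoid.m_closed[OF submonoid] by simp
    ultimately show "r \<in> sat R S ?B" using R.sat_cancel[OF submonoid B'(1) *(1)] by blast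
  next
    have "B \<subseteq> contraction ?K"
      using R.sat_upper[OF submonoid B] KB K'(2) by (auto simp: contraction_def)
    moreover have "a \<in> contraction ?K"
      using mem_iff_numerator[OF K'(1) t s a st] K'(2) by blast
    ultimately have "?B \<subseteq> contraction ?K"
      by (intro R.genideal_minimal contraction_ideal K'(1)) simp
    then have "sat R S ?B \<subseteq> contraction ?K"
      using R.sat_mono[of ?B "contraction ?K" S] contraction_sat[OF K'(1)] by simp
    moreover assume "r \<in> sat R S ?B"
    ultimately show "r \<in> contraction ?K" by blast
  }
qed

text \<open>
  Numerators differ from the fractions by units, so they form a weakly regular sequence
  at the same time.
\<close>

lemma loc_regular_transfer:
  assumes "list_all2 (\<lambda>t a. t \<in> carrier T \<and> a \<in> carrier R \<and> (\<exists>s\<in>S. h s \<otimes>\<^bsub>T\<^esub> t = h a)) ts as"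
    and "ideal B R" "ideal K T" "contraction K = sat R S B"
  shows "loc_regular T {\<one>\<^bsub>T\<^esub>} ts K \<longleftrightarrow> loc_regular R S as B"
  using assms
proof (induction arbitrary: B K rule: list_all2_induct)
  case (Cons t ts a as)
  note B = Cons.prems(1) and K = Cons.prems(2) and KB = Cons.prems(3)
  obtain s where t: "t \<in> carrier T" and a: "a \<in> carrier R" and s: "s \<in> S" and st: "h s \<otimes>\<^bsub>T\<^esub> t = h a"
    using Cons.hyps(1) by blast
  have tail: "loc_regular T {\<one>\<^bsub>T\<^esub>} ts (Idl\<^bsub>T\<^esub> (insert t K)) \<longleftrightarrow> loc_regular R S as (Idl (insert a B))"
    by (rule Cons.IH[OF R.adjoin_ideal[OF B a] S.adjoin_ideal[OF K t]
          contraction_adjoin[OF B K KB t s a st]])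
  have mem: "r \<in> sat R S B \<longleftrightarrow> h r \<in> K" if "r \<in> carrier R" for r
    unfolding KB[symmetric] using that by (simp add: contraction_def)
  have "(\<forall>y\<in>carrier T. t \<otimes>\<^bsub>T\<^esub> y \<in> K \<longrightarrow> y \<in> K) \<longleftrightarrow>
    (\<forall>r\<in>carrier R. a \<otimes> r \<in> sat R S B \<longrightarrow> r \<in> sat R S B)"
  proof (intro iffI ballI impI)
    fix r assume reg: "\<forall>y\<in>carrier T. t \<otimes>\<^bsub>T\<^esub> y \<in> K \<longrightarrow> y \<in> K"
      and r: "r \<in> carrier R" "a \<otimes> r \<in> sat R S B"
    have "h s \<otimes>\<^bsub>T\<^esub> (t \<otimes>\<^bsub>T\<^esub> h r) = h (a \<otimes> r)"
      using r a t st denominator_carrier[OF s] by (simp add: S.m_assoc[symmetric])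
    also have "\<dots> \<in> K" using mem[of "a \<otimes> r"] r a by simp
    finally have "t \<otimes>\<^bsub>T\<^esub> h r \<in> K" using t r by (intro cancel_mem[OF K s, of "t \<otimes>\<^bsub>T\<^esub> h r"]) simp_all
    then show "r \<in> sat R S B" using reg r mem by simp
  next
    fix y assume reg: "\<forall>r\<in>carrier R. a \<otimes> r \<in> sat R S B \<longrightarrow> r \<in> sat R S B"
      and y: "y \<in> carrier T" "t \<otimes>\<^bsub>T\<^esub> y \<in> K"
    obtain s' r where sr: "s' \<in> S" "r \<in> carrier R" "h s' \<otimes>\<^bsub>T\<^esub> y = h r" using fraction[OF y(1)] by blast
    have "h (a \<otimes> r) = (h s \<otimes>\<^bsub>T\<^esub> t) \<otimes>\<^bsub>T\<^esub> (h s' \<otimes>\<^bsub>T\<^esub> y)" unfolding st sr(3) using a sr by simp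
    also have "\<dots> = (h s \<otimes>\<^bsub>T\<^esub> h s') \<otimes>\<^bsub>T\<^esub> (t \<otimes>\<^bsub>T\<^esub> y)"
      using t y(1) denominator_carrier[OF s] denominator_carrier[OF sr(1)] by (simp add: S.m_ac)
    also have "\<dots> \<in> K"
      using y(2) denominator_carrier[OF s] denominator_carrier[OF sr(1)]
      by (simp add: S.ideal_closed[OF K])
    finally have "a \<otimes> r \<in> sat R S B" using mem[of "a \<otimes> r"] a sr by simp
    then have "r \<in> contraction K" using reg sr KB by blast
    then show "y \<in> K" using mem_iff_numerator[OF K y(1) sr] by blast
  qed
  then show ?case using tail by (simp add: S.sat_one[OF K])
qed simp

lemma contraction_zero: "contraction {\<zero>\<^bsub>T\<^esub>} = sat R S J"
proof -
  have "sat R S J \<subseteq> carrier R" by (auto simp: sat_def)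
  then have "{a \<in> carrier R. a \<in> sat R S J} = sat R S J" by blast
  then show ?thesis unfolding contraction_def using hom_eq_zero by (simp cong: conj_cong)
qed

end

lemma carrier_quotient: "carrier (R Quot K) = (\<lambda>a. K +>\<^bsub>R\<^esub> a) ` carrier R"
  by (auto simp: FactRing_def A_RCOSETS_def')

lemma zero_quotient: "\<zero>\<^bsub>R Quot K\<^esub> = K"
  by (simp add: FactRing_def)

lemma fraction_hom_quotient:
  assumes R: "cring R" and K: "ideal K R"
  shows "fraction_hom R (R Quot K) ((+>\<^bsub>R\<^esub>) K) {\<one>\<^bsub>R\<^esub>} K"
proof -
  interpret cring R by (rule R)
  interpret K: ideal K R by (rule K)
  interpret q: ring_hom_cring R "R Quot K" "(+>\<^bsub>R\<^esub>) K" by (rule K.rcos_ring_hom_cring[OF R])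
  show ?thesis
  proof (unfold_locales)
    show "{\<one>\<^bsub>R\<^esub>} \<subseteq> carrier R" by simp
    fix t assume "t \<in> carrier (R Quot K)"
    then obtain a where "a \<in> carrier R" "t = K +>\<^bsub>R\<^esub> a" unfolding carrier_quotient by (elim imageE)
    then have "(K +>\<^bsub>R\<^esub> \<one>\<^bsub>R\<^esub>) \<otimes>\<^bsub>R Quot K\<^esub> t = K +>\<^bsub>R\<^esub> a"
      using q.hom_mult[OF one_closed, of a] by simp
    then show "\<exists>s\<in>{\<one>\<^bsub>R\<^esub>}. \<exists>a\<in>carrier R. (K +>\<^bsub>R\<^esub> s) \<otimes>\<^bsub>R Quot K\<^esub> t = K +>\<^bsub>R\<^esub> a"
      using \<open>a \<in> carrier R\<close> by blast
  next
    fix a assume a: "a \<in> carrier R"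
    have "K +>\<^bsub>R\<^esub> a = K \<longleftrightarrow> a \<in> K"
      by (rule iffI[OF K.rcos_const_imp_mem[OF a] a_rcos_zero[OF K]])
    moreover note zero_quotient[of R K]
    ultimately show "(K +>\<^bsub>R\<^esub> a = \<zero>\<^bsub>R Quot K\<^esub>) = (a \<in> sat R {\<one>\<^bsub>R\<^esub>} K)"
      by (simp add: sat_one[OF K])
  next
    fix s assume "s \<in> {\<one>\<^bsub>R\<^esub>}"
    then have "\<one>\<^bsub>R Quot K\<^esub> \<otimes>\<^bsub>R Quot K\<^esub> (K +>\<^bsub>R\<^esub> s) = \<one>\<^bsub>R Quot K\<^esub>"
      using q.hom_one by simp
    then show "\<exists>u\<in>carrier (R Quot K). u \<otimes>\<^bsub>R Quot K\<^esub> (K +>\<^bsub>R\<^esub> s) = \<one>\<^bsub>R Quot K\<^esub>"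
      using q.S.one_closed by blast
  qed auto
qed

text \<open>
  Forming fractions first and dividing by the extended ideal afterwards gives the fractions of \<open>R/B\<close>.
\<close>

lemma (in fraction_hom) fraction_hom_quotient_extension:
  assumes B: "ideal B R" and J0: "J \<subseteq> B"
  defines "K \<equiv> extended_ideal T h B"
  shows "fraction_hom R (T Quot K) ((+>\<^bsub>T\<^esub>) K \<circ> h) S B"
proof -
  have hB: "h ` B \<subseteq> carrier T" using R.ideal_subset[OF B] by auto
  have K: "ideal K T" unfolding K_def extended_ideal_def by (rule S.genideal_ideal[OF hB])
  have "K = extension B"
  proof
    have "B \<subseteq> contraction (extension B)"
      using contraction_extension[OF B] R.sat_upper[OF submonoid B] J0 by simp
    then show "K \<subseteq> extension B" unfolding K_def extended_ideal_def
      by (intro S.genideal_minimal extension_ideal B) (auto simp: contraction_def)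
    show "extension B \<subseteq> K"
    proof
      fix t assume "t \<in> extension B"
      then obtain s b where *: "t \<in> carrier T" "s \<in> S" "b \<in> B" "h s \<otimes>\<^bsub>T\<^esub> t = h b"
        by (auto simp: extension_def)
      then have "h s \<otimes>\<^bsub>T\<^esub> t \<in> K"
        using S.genideal_self[OF hB] by (auto simp: K_def extended_ideal_def)
      then show "t \<in> K" by (rule cancel_mem[OF K *(2,1)])
    qed
  qed
  then have KB: "contraction K = sat R S B"
    using contraction_extension[OF B] R.sat_upper[OF submonoid B] J0 by auto
  interpret q: fraction_hom T "T Quot K" "(+>\<^bsub>T\<^esub>) K" "{\<one>\<^bsub>T\<^esub>}" K
    by (rule fraction_hom_quotient[OF S.is_cring K])
  interpret c: ring_hom_cring R "T Quot K" "(+>\<^bsub>T\<^esub>) K \<circ> h"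
    by unfold_locales (rule ring_hom_trans[OF homh q.homh])
  show ?thesis
  proof (intro fraction_hom.intro fraction_hom_axioms.intro c.ring_hom_cring_axioms submonoid B)
    fix s assume s: "s \<in> S"
    obtain u where u: "u \<in> carrier T" "u \<otimes>\<^bsub>T\<^esub> h s = \<one>\<^bsub>T\<^esub>" using unit[OF s] by blast
    have "(K +>\<^bsub>T\<^esub> u) \<otimes>\<^bsub>T Quot K\<^esub> (K +>\<^bsub>T\<^esub> h s) = \<one>\<^bsub>T Quot K\<^esub>"
      using u denominator_carrier[OF s] by (simp flip: q.hom_mult q.hom_one)
    then show "\<exists>u\<in>carrier (T Quot K). u \<otimes>\<^bsub>T Quot K\<^esub> ((+>\<^bsub>T\<^esub>) K \<circ> h) s = \<one>\<^bsub>T Quot K\<^esub>"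
      using q.hom_closed[OF u(1)] by auto
  next
    fix t assume "t \<in> carrier (T Quot K)"
    then obtain z where z: "z \<in> carrier T" "t = K +>\<^bsub>T\<^esub> z" unfolding carrier_quotient by (elim imageE)
    obtain s a where sa: "s \<in> S" "a \<in> carrier R" "h s \<otimes>\<^bsub>T\<^esub> z = h a" using fraction[OF z(1)] by blast
    have "(K +>\<^bsub>T\<^esub> h s) \<otimes>\<^bsub>T Quot K\<^esub> t = K +>\<^bsub>T\<^esub> h a"
      using z sa denominator_carrier[OF sa(1)] by (simp flip: q.hom_mult)
    then show "\<exists>s\<in>S. \<exists>a\<in>carrier R. ((+>\<^bsub>T\<^esub>) K \<circ> h) s \<otimes>\<^bsub>T Quot K\<^esub> t = ((+>\<^bsub>T\<^esub>) K \<circ> h) a"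
      using sa by auto
  next
    fix a assume a: "a \<in> carrier R"
    have "((+>\<^bsub>T\<^esub>) K \<circ> h) a = \<zero>\<^bsub>T Quot K\<^esub> \<longleftrightarrow> h a \<in> K"
      using q.hom_eq_zero[of "h a"] a by (simp add: S.sat_one[OF K])
    also have "\<dots> \<longleftrightarrow> a \<in> sat R S B" unfolding KB[symmetric] using a by (simp add: contraction_def)
    finally show "(((+>\<^bsub>T\<^esub>) K \<circ> h) a = \<zero>\<^bsub>T Quot K\<^esub>) = (a \<in> sat R S B)" .
  qed
qed

section \<open>The ring structure of localizations\<close>

locale localization_data = cring R for R (structure) +
  fixes S
  assumes S: "submonoid S R"
begin

abbreviation L where "L \<equiv> localization R S"
abbreviation fr where "fr a s \<equiv> Defs.fraction R S a s"

lemma S_carrier [simp]: "s \<in> S \<Longrightarrow> s \<in> carrier R"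
  by (rule submonoid_carrier[OF S])

lemma S_mult [simp]: "s \<in> S \<Longrightarrow> t \<in> S \<Longrightarrow> s \<otimes> t \<in> S"
  by (rule submonoid.m_closed[OF S])

lemma S_one [simp]: "\<one> \<in> S"
  by (rule submonoid.one_closed[OF S])

lemma equiv_loc_rel: "equiv (carrier R \<times> S) (loc_rel R S)"
proof (rule equivI)
  show "loc_rel R S \<subseteq> (carrier R \<times> S) \<times> (carrier R \<times> S)" by (auto simp: loc_rel_def)
  show "refl_on (carrier R \<times> S) (loc_rel R S)"
    by (rule refl_onI) (auto simp: loc_rel_def intro!: bexI[of _ \<one>])
  show "sym (loc_rel R S)"
  proof (rule symI, clarsimp simp: loc_rel_def)
    fix a s b t u assume "u \<in> S" "u \<otimes> (t \<otimes> a) = u \<otimes> (s \<otimes> b)"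
    then show "\<exists>u\<in>S. u \<otimes> (s \<otimes> b) = u \<otimes> (t \<otimes> a)" by (intro bexI[of _ u]) auto
  qed
  show "trans (loc_rel R S)"
  proof (rule transI, clarsimp simp: loc_rel_def)
    fix a s b t c r u v
    assume *: "a \<in> carrier R" "s \<in> S" "b \<in> carrier R" "t \<in> S" "c \<in> carrier R" "r \<in> S"
      and u: "u \<in> S" "u \<otimes> (t \<otimes> a) = u \<otimes> (s \<otimes> b)"
      and v: "v \<in> S" "v \<otimes> (r \<otimes> b) = v \<otimes> (t \<otimes> c)"
    have "(u \<otimes> v \<otimes> t) \<otimes> (r \<otimes> a) = (v \<otimes> r) \<otimes> (u \<otimes> (t \<otimes> a))"
      using * u(1) v(1) by (simp add: m_ac)
    also have "\<dots> = (u \<otimes> s) \<otimes> (v \<otimes> (r \<otimes> b))"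
      unfolding u(2) using * u(1) v(1) by (simp add: m_ac)
    also have "\<dots> = (u \<otimes> v \<otimes> t) \<otimes> (s \<otimes> c)"
      unfolding v(2) using * u(1) v(1) by (simp add: m_ac)
    finally show "\<exists>u\<in>S. u \<otimes> (r \<otimes> a) = u \<otimes> (s \<otimes> c)"
      using * u(1) v(1) by (intro bexI[of _ "u \<otimes> v \<otimes> t"]) auto
  qed
qed

lemma fraction_eq_iff:
  assumes "a \<in> carrier R" "s \<in> S" "b \<in> carrier R" "t \<in> S"
  shows "fr a s = fr b t \<longleftrightarrow> (\<exists>u\<in>S. u \<otimes> (t \<otimes> a) = u \<otimes> (s \<otimes> b))"
  unfolding fraction_def using assms
  by (subst eq_equiv_class_iff[OF equiv_loc_rel]) (auto simp: loc_rel_def)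

lemma fraction_eqI:
  assumes "a \<in> carrier R" "s \<in> S" "b \<in> carrier R" "t \<in> S" "t \<otimes> a = s \<otimes> b"
  shows "fr a s = fr b t"
  using assms by (subst fraction_eq_iff) (auto intro!: bexI[of _ \<one>])

lemma fraction_self: "a \<in> carrier R \<Longrightarrow> s \<in> S \<Longrightarrow> (a, s) \<in> fr a s"
  unfolding fraction_def by (rule equiv_class_self[OF equiv_loc_rel]) simp

lemma fraction_memD:
  assumes "(a', s') \<in> fr a s"
  shows "a' \<in> carrier R \<and> s' \<in> S \<and> (\<exists>u\<in>S. u \<otimes> (s' \<otimes> a) = u \<otimes> (s \<otimes> a'))"
  using assms by (auto simp: fraction_def loc_rel_def)

lemma carrier_eq: "carrier L = {fr a s | a s. a \<in> carrier R \<and> s \<in> S}"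
  by (auto simp: localization_def quotient_def fraction_def)

lemma fraction_closed: "a \<in> carrier R \<Longrightarrow> s \<in> S \<Longrightarrow> fr a s \<in> carrier L"
  by (auto simp: carrier_eq)

text \<open>
  The operations of the localization are unions over all pairs of representatives. They are
  well defined as soon as the operation is constant on these pairs.
\<close>

lemma UN_fractions:
  assumes "a \<in> carrier R" "s \<in> S" "b \<in> carrier R" "t \<in> S"
    and wd: "\<And>a' s' b' t' u v. \<lbrakk>a' \<in> carrier R; s' \<in> S; b' \<in> carrier R; t' \<in> S; u \<in> S; v \<in> S;
      u \<otimes> (s' \<otimes> a) = u \<otimes> (s \<otimes> a'); v \<otimes> (t' \<otimes> b) = v \<otimes> (t \<otimes> b')\<rbrakk> \<Longrightarrow> F a' s' b' t' = X"
  shows "(\<Union>(a, s)\<in>fr a s. \<Union>(b, t)\<in>fr b t. F a s b t) = X"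
proof -
  have const: "F a' s' b' t' = X" if as: "(a', s') \<in> fr a s" and bt: "(b', t') \<in> fr b t" for a' s' b' t'
    using fraction_memD[OF as] fraction_memD[OF bt] wd[of a' s' b' t'] by blast
  have "(a, s) \<in> fr a s" "(b, t) \<in> fr b t" using assms(1-4) fraction_self by simp_all
  then show ?thesis using const by fastforce
qed

lemma mult_fraction:
  assumes ab: "a \<in> carrier R" "s \<in> S" "b \<in> carrier R" "t \<in> S"
  shows "fr a s \<otimes>\<^bsub>L\<^esub> fr b t = fr (a \<otimes> b) (s \<otimes> t)"
proof -
  have "(\<Union>(a, s)\<in>fr a s. \<Union>(b, t)\<in>fr b t. fr (a \<otimes> b) (s \<otimes> t)) = fr (a \<otimes> b) (s \<otimes> t)"
  proof (rule UN_fractions[OF ab])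
    fix a' s' b' t' u v
    assume c: "a' \<in> carrier R" "s' \<in> S" "b' \<in> carrier R" "t' \<in> S" "u \<in> S" "v \<in> S"
      and u: "u \<otimes> (s' \<otimes> a) = u \<otimes> (s \<otimes> a')" and v: "v \<otimes> (t' \<otimes> b) = v \<otimes> (t \<otimes> b')"
    have "(u \<otimes> v) \<otimes> ((s \<otimes> t) \<otimes> (a' \<otimes> b')) = (u \<otimes> (s \<otimes> a')) \<otimes> (v \<otimes> (t \<otimes> b'))"
      using ab c by (simp add: m_ac)
    also have "\<dots> = (u \<otimes> v) \<otimes> ((s' \<otimes> t') \<otimes> (a \<otimes> b))"
      unfolding u[symmetric] v[symmetric] using ab c by (simp add: m_ac)
    finally show "fr (a' \<otimes> b') (s' \<otimes> t') = fr (a \<otimes> b) (s \<otimes> t)"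
      using ab c by (subst fraction_eq_iff) (auto intro!: bexI[of _ "u \<otimes> v"])
  qed
  then show ?thesis by (simp add: localization_def)
qed

lemma add_fraction:
  assumes ab: "a \<in> carrier R" "s \<in> S" "b \<in> carrier R" "t \<in> S"
  shows "fr a s \<oplus>\<^bsub>L\<^esub> fr b t = fr (t \<otimes> a \<oplus> s \<otimes> b) (s \<otimes> t)"
proof -
  have "(\<Union>(a, s)\<in>fr a s. \<Union>(b, t)\<in>fr b t. fr (t \<otimes> a \<oplus> s \<otimes> b) (s \<otimes> t)) =
    fr (t \<otimes> a \<oplus> s \<otimes> b) (s \<otimes> t)"
  proof (rule UN_fractions[OF ab])
    fix a' s' b' t' u v
    assume c: "a' \<in> carrier R" "s' \<in> S" "b' \<in> carrier R" "t' \<in> S" "u \<in> S" "v \<in> S"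
      and u: "u \<otimes> (s' \<otimes> a) = u \<otimes> (s \<otimes> a')" and v: "v \<otimes> (t' \<otimes> b) = v \<otimes> (t \<otimes> b')"
    have "(u \<otimes> v) \<otimes> ((s \<otimes> t) \<otimes> (t' \<otimes> a' \<oplus> s' \<otimes> b')) =
      (v \<otimes> t \<otimes> t') \<otimes> (u \<otimes> (s \<otimes> a')) \<oplus> (u \<otimes> s \<otimes> s') \<otimes> (v \<otimes> (t \<otimes> b'))"
      using ab c by (simp add: r_distr m_ac)
    also have "\<dots> = (u \<otimes> v) \<otimes> ((s' \<otimes> t') \<otimes> (t \<otimes> a \<oplus> s \<otimes> b))"
      unfolding u[symmetric] v[symmetric] using ab c by (simp add: r_distr m_ac)
    finally show "fr (t' \<otimes> a' \<oplus> s' \<otimes> b') (s' \<otimes> t') = fr (t \<otimes> a \<oplus> s \<otimes> b) (s \<otimes> t)"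
      using ab c by (subst fraction_eq_iff) (auto intro!: bexI[of _ "u \<otimes> v"])
  qed
  then show ?thesis by (simp add: localization_def)
qed

lemma one_eq: "\<one>\<^bsub>L\<^esub> = fr \<one> \<one>" and zero_eq: "\<zero>\<^bsub>L\<^esub> = fr \<zero> \<one>"
  by (simp_all add: localization_def)

lemma carrierE:
  assumes "x \<in> carrier L"
  obtains a s where "a \<in> carrier R" "s \<in> S" "x = fr a s"
  using assms carrier_eq by auto

lemma cring_localization: "cring L"
proof (rule cringI)
  show "abelian_group L"
  proof (rule abelian_groupI)
    fix x y assume x: "x \<in> carrier L" and y: "y \<in> carrier L"
    obtain a s where a: "a \<in> carrier R" "s \<in> S" "x = fr a s" by (rule carrierE[OF x])
    obtain b t where b: "b \<in> carrier R" "t \<in> S" "y = fr b t" by (rule carrierE[OF y])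
    show "x \<oplus>\<^bsub>L\<^esub> y \<in> carrier L"
      using a b by (simp add: add_fraction fraction_closed)
    show "x \<oplus>\<^bsub>L\<^esub> y = y \<oplus>\<^bsub>L\<^esub> x"
      using a b by (simp add: add_fraction m_comm a_comm)
    {
      fix z assume z: "z \<in> carrier L"
      obtain c r where c: "c \<in> carrier R" "r \<in> S" "z = fr c r" by (rule carrierE[OF z])
      show "x \<oplus>\<^bsub>L\<^esub> y \<oplus>\<^bsub>L\<^esub> z = x \<oplus>\<^bsub>L\<^esub> (y \<oplus>\<^bsub>L\<^esub> z)"
        using a b c by (simp add: add_fraction r_distr m_ac a_ac)
    }
  next
    show "\<zero>\<^bsub>L\<^esub> \<in> carrier L" by (simp add: zero_eq fraction_closed)
  next
    fix x assume x: "x \<in> carrier L"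
    obtain a s where a: "a \<in> carrier R" "s \<in> S" "x = fr a s" by (rule carrierE[OF x])
    show "\<zero>\<^bsub>L\<^esub> \<oplus>\<^bsub>L\<^esub> x = x" using a by (simp add: zero_eq add_fraction)
    have "fr (\<ominus> a) s \<oplus>\<^bsub>L\<^esub> x = \<zero>\<^bsub>L\<^esub>"
    proof -
      have "s \<otimes> (\<ominus> a) \<oplus> s \<otimes> a = \<zero>" using a by (simp flip: r_distr add: l_neg)
      then have "fr (\<ominus> a) s \<oplus>\<^bsub>L\<^esub> x = fr \<zero> (s \<otimes> s)" using a by (simp add: add_fraction)
      also have "\<dots> = fr \<zero> \<one>" using a by (intro fraction_eqI) auto
      finally show ?thesis by (simp add: zero_eq)
    qed
    then show "\<exists>y\<in>carrier L. y \<oplus>\<^bsub>L\<^esub> x = \<zero>\<^bsub>L\<^esub>" using a fraction_closed[of "\<ominus> a" s] by auto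
  qed
  show "comm_monoid L"
  proof (rule comm_monoidI)
    fix x y assume x: "x \<in> carrier L" and y: "y \<in> carrier L"
    obtain a s where a: "a \<in> carrier R" "s \<in> S" "x = fr a s" by (rule carrierE[OF x])
    obtain b t where b: "b \<in> carrier R" "t \<in> S" "y = fr b t" by (rule carrierE[OF y])
    show "x \<otimes>\<^bsub>L\<^esub> y \<in> carrier L" using a b by (simp add: mult_fraction fraction_closed)
    show "x \<otimes>\<^bsub>L\<^esub> y = y \<otimes>\<^bsub>L\<^esub> x" using a b by (simp add: mult_fraction m_comm)
    {
      fix z assume z: "z \<in> carrier L"
      obtain c r where c: "c \<in> carrier R" "r \<in> S" "z = fr c r" by (rule carrierE[OF z])
      show "x \<otimes>\<^bsub>L\<^esub> y \<otimes>\<^bsub>L\<^esub> z = x \<otimes>\<^bsub>L\<^esub> (y \<otimes>\<^bsub>L\<^esub> z)"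
        using a b c by (simp add: mult_fraction m_ac)
    }
  next
    show "\<one>\<^bsub>L\<^esub> \<in> carrier L" by (simp add: one_eq fraction_closed)
    fix x assume x: "x \<in> carrier L"
    obtain a s where a: "a \<in> carrier R" "s \<in> S" "x = fr a s" by (rule carrierE[OF x])
    show "\<one>\<^bsub>L\<^esub> \<otimes>\<^bsub>L\<^esub> x = x" using a by (simp add: one_eq mult_fraction)
  qed
  fix x y z assume x: "x \<in> carrier L" and y: "y \<in> carrier L" and z: "z \<in> carrier L"
  obtain a s where a: "a \<in> carrier R" "s \<in> S" "x = fr a s" by (rule carrierE[OF x])
  obtain b t where b: "b \<in> carrier R" "t \<in> S" "y = fr b t" by (rule carrierE[OF y])
  obtain c r where c: "c \<in> carrier R" "r \<in> S" "z = fr c r" by (rule carrierE[OF z])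
  have "fr ((t \<otimes> a \<oplus> s \<otimes> b) \<otimes> c) (s \<otimes> t \<otimes> r) =
      fr (t \<otimes> r \<otimes> (a \<otimes> c) \<oplus> s \<otimes> r \<otimes> (b \<otimes> c)) (s \<otimes> r \<otimes> (t \<otimes> r))"
    using a b c by (intro fraction_eqI) (simp_all add: l_distr r_distr m_ac)
  then show "(x \<oplus>\<^bsub>L\<^esub> y) \<otimes>\<^bsub>L\<^esub> z = x \<otimes>\<^bsub>L\<^esub> z \<oplus>\<^bsub>L\<^esub> y \<otimes>\<^bsub>L\<^esub> z"
    using a b c by (simp add: add_fraction mult_fraction)
qed

lemma fraction_hom_localization: "fraction_hom R L (loc_map R S) S {\<zero>}"
proof -
  interpret L: cring L by (rule cring_localization)
  have hom: "loc_map R S \<in> ring_hom R L"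
  proof (rule ring_hom_memI)
    fix a b assume "a \<in> carrier R" "b \<in> carrier R"
    then show "loc_map R S a \<in> carrier L"
      "loc_map R S (a \<otimes> b) = loc_map R S a \<otimes>\<^bsub>L\<^esub> loc_map R S b"
      "loc_map R S (a \<oplus> b) = loc_map R S a \<oplus>\<^bsub>L\<^esub> loc_map R S b"
      by (simp_all add: loc_map_def fraction_closed mult_fraction add_fraction)
  qed (simp add: loc_map_def one_eq)
  show ?thesis
  proof (intro fraction_hom.intro fraction_hom_axioms.intro ring_hom_cring.intro
      ring_hom_cring_axioms.intro is_cring cring_localization hom S zeroideal)
    fix s assume s: "s \<in> S"
    have "fr \<one> s \<otimes>\<^bsub>L\<^esub> loc_map R S s = fr s s"
      using s by (simp add: loc_map_def mult_fraction)
    also have "\<dots> = \<one>\<^bsub>L\<^esub>" unfolding one_eq using s by (intro fraction_eqI) simp_all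
    finally show "\<exists>u\<in>carrier L. u \<otimes>\<^bsub>L\<^esub> loc_map R S s = \<one>\<^bsub>L\<^esub>"
      using s fraction_closed[of \<one> s] by auto
  next
    fix x assume x: "x \<in> carrier L"
    obtain a s where a: "a \<in> carrier R" "s \<in> S" "x = fr a s" by (rule carrierE[OF x])
    have "loc_map R S s \<otimes>\<^bsub>L\<^esub> x = fr (s \<otimes> a) s" using a by (simp add: loc_map_def mult_fraction)
    also have "\<dots> = loc_map R S a" unfolding loc_map_def using a by (intro fraction_eqI) simp_all
    finally show "\<exists>s\<in>S. \<exists>a\<in>carrier R. loc_map R S s \<otimes>\<^bsub>L\<^esub> x = loc_map R S a" using a by blast
  next
    fix a assume a: "a \<in> carrier R"
    then show "(loc_map R S a = \<zero>\<^bsub>L\<^esub>) = (a \<in> sat R S {\<zero>})"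
      unfolding loc_map_def zero_eq by (subst fraction_eq_iff) (auto simp: sat_def)
  qed
qed

end

text \<open>
  Localizing \<open>T\<close> at a prime amounts to enlarging the set of denominators in \<open>R\<close> to the complement of
  the contracted prime.
\<close>

lemma (in fraction_hom) fraction_hom_localization_at:
  assumes N: "primeideal N T"
  shows "fraction_hom R (localization_at T N) (loc_map T (carrier T - N) \<circ> h)
    (carrier R - contraction N) J"
proof -
  let ?V = "carrier T - N" and ?U = "carrier R - contraction N"
  have V: "submonoid ?V T" by (rule S.primeideal_complement_submonoid[OF N])
  have U: "submonoid ?U R" by (rule R.primeideal_complement_submonoid[OF contraction_prime(1)[OF N]])
  interpret l: localization_data T ?V
    by (intro localization_data.intro localization_data_axioms.intro S.is_cring V)
  interpret q: fraction_hom T "localization_at T N" "loc_map T ?V" ?V "{\<zero>\<^bsub>T\<^esub>}"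
    by (rule l.fraction_hom_localization)
  interpret c: ring_hom_cring R "localization_at T N" "loc_map T ?V \<circ> h"
    by unfold_locales (rule ring_hom_trans[OF homh q.homh])
  have hU: "h u \<in> ?V" if "u \<in> ?U" for u using that by (auto simp: contraction_def)
  have SU: "s \<in> ?U" if "s \<in> S" for s
    using that contraction_prime(2)[OF N] denominator_carrier by blast
  show ?thesis
  proof (intro fraction_hom.intro fraction_hom_axioms.intro c.ring_hom_cring_axioms U kernel_ideal)
    fix s assume "s \<in> ?U"
    from q.unit[OF hU[OF this]]
    show "\<exists>u\<in>carrier (localization_at T N). u \<otimes>\<^bsub>localization_at T N\<^esub> (loc_map T ?V \<circ> h) s =
        \<one>\<^bsub>localization_at T N\<^esub>" by simp
  next
    fix t assume t: "t \<in> carrier (localization_at T N)"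
    obtain v w where vw: "v \<in> ?V" "w \<in> carrier T"
      "loc_map T ?V v \<otimes>\<^bsub>localization_at T N\<^esub> t = loc_map T ?V w" using q.fraction[OF t] by blast
    obtain s a where sa: "s \<in> S" "a \<in> carrier R" "h s \<otimes>\<^bsub>T\<^esub> w = h a" using fraction[OF vw(2)] by blast
    obtain s' b where sb: "s' \<in> S" "b \<in> carrier R" "h s' \<otimes>\<^bsub>T\<^esub> v = h b" using fraction[of v] vw(1) by blast
    have c: "s \<in> carrier R" "s' \<in> carrier R" "v \<in> carrier T"
      using sa sb vw denominator_carrier by auto
    have "b \<in> ?U"
      using mem_iff_numerator[OF primeideal.axioms(1)[OF N] c(3) sb] vw(1) sb(2) by blast
    then have u: "s \<otimes> b \<in> ?U" by (rule submonoid.m_closed[OF U SU[OF sa(1)]])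
    have "loc_map T ?V (h (s \<otimes> b)) \<otimes>\<^bsub>localization_at T N\<^esub> t =
      loc_map T ?V (h s \<otimes>\<^bsub>T\<^esub> h s') \<otimes>\<^bsub>localization_at T N\<^esub> (loc_map T ?V v \<otimes>\<^bsub>localization_at T N\<^esub> t)"
      using c t sb(2) sb(3)[symmetric] by (simp add: q.S.m_assoc)
    also have "\<dots> = loc_map T ?V (h s' \<otimes>\<^bsub>T\<^esub> (h s \<otimes>\<^bsub>T\<^esub> w))"
      unfolding vw(3) using c vw(2) by (simp add: q.S.m_ac)
    also have "\<dots> = loc_map T ?V (h (s' \<otimes> a))" unfolding sa(3) using c sa by simp
    finally have eq: "(loc_map T ?V \<circ> h) (s \<otimes> b) \<otimes>\<^bsub>localization_at T N\<^esub> t =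
        (loc_map T ?V \<circ> h) (s' \<otimes> a)" unfolding o_apply .
    show "\<exists>s\<in>?U. \<exists>a\<in>carrier R. (loc_map T ?V \<circ> h) s \<otimes>\<^bsub>localization_at T N\<^esub> t =
        (loc_map T ?V \<circ> h) a"
      by (rule bexI[OF _ u], rule bexI[where x = "s' \<otimes> a"], rule eq) (use c sa in simp)
  next
    fix a assume a: "a \<in> carrier R"
    have "(loc_map T ?V \<circ> h) a = \<zero>\<^bsub>localization_at T N\<^esub> \<longleftrightarrow> (\<exists>v\<in>?V. v \<otimes>\<^bsub>T\<^esub> h a = \<zero>\<^bsub>T\<^esub>)"
      using q.hom_eq_zero[of "h a"] a by (auto simp: sat_def)
    also have "\<dots> \<longleftrightarrow> a \<in> sat R ?U J"
    proof
      assume "\<exists>v\<in>?V. v \<otimes>\<^bsub>T\<^esub> h a = \<zero>\<^bsub>T\<^esub>"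
      then obtain v where v: "v \<in> carrier T" "v \<notin> N" "v \<otimes>\<^bsub>T\<^esub> h a = \<zero>\<^bsub>T\<^esub>" by blast
      obtain s b where sb: "s \<in> S" "b \<in> carrier R" "h s \<otimes>\<^bsub>T\<^esub> v = h b" using fraction[OF v(1)] by blast
      have "b \<in> ?U"
        using mem_iff_numerator[OF primeideal.axioms(1)[OF N] v(1) sb] v(2) sb(2) by blast
      have "h (b \<otimes> a) = h s \<otimes>\<^bsub>T\<^esub> (v \<otimes>\<^bsub>T\<^esub> h a)"
        using sb(2) sb(3)[symmetric] a v(1) denominator_carrier[OF sb(1)] by (simp add: S.m_assoc)
      also have "\<dots> = \<zero>\<^bsub>T\<^esub>" unfolding v(3) using denominator_carrier[OF sb(1)] by simp
      finally have "b \<otimes> a \<in> sat R S J" using hom_eq_zero[of "b \<otimes> a"] sb a by simp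
      then obtain r where r: "r \<in> S" "r \<otimes> (b \<otimes> a) \<in> J" by (auto simp: sat_def)
      have "r \<otimes> b \<in> ?U" using submonoid.m_closed[OF U SU[OF r(1)] \<open>b \<in> ?U\<close>] .
      moreover have "(r \<otimes> b) \<otimes> a \<in> J"
        using r a sb denominator_carrier[OF r(1)] by (simp add: R.m_assoc)
      ultimately show "a \<in> sat R ?U J" using a by (intro R.satI) auto
    next
      assume "a \<in> sat R ?U J"
      then obtain u where u: "u \<in> ?U" "u \<otimes> a \<in> J" by (auto simp: sat_def)
      then have "h (u \<otimes> a) = \<zero>\<^bsub>T\<^esub>"
        using hom_eq_zero[of "u \<otimes> a"] R.sat_upper[OF submonoid kernel_ideal] a by auto
      then have "h u \<otimes>\<^bsub>T\<^esub> h a = \<zero>\<^bsub>T\<^esub>" using u a by simp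
      then show "\<exists>v\<in>?V. v \<otimes>\<^bsub>T\<^esub> h a = \<zero>\<^bsub>T\<^esub>" using hU[OF u(1)] by blast
    qed
    finally show "((loc_map T ?V \<circ> h) a = \<zero>\<^bsub>localization_at T N\<^esub>) = (a \<in> sat R ?U J)" .
  qed
qed

section \<open>Cohen-Macaulay loci\<close>

text \<open>
  For \<open>J \<subseteq> Q\<close> this says that the local ring of \<open>R/J\<close> at \<open>Q\<close> has a regular sequence at least as long as
  its dimension. Formulated in \<open>R\<close>, the condition can be compared for different ideals \<open>J\<close>, and it
  does not depend on a choice of the local ring.
\<close>

definition cohen_macaulay_at :: "('a, 'b) ring_scheme \<Rightarrow> 'a set \<Rightarrow> 'a set \<Rightarrow> bool" where
  "cohen_macaulay_at R J Q \<longleftrightarrow>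
     (\<exists>xs. set xs \<subseteq> Q \<and> loc_regular R (carrier R - Q) xs J \<and>
        (\<forall>C n. prime_chain R C n \<and> J \<subseteq> C 0 \<and> C n \<subseteq> Q \<longrightarrow> n \<le> length xs))"

lemma noetherian_cring_iff: "noetherian_cring R \<longleftrightarrow> noeth_cring R"
  by (simp add: noetherian_cring_def noeth_cring_def)

locale local_fraction_hom = fraction_hom R T h S J
  for R (structure) and T (structure) and h S J +
  fixes Q
  assumes noeth: "noeth_cring R" and Q: "primeideal Q R" and SQ: "S = carrier R - Q" and JQ: "J \<subseteq> Q"
begin

lemma extension_Q: "primeideal (extension Q) T" "contraction (extension Q) = Q"
  using extension_prime[OF Q JQ] SQ by auto

lemma proper_ideal_subset:
  assumes K: "ideal K T" and ne: "K \<noteq> carrier T"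
  shows "K \<subseteq> extension Q"
proof
  fix t assume t: "t \<in> K"
  have tc: "t \<in> carrier T" using ideal.Icarr[OF K t] .
  obtain s a where sa: "s \<in> S" "a \<in> carrier R" "h s \<otimes>\<^bsub>T\<^esub> t = h a" using fraction[OF tc] by blast
  have "a \<in> Q"
  proof (rule ccontr)
    assume "a \<notin> Q"
    then have aS: "a \<in> S" using SQ sa by simp
    have "h a \<in> K" using mem_iff_numerator[OF K tc sa] t by (simp add: contraction_def)
    then have "\<one>\<^bsub>T\<^esub> \<in> K" using cancel_mem[OF K aS S.one_closed] sa by simp
    then show False using S.ideal_eq_carrier[OF K] ne by simp
  qed
  then show "t \<in> extension Q"
    using mem_iff_numerator[OF primeideal.axioms(1)[OF extension_Q(1)] tc sa] extension_Q(2) by simp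
qed

lemma local_ring: "local_ring T" and max_ideal_eq: "max_ideal T = extension Q"
proof -
  note E = primeideal.axioms(1)[OF extension_Q(1)]
  have "maximalideal (extension Q) T"
  proof (rule maximalidealI[OF E])
    show "carrier T \<noteq> extension Q" using S.prime_one[OF extension_Q(1)] by auto
    fix K assume "ideal K T" "extension Q \<subseteq> K"
    then show "K = extension Q \<or> K = carrier T" using proper_ideal_subset by blast
  qed
  note max = this
  have uniq: "M = extension Q" if M: "maximalideal M T" for M
  proof -
    have "M \<subseteq> extension Q"
      using proper_ideal_subset[of M] maximalideal.axioms(1)[OF M] maximalideal.I_notcarr[OF M] by metis
    then have "extension Q = M \<or> extension Q = carrier T"
      using maximalideal.I_maximal[OF M E] S.ideal_subset[OF E] by blast
    then show ?thesis using S.prime_one[OF extension_Q(1)] by auto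
  qed
  have "\<exists>!M. maximalideal M T" by (rule ex1I, rule max, rule uniq)
  moreover have "(THE M. maximalideal M T) = extension Q" by (rule the_equality, rule max, rule uniq)
  ultimately show "local_ring T" "max_ideal T = extension Q"
    by (simp_all add: local_ring_def max_ideal_def S.is_cring)
qed

lemma noetherian_T: "noeth_cring T"
  by (rule noetherian[OF noeth])

lemma chain_length_le:
  assumes "\<And>C n. prime_chain R C n \<Longrightarrow> J \<subseteq> C 0 \<Longrightarrow> C n \<subseteq> Q \<Longrightarrow> n \<le> d"
  shows "krull_dim T \<le> enat d"
proof (rule krull_dim_le)
  fix C n assume C: "prime_chain T C n"
  have "contraction (C n) \<subseteq> Q"
    using contraction_chain(3)[OF C] SQ by (auto simp: contraction_def)
  from assms[OF contraction_chain(1,2)[OF C] this] show "n \<le> d" .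
qed

lemma cohen_macaulay_local:
  assumes "cohen_macaulay_at R J Q"
  shows "cohen_macaulay_local_ring T"
proof -
  interpret N: noeth_cring T by (rule noetherian_T)
  obtain xs where xs: "set xs \<subseteq> Q" "loc_regular R S xs J"
    and dim: "\<And>C n. prime_chain R C n \<Longrightarrow> J \<subseteq> C 0 \<Longrightarrow> C n \<subseteq> Q \<Longrightarrow> n \<le> length xs"
    using assms SQ by (auto simp: cohen_macaulay_at_def)
  have Qc: "Q \<subseteq> carrier R" by (rule R.ideal_subset[OF R.prime_ideal[OF Q]])
  note E = primeideal.axioms(1)[OF extension_Q(1)]
  let ?ts = "map h xs"
  have "\<exists>s\<in>S. h s \<otimes>\<^bsub>T\<^esub> h a = h a" if "a \<in> carrier R" for a
    using that submonoid.one_closed[OF submonoid] by (intro bexI[of _ \<one>]) simp_all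
  then have "list_all2 (\<lambda>t a. t \<in> carrier T \<and> a \<in> carrier R \<and> (\<exists>s\<in>S. h s \<otimes>\<^bsub>T\<^esub> t = h a)) ?ts xs"
    using xs(1) Qc by (auto simp: list_all2_map1 list_all2_same)
  from loc_regular_transfer[OF this kernel_ideal S.zeroideal contraction_zero]
  have reg: "loc_regular T {\<one>\<^bsub>T\<^esub>} ?ts {\<zero>\<^bsub>T\<^esub>}" using xs(2) by simp
  have tsE: "set ?ts \<subseteq> extension Q" using xs(1) extension_Q(2) by (auto simp: contraction_def)
  have tsc: "set ?ts \<subseteq> carrier T" using tsE S.ideal_subset[OF E] by blast
  have "Idl\<^bsub>T\<^esub> (set ?ts) \<subseteq> extension Q" by (rule S.genideal_minimal[OF E tsE])
  then have "Idl\<^bsub>T\<^esub> (set ?ts) \<noteq> carrier T" using S.prime_one[OF extension_Q(1)] by auto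
  then have "regular_sequence T ?ts"
    using reg tsc by (simp add: S.regular_sequence_iff_loc_regular)
  then have "enat (length ?ts) \<le> depth T"
    unfolding depth_def using tsE max_ideal_eq by (intro Sup_upper) blast
  moreover have "krull_dim T \<le> enat (length xs)" by (rule chain_length_le[OF dim])
  ultimately have "depth T = krull_dim T"
    using N.depth_le_krull_dim by (auto intro: antisym order_trans)
  then show ?thesis
    using local_ring noetherian_T by (simp add: cohen_macaulay_local_ring_def noetherian_cring_iff)
qed

lemma cohen_macaulay_at_of_regular:
  assumes reg: "regular_local_ring T"
  shows "cohen_macaulay_at R J Q"
proof -
  interpret N: noeth_cring T by (rule noetherian_T)
  obtain ts where ts: "enat (length ts) = krull_dim T" "set ts \<subseteq> max_ideal T"
    "loc_regular T {\<one>\<^bsub>T\<^esub>} ts {\<zero>\<^bsub>T\<^esub>}"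
    using N.regular_local_ring_regular_sequence[OF reg] .
  note E = primeideal.axioms(1)[OF extension_Q(1)]
  have "\<exists>a. a \<in> Q \<and> (\<exists>s\<in>S. h s \<otimes>\<^bsub>T\<^esub> t = h a)" if "t \<in> extension Q" for t
    using that by (auto simp: extension_def)
  then obtain f where f: "\<And>t. t \<in> extension Q \<Longrightarrow> f t \<in> Q \<and> (\<exists>s\<in>S. h s \<otimes>\<^bsub>T\<^esub> t = h (f t))" by metis
  let ?xs = "map f ts"
  have tsE: "t \<in> extension Q" if "t \<in> set ts" for t using that ts(2) max_ideal_eq by blast
  have Qc: "Q \<subseteq> carrier R" by (rule R.ideal_subset[OF R.prime_ideal[OF Q]])
  have "list_all2 (\<lambda>t a. t \<in> carrier T \<and> a \<in> carrier R \<and> (\<exists>s\<in>S. h s \<otimes>\<^bsub>T\<^esub> t = h a)) ts ?xs"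
    using f tsE Qc S.ideal_subset[OF E] by (auto simp: list_all2_map2 list_all2_same)
  from loc_regular_transfer[OF this kernel_ideal S.zeroideal contraction_zero]
  have "loc_regular R S ?xs J" using ts(3) by simp
  moreover have "set ?xs \<subseteq> Q" using f tsE by auto
  moreover have "n \<le> length ?xs" if C: "prime_chain R C n" "J \<subseteq> C 0" "C n \<subseteq> Q" for C n
  proof -
    have "prime_chain T (\<lambda>i. extension (C i)) n" using C SQ by (intro extension_chain) auto
    then have "enat n \<le> krull_dim T" by (rule le_krull_dim)
    then show ?thesis unfolding ts(1)[symmetric] by simp
  qed
  ultimately show ?thesis unfolding cohen_macaulay_at_def SQ by blast
qed

end

lemma local_fraction_homI:
  assumes "fraction_hom R T h (carrier R - Q) J" "noeth_cring R" "primeideal Q R" "J \<subseteq> Q"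
  shows "local_fraction_hom R T h (carrier R - Q) J Q"
  using assms by (intro local_fraction_hom.intro local_fraction_hom_axioms.intro) auto

context noeth_cring begin

text \<open>
  The J-2 property speaks about algebras on subsets of the type of sequences in \<open>R\<close>. The quotient ring is
  copied there by choosing a representative of each coset and viewing it as a constant sequence.
\<close>

definition representative :: "'a set \<Rightarrow> nat \<Rightarrow> 'a" where
  "representative X = (\<lambda>_. SOME b. b \<in> X)"

lemma representative_inj:
  assumes P: "ideal P R" shows "inj_on representative (carrier (R Quot P))"
proof (rule inj_onI)
  interpret P: ideal P R by (rule P)
  fix X Y assume XY: "X \<in> carrier (R Quot P)" "Y \<in> carrier (R Quot P)"
    and eq: "representative X = representative Y"
  obtain a where a: "a \<in> carrier R" "X = P +> a" using XY(1) unfolding carrier_quotient by (elim imageE)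
  obtain b where b: "b \<in> carrier R" "Y = P +> b" using XY(2) unfolding carrier_quotient by (elim imageE)
  define c where "c = (SOME c. c \<in> X)"
  have c: "c = (SOME c. c \<in> Y)" using fun_cong[OF eq, of 0] by (simp add: representative_def c_def)
  have "c \<in> X" unfolding c_def by (rule someI[of _ a]) (simp add: a P.a_rcos_self)
  moreover have "c \<in> Y" unfolding c by (rule someI[of _ b]) (simp add: b P.a_rcos_self)
  ultimately show "X = Y"
    using P.a_repr_independence'[of c a] P.a_repr_independence'[of c b] a b by simp
qed

lemma fraction_hom_quotient_copy:
  assumes P: "ideal P R"
  defines "A \<equiv> image_ring representative (R Quot P)"
  shows "fraction_hom R A (representative \<circ> (+>) P) {\<one>} P"
    and "carrier A = (representative \<circ> (+>) P) ` carrier R"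
proof -
  interpret q: fraction_hom R "R Quot P" "(+>) P" "{\<one>}" P
    by (rule fraction_hom_quotient[OF is_cring P])
  note inj = representative_inj[OF P]
  note iso = inj_imp_image_ring_iso[OF inj, folded A_def]
  have hom: "representative \<in> ring_hom (R Quot P) A" using iso by (simp add: ring_iso_def)
  have zero: "\<zero>\<^bsub>A\<^esub> = representative \<zero>\<^bsub>R Quot P\<^esub>" by (simp add: A_def image_ring_zero)
  have A: "cring A"
    using q.S.ring_iso_imp_img_cring[OF iso] unfolding zero[symmetric] by simp
  interpret A: cring A by (rule A)
  have carr: "carrier A = representative ` carrier (R Quot P)" by (simp add: A_def image_ring_carrier)
  then show carr': "carrier A = (representative \<circ> (+>) P) ` carrier R"
    unfolding carrier_quotient by (simp add: image_comp)
  interpret c: ring_hom_cring R A "representative \<circ> (+>) P"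
    by (intro ring_hom_cring.intro ring_hom_cring_axioms.intro is_cring A ring_hom_trans[OF q.homh hom])
  show "fraction_hom R A (representative \<circ> (+>) P) {\<one>} P"
  proof (intro fraction_hom.intro fraction_hom_axioms.intro c.ring_hom_cring_axioms one_submonoid P)
    fix s assume "s \<in> {\<one>}"
    then have "\<one>\<^bsub>A\<^esub> \<otimes>\<^bsub>A\<^esub> (representative \<circ> (+>) P) s = \<one>\<^bsub>A\<^esub>" using c.hom_one by simp
    then show "\<exists>u\<in>carrier A. u \<otimes>\<^bsub>A\<^esub> (representative \<circ> (+>) P) s = \<one>\<^bsub>A\<^esub>"
      using A.one_closed by blast
  next
    fix t assume "t \<in> carrier A"
    then obtain a where a: "a \<in> carrier R" "t = (representative \<circ> (+>) P) a" unfolding carr' by (elim imageE)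
    have "(representative \<circ> (+>) P) \<one> \<otimes>\<^bsub>A\<^esub> t = (representative \<circ> (+>) P) a"
      using c.hom_mult[of \<one> a] a by simp
    then show "\<exists>s\<in>{\<one>}. \<exists>a\<in>carrier R. (representative \<circ> (+>) P) s \<otimes>\<^bsub>A\<^esub> t = (representative \<circ> (+>) P) a"
      using a(1) by blast
  next
    fix a assume a: "a \<in> carrier R"
    have "(representative \<circ> (+>) P) a = \<zero>\<^bsub>A\<^esub> \<longleftrightarrow> P +> a = \<zero>\<^bsub>R Quot P\<^esub>"
      unfolding zero o_apply by (rule inj_on_eq_iff[OF inj q.hom_closed[OF a] q.S.zero_closed])
    then show "((representative \<circ> (+>) P) a = \<zero>\<^bsub>A\<^esub>) = (a \<in> sat R {\<one>} P)"
      using q.hom_eq_zero[OF a] by simp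
  qed
qed

text \<open>
  The localization of the domain \<open>R/P\<close> at its zero ideal is a field, hence regular, so the open regular
  locus of \<open>R/P\<close> is not empty. A member of its defining set that is nonzero in \<open>R/P\<close> comes from an
  element \<open>f\<close> outside \<open>P\<close>, and the primes avoiding \<open>f\<close> are in the regular locus.
\<close>

lemma cohen_macaulay_generic_prime:
  assumes J2: "J2_ring R" and P: "primeideal P R"
  shows "\<exists>f\<in>carrier R - P. \<forall>Q. primeideal Q R \<and> P \<subseteq> Q \<and> f \<notin> Q \<longrightarrow> cohen_macaulay_at R P Q"
proof -
  note Pi = prime_ideal[OF P]
  let ?A = "image_ring representative (R Quot P)"
  let ?h = "representative \<circ> (+>) P"
  interpret A: fraction_hom R ?A ?h "{\<one>}" P by (rule fraction_hom_quotient_copy(1)[OF Pi])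
  have carr: "carrier ?A = ?h ` carrier R" by (rule fraction_hom_quotient_copy(2)[OF Pi])
  have "finite_type R ?A ?h"
  proof -
    have "generate_ring ?A (carrier ?A) = carrier ?A"
    proof
      show "generate_ring ?A (carrier ?A) \<subseteq> carrier ?A" by (rule A.S.generate_ring_incl) simp
      show "carrier ?A \<subseteq> generate_ring ?A (carrier ?A)" by (rule subsetI) (rule generate_ring.incl)
    qed
    then have "generate_ring ?A (?h ` carrier R \<union> {}) = carrier ?A"
      by (simp only: carr[symmetric] Un_empty_right)
    then show ?thesis unfolding finite_type_def
      by (intro conjI exI[of _ "{}"] A.S.is_cring A.homh) auto
  qed
  then have "zariski_open ?A (regular_locus ?A)" using J2 unfolding J2_ring_def by blast
  then obtain E where E: "E \<subseteq> carrier ?A"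
    and locus: "regular_locus ?A = {N. primeideal N ?A \<and> \<not> E \<subseteq> N}"
    by (auto simp: zariski_open_def)
  have one: "Q \<inter> {\<one>} = {}" if "primeideal Q R" for Q using prime_one[OF that] by blast
  have comp: "local_fraction_hom R (localization_at ?A (A.extension Q))
      (loc_map ?A (carrier ?A - A.extension Q) \<circ> ?h) (carrier R - Q) P Q"
    if Q: "primeideal Q R" "P \<subseteq> Q" for Q
  proof -
    note EQ = A.extension_prime[OF Q one[OF Q(1)]]
    show ?thesis
      using A.fraction_hom_localization_at[OF EQ(1)] unfolding EQ(2)
      by (intro local_fraction_homI noeth_cring_axioms Q)
  qed
  \<comment> \<open>\<open>?N\<close> is the zero ideal of \<open>R/P\<close>; dimension zero and the empty system of parameters show
    regularity.\<close>
  let ?N = "A.extension P"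
  note EP = A.extension_prime[OF P order_refl one[OF P]]
  interpret F: local_fraction_hom R "localization_at ?A ?N"
    "loc_map ?A (carrier ?A - ?N) \<circ> ?h" "carrier R - P" P P
    by (rule comp[OF P order_refl])
  have "regular_local_ring (localization_at ?A ?N)"
  proof -
    have "n \<le> 0" if C: "prime_chain R C n" "P \<subseteq> C 0" "C n \<subseteq> P" for C n
    proof (rule ccontr)
      assume "\<not> n \<le> 0"
      then have "C 0 \<subset> C 1" "C 1 \<subseteq> C n"
        using C(1) prime_chain_mono[OF C(1), of 1 n] by (auto simp: prime_chain_def)
      then show False using C by blast
    qed
    from F.chain_length_le[of 0, OF this] have dim: "krull_dim (localization_at ?A ?N) = enat 0"
      by (simp add: zero_enat_def[symmetric])
    note Z = F.S.zeroideal and X = primeideal.axioms(1)[OF F.extension_Q(1)]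
    have "F.contraction {\<zero>\<^bsub>localization_at ?A ?N\<^esub>} = P"
      unfolding F.contraction_zero by (rule sat_prime[OF P F.submonoid]) blast
    then have "F.extension P = {\<zero>\<^bsub>localization_at ?A ?N\<^esub>}"
      using F.contraction_subset_iff[OF Z X] F.contraction_subset_iff[OF X Z] F.extension_Q(2) by blast
    then have "max_ideal (localization_at ?A ?N) = Idl\<^bsub>localization_at ?A ?N\<^esub> {}"
      unfolding F.max_ideal_eq F.S.Idl_empty .
    then show ?thesis
      unfolding regular_local_ring_def dim noetherian_cring_iff
      by (intro conjI exI[of _ "{}"] F.noetherian_T F.local_ring) auto
  qed
  then have "?N \<in> regular_locus ?A" using EP(1) by (simp add: regular_locus_def)
  then obtain e where e: "e \<in> E" "e \<notin> ?N" using locus by auto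
  obtain f where f: "f \<in> carrier R" "e = ?h f" using e(1) E unfolding carr by blast
  have "f \<notin> P" using e(2) f EP(2) by (auto simp: A.contraction_def)
  moreover have "cohen_macaulay_at R P Q" if Q: "primeideal Q R" "P \<subseteq> Q" "f \<notin> Q" for Q
  proof -
    note EQ = A.extension_prime[OF Q(1,2) one[OF Q(1)]]
    have "e \<notin> A.extension Q" using Q(3) f EQ(2) by (auto simp: A.contraction_def)
    then have "A.extension Q \<in> regular_locus ?A" using locus EQ(1) e(1) by auto
    then have "regular_local_ring (localization_at ?A (A.extension Q))"
      by (simp add: regular_locus_def)
    then show ?thesis
      by (rule local_fraction_hom.cohen_macaulay_at_of_regular[OF comp[OF Q(1,2)]])
  qed
  ultimately show ?thesis using f(1) by blast
qed

text \<open>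
  At a minimal prime, every \<open>a \<in> P\<close> satisfies \<open>s a\<^sup>n \<in> I\<close> for some \<open>s\<close> outside \<open>P\<close>. The product of these
  \<open>s\<close> over a finite set of generators of \<open>P\<close> is the required element.
\<close>

lemma minimal_prime_generic:
  assumes P: "P \<in> minimal_primes R I" and I: "ideal I R"
  shows "\<exists>f\<in>carrier R - P. \<forall>N. primeideal N R \<and> I \<subseteq> N \<and> f \<notin> N \<longrightarrow> P \<subseteq> N"
proof -
  have Pp: "primeideal P R" and min: "\<And>N. primeideal N R \<Longrightarrow> I \<subseteq> N \<Longrightarrow> N \<subseteq> P \<Longrightarrow> N = P"
    using P by (auto simp: minimal_primes_def)
  note m = primeideal_complement_submonoid[OF Pp]
  have single: "\<exists>f\<in>carrier R - P. \<forall>N. primeideal N R \<and> I \<subseteq> N \<and> f \<notin> N \<longrightarrow> a \<in> N"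
    if a: "a \<in> P" for a
  proof -
    have ac: "a \<in> carrier R" using ideal.Icarr[OF prime_ideal[OF Pp] a] .
    have "I \<inter> complement_powers R P a \<noteq> {}"
    proof
      assume "I \<inter> complement_powers R P a = {}"
      then obtain N where N: "primeideal N R" "I \<subseteq> N" "N \<inter> complement_powers R P a = {}"
        using prime_avoiding_submonoid[OF I complement_powers_submonoid[OF Pp ac]] by blast
      have "N \<subseteq> P"
        using N(3) complement_powers_complement[OF Pp ac] ideal_subset[OF prime_ideal[OF N(1)]] by blast
      then have "N = P" by (rule min[OF N(1,2)])
      then show False using N(3) a complement_powers_self[OF Pp ac] by blast
    qed
    then obtain s n where s: "s \<in> carrier R" "s \<notin> P" "s \<otimes> a [^] (n::nat) \<in> I"
      by (auto simp: complement_powers_def)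
    have "a \<in> N" if N: "primeideal N R" "I \<subseteq> N" "s \<notin> N" for N
    proof -
      have "s \<in> N \<or> a [^] n \<in> N" using s N ac by (intro prime_mem[OF N(1)]) auto
      then show ?thesis using N(3) prime_pow_mem[OF N(1) ac] by blast
    qed
    then show ?thesis using s by blast
  qed
  have finite: "\<exists>f\<in>carrier R - P. \<forall>N. primeideal N R \<and> I \<subseteq> N \<and> f \<notin> N \<longrightarrow> A \<subseteq> N"
    if "finite A" "A \<subseteq> P" for A
    using that
  proof (induction A)
    case empty
    then show ?case using submonoid.one_closed[OF m] by blast
  next
    case (insert a A)
    obtain f where f: "f \<in> carrier R - P" "\<And>N. primeideal N R \<Longrightarrow> I \<subseteq> N \<Longrightarrow> f \<notin> N \<Longrightarrow> A \<subseteq> N"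
      using insert.IH insert.prems by auto
    obtain g where g: "g \<in> carrier R - P" "\<And>N. primeideal N R \<Longrightarrow> I \<subseteq> N \<Longrightarrow> g \<notin> N \<Longrightarrow> a \<in> N"
      using single[of a] insert.prems by auto
    have "insert a A \<subseteq> N" if N: "primeideal N R" "I \<subseteq> N" "f \<otimes> g \<notin> N" for N
    proof -
      have "f \<notin> N" "g \<notin> N"
        using N(3) ideal_mult_left[OF prime_ideal[OF N(1)]] ideal_mult_right[OF prime_ideal[OF N(1)]]
          f(1) g(1) by blast+
      then show ?thesis using f(2) g(2) N by simp
    qed
    then show ?case using submonoid.m_closed[OF m f(1) g(1)] by blast
  qed
  obtain A where A: "A \<subseteq> carrier R" "finite A" "P = Idl A"
    using finetely_gen[OF prime_ideal[OF Pp]] by blast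
  then have "A \<subseteq> P" using genideal_self by simp
  then obtain f where f: "f \<in> carrier R - P" "\<And>N. primeideal N R \<Longrightarrow> I \<subseteq> N \<Longrightarrow> f \<notin> N \<Longrightarrow> A \<subseteq> N"
    using finite[OF A(2)] by auto
  have "P \<subseteq> N" if "primeideal N R" "I \<subseteq> N" "f \<notin> N" for N
    unfolding A(3) by (intro genideal_minimal prime_ideal f(2) that)
  then show ?thesis using f(1) by blast
qed

text \<open>
  The primes \<open>(c : a)\<close> of a prime filtration of \<open>R/I\<close> form such a set: a prime \<open>N \<supseteq> c\<close> either contains \<open>a\<close>,
  and one passes to \<open>c + (a)\<close>, or it contains \<open>(c : a)\<close>.
\<close>

lemma finitely_many_primes_containing:
  assumes "ideal I R"
  shows "\<exists>X. finite X \<and> (\<forall>P\<in>X. primeideal P R \<and> I \<subseteq> P) \<and>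
    (\<forall>N. primeideal N R \<and> I \<subseteq> N \<longrightarrow> (\<exists>P\<in>X. P \<subseteq> N))"
  using assms
proof (induction rule: ideal_induct)
  case (larger c)
  show ?case
  proof (cases "c = carrier R")
    case True
    have "\<not> carrier R \<subseteq> N" if "primeideal N R" for N using prime_one[OF that] by blast
    then show ?thesis using True by (intro exI[of _ "{}"]) auto
  next
    case False
    obtain a where a: "a \<in> carrier R" "a \<notin> c" "primeideal (colon R c a) R"
      using associated_prime_exists[OF larger(1) False] .
    let ?c = "Idl (insert a c)"
    have c': "ideal ?c R" "insert a c \<subseteq> ?c"
      using adjoin_ideal[OF larger(1) a(1)] adjoin_upper[OF larger(1) a(1)] by simp_all
    have "c \<subset> ?c" using c'(2) a(2) by auto
    from larger(2)[OF c'(1) this] obtain X where X: "finite X" "\<And>P. P \<in> X \<Longrightarrow> primeideal P R \<and> ?c \<subseteq> P"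
      "\<And>N. primeideal N R \<Longrightarrow> ?c \<subseteq> N \<Longrightarrow> \<exists>P\<in>X. P \<subseteq> N" by (elim exE conjE) simp
    have "\<exists>P\<in>insert (colon R c a) X. P \<subseteq> N" if N: "primeideal N R" "c \<subseteq> N" for N
    proof (cases "a \<in> N")
      case True
      then have "?c \<subseteq> N" using N by (intro genideal_minimal prime_ideal) auto
      then show ?thesis using X(3)[OF N(1)] by blast
    next
      case False
      have "colon R c a \<subseteq> N"
      proof
        fix r assume "r \<in> colon R c a"
        then have "r \<in> carrier R" "r \<otimes> a \<in> N" using N(2) by (auto simp: colon_def)
        then show "r \<in> N" using prime_mem[OF N(1) _ a(1)] False by blast
      qed
      then show ?thesis by blast
    qed
    moreover have "primeideal P R \<and> c \<subseteq> P" if "P \<in> insert (colon R c a) X" for P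
      using that a(3) subset_colon[OF larger(1) a(1)] X(2)[of P] c'(2) by auto
    ultimately show ?thesis
      using X(1) by (intro exI[of _ "insert (colon R c a) X"]) simp
  qed
qed

lemma finite_minimal_primes:
  assumes "ideal I R" shows "finite (minimal_primes R I)"
proof -
  obtain X where X: "finite X" "\<And>P. P \<in> X \<Longrightarrow> primeideal P R \<and> I \<subseteq> P"
    "\<And>N. primeideal N R \<Longrightarrow> I \<subseteq> N \<Longrightarrow> \<exists>P\<in>X. P \<subseteq> N"
    using finitely_many_primes_containing[OF assms] by (elim exE conjE) simp
  have "minimal_primes R I \<subseteq> X"
  proof
    fix N assume N: "N \<in> minimal_primes R I"
    then have "primeideal N R" "I \<subseteq> N" by (auto simp: minimal_primes_def)
    then obtain P where P: "P \<in> X" "P \<subseteq> N" using X(3) by blast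
    then have "P = N" using X(2)[OF P(1)] N by (auto simp: minimal_primes_def)
    then show "N \<in> X" using P by simp
  qed
  then show ?thesis using X(1) finite_subset by blast
qed

lemma ideal_power_ideal: "ideal I R \<Longrightarrow> ideal (ideal_power R I n) R"
  by (induction n) (simp_all add: nat_pow_def ideals_set_def oneideal ideal_prod_is_ideal)

lemma ideal_power_subset_prime:
  assumes N: "primeideal N R" and I: "ideal I R" and sub: "ideal_power R I n \<subseteq> N"
  shows "I \<subseteq> N"
proof
  fix a assume a: "a \<in> I"
  have "a [^] k \<in> ideal_power R I k" for k
  proof (induction k)
    case (Suc k)
    then show ?case using ideal_prod.prod[OF Suc a, of R] by (simp add: nat_pow_def ideals_set_def)
  qed (simp add: nat_pow_def ideals_set_def)
  then have "a [^] n \<in> N" using sub by blast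
  then show "a \<in> N" by (rule prime_pow_mem[OF N ideal.Icarr[OF I a]])
qed

text \<open>
  Three elements outside \<open>P\<close> are multiplied: one that makes \<open>R/P\<close> Cohen-Macaulay, one that makes \<open>P\<close> the only
  minimal prime of \<open>I\<close> so that \<open>R/P\<close> and \<open>R/I\<^sup>n\<close> have the same dimension, and one that gives all \<open>R/I\<^sup>n\<close>
  filtrations with quotients \<open>R/P\<close>.
\<close>

lemma cohen_macaulay_generic_minimal_prime:
  assumes J2: "J2_ring R" and I: "ideal I R" and P: "P \<in> minimal_primes R I"
  shows "\<exists>f\<in>carrier R - P. \<forall>Q. primeideal Q R \<and> I \<subseteq> Q \<and> f \<notin> Q \<longrightarrow>
    (\<forall>n. cohen_macaulay_at R (ideal_power R I n) Q)"
proof -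
  have Pp: "primeideal P R" using P by (simp add: minimal_primes_def)
  note m = primeideal_complement_submonoid[OF Pp]
  obtain f1 where f1: "f1 \<in> carrier R - P"
    "\<And>Q. primeideal Q R \<Longrightarrow> P \<subseteq> Q \<Longrightarrow> f1 \<notin> Q \<Longrightarrow> cohen_macaulay_at R P Q"
    using cohen_macaulay_generic_prime[OF J2 Pp] by auto
  obtain f2 where f2: "f2 \<in> carrier R - P"
    "\<And>N. primeideal N R \<Longrightarrow> I \<subseteq> N \<Longrightarrow> f2 \<notin> N \<Longrightarrow> P \<subseteq> N"
    using minimal_prime_generic[OF P I] by auto
  obtain f3 where f3: "f3 \<in> carrier R - P"
    "\<And>n. cyclic_filtration R P f3 (ideal_power R I n) (carrier R)"
    using generic_cyclic_filtration_powers[OF P I] by auto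
  let ?f = "f1 \<otimes> (f2 \<otimes> f3)"
  have "?f \<in> carrier R - P"
    using submonoid.m_closed[OF m f1(1) submonoid.m_closed[OF m f2(1) f3(1)]] .
  moreover have "cohen_macaulay_at R (ideal_power R I n) Q"
    if Q: "primeideal Q R" "I \<subseteq> Q" "?f \<notin> Q" for Q n
  proof -
    have c: "f1 \<in> carrier R" "f2 \<in> carrier R" "f3 \<in> carrier R" using f1 f2 f3 by auto
    have nQ: "f1 \<notin> Q" "f2 \<notin> Q" "f3 \<notin> Q"
      using Q(3) c by (auto simp: ideal_closed[OF prime_ideal[OF Q(1)]])
    have PQ: "P \<subseteq> Q" by (rule f2(2)[OF Q(1,2) nQ(2)])
    obtain xs where xs: "set xs \<subseteq> Q" "loc_regular R (carrier R - Q) xs P"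
      and dim: "\<And>C k. prime_chain R C k \<Longrightarrow> P \<subseteq> C 0 \<Longrightarrow> C k \<subseteq> Q \<Longrightarrow> k \<le> length xs"
      using f1(2)[OF Q(1) PQ nQ(1)] by (auto simp: cohen_macaulay_at_def)
    have "loc_regular R (carrier R - Q) xs (ideal_power R I n)"
    proof (rule loc_regular_filtration[OF f3(2) HOL.refl prime_ideal[OF Pp]
          primeideal_complement_submonoid[OF Q(1)] _ _ xs(2)])
      show "f3 \<in> carrier R - Q" using c nQ by simp
      show "set xs \<subseteq> carrier R" using xs(1) ideal_subset[OF prime_ideal[OF Q(1)]] by blast
    qed
    moreover have "k \<le> length xs"
      if C: "prime_chain R C k" "ideal_power R I n \<subseteq> C 0" "C k \<subseteq> Q" for C k
    proof (rule dim[OF C(1) _ C(3)])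
      have C0: "primeideal (C 0) R" using prime_chain_prime[OF C(1)] by simp
      have "f2 \<notin> C 0" using prime_chain_mono[OF C(1), of 0 k] C(3) nQ(2) by blast
      then show "P \<subseteq> C 0" by (intro f2(2)[OF C0 ideal_power_subset_prime[OF C0 I C(2)]])
    qed
    ultimately show ?thesis unfolding cohen_macaulay_at_def using xs(1) by blast
  qed
  ultimately show ?thesis by blast
qed

lemma incomparable_primes_element:
  assumes P: "primeideal P R" and "finite X"
    and "\<And>F. F \<in> X \<Longrightarrow> primeideal F R \<and> \<not> F \<subseteq> P"
  shows "\<exists>g\<in>carrier R - P. \<forall>F\<in>X. g \<in> F"
  using assms(2,3)
proof (induction X)
  case empty
  then show ?case using submonoid.one_closed[OF primeideal_complement_submonoid[OF P]] by blast
next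
  case (insert F X)
  have "\<exists>g\<in>carrier R - P. \<forall>F\<in>X. g \<in> F"
    by (rule insert.IH, rule insert.prems, simp)
  then obtain g where g: "g \<in> carrier R - P" "\<forall>F\<in>X. g \<in> F" by blast
  have F: "primeideal F R" "\<not> F \<subseteq> P" using insert.prems by auto
  then obtain u where u: "u \<in> F" "u \<notin> P" by blast
  have uc: "u \<in> carrier R" using ideal.Icarr[OF prime_ideal[OF F(1)] u(1)] .
  have "g \<otimes> u \<in> carrier R - P"
    using submonoid.m_closed[OF primeideal_complement_submonoid[OF P] g(1), of u] u uc by simp
  moreover have "g \<otimes> u \<in> G" if G: "G \<in> insert F X" for G
  proof -
    have Gi: "ideal G R" using insert.prems[OF G] prime_ideal by simp
    show ?thesis
    proof (cases "G = F")
      case True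
      then have "u \<in> G" using u by simp
      then show ?thesis using g(1) by (intro ideal_mult_left[OF Gi]) auto
    next
      case False
      then have "g \<in> G" using g(2) G by blast
      then show ?thesis by (rule ideal_mult_right[OF Gi _ uc])
    qed
  qed
  ultimately show ?case by blast
qed

text \<open>
  Prime avoidance for incomparable primes. If \<open>f\<close> avoids \<open>X\<close> but lies in \<open>P\<close>, it is corrected by an element of
  \<open>H\<close> outside \<open>P\<close> that lies in all members of \<open>X\<close>.
\<close>

lemma prime_avoidance:
  assumes H: "ideal H R" and "finite X"
    and "\<And>P. P \<in> X \<Longrightarrow> primeideal P R \<and> \<not> H \<subseteq> P"
    and "\<And>P F. P \<in> X \<Longrightarrow> F \<in> X \<Longrightarrow> F \<subseteq> P \<Longrightarrow> F = P"
  shows "\<exists>f\<in>H. \<forall>P\<in>X. f \<notin> P"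
  using assms(2-4)
proof (induction X)
  case empty
  then show ?case using ideal_zero[OF H] by blast
next
  case (insert P X)
  have "\<exists>f\<in>H. \<forall>F\<in>X. f \<notin> F"
    by (rule insert.IH; rule insert.prems; simp)
  then obtain f where f: "f \<in> H" "\<forall>F\<in>X. f \<notin> F" by blast
  show ?case
  proof (cases "f \<in> P")
    case False
    then show ?thesis using f by blast
  next
    case True
    have P: "primeideal P R" "\<not> H \<subseteq> P" using insert.prems(1) by auto
    have "primeideal F R \<and> \<not> F \<subseteq> P" if F: "F \<in> X" for F
    proof
      show "primeideal F R" using insert.prems(1)[of F] F by simp
      show "\<not> F \<subseteq> P" using insert.prems(2)[of P F] F insert.hyps(2) by auto
    qed
    then obtain g where g: "g \<in> carrier R - P" "\<forall>F\<in>X. g \<in> F"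
      using incomparable_primes_element[OF P(1) insert.hyps(1)] by auto
    obtain u where u: "u \<in> H" "u \<notin> P" using P(2) by blast
    have c: "u \<in> carrier R" "g \<in> carrier R" "f \<in> carrier R"
      using ideal.Icarr[OF H] u f g by auto
    have ug: "u \<otimes> g \<in> H" "u \<otimes> g \<notin> P"
      using ideal_mult_right[OF H u(1) c(2)] prime_mem[OF P(1) c(1,2)] u(2) g(1) by blast+
    have "f \<oplus> u \<otimes> g \<notin> P"
      using ideal_addD[OF prime_ideal[OF P(1)] True, of "u \<otimes> g"] ug c by auto
    moreover have "f \<oplus> u \<otimes> g \<notin> F" if F: "F \<in> X" for F
    proof
      have Fi: "ideal F R" using insert.prems(1)[of F] F prime_ideal by simp
      have ugF: "u \<otimes> g \<in> F" using ideal_mult_left[OF Fi _ c(1)] g(2) F by blast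
      assume "f \<oplus> u \<otimes> g \<in> F"
      then have "u \<otimes> g \<oplus> f \<in> F" using c by (simp add: a_comm)
      then have "f \<in> F" by (rule ideal_addD[OF Fi ugF c(3)])
      then show False using f(2) F by blast
    qed
    ultimately show ?thesis using ideal_add[OF H f(1) ug(1)] by blast
  qed
qed

text \<open>
  The elements whose basic open set lies in a given set of primes form an ideal: a prime that
  avoids \<open>a \<oplus> b\<close> avoids \<open>a\<close> or \<open>b\<close>.
\<close>

lemma open_locus_ideal:
  "ideal {f \<in> carrier R. \<forall>Q. primeideal Q R \<and> I \<subseteq> Q \<and> f \<notin> Q \<longrightarrow> G Q} R"
proof (rule idealI')
  let ?H = "{f \<in> carrier R. \<forall>Q. primeideal Q R \<and> I \<subseteq> Q \<and> f \<notin> Q \<longrightarrow> G Q}"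
  show "\<zero> \<in> ?H" using ideal_zero[OF prime_ideal] by auto
  fix a b assume "a \<in> ?H" "b \<in> ?H"
  then show "a \<oplus> b \<in> ?H" using ideal_add[OF prime_ideal, of _ a b] by auto
next
  let ?H = "{f \<in> carrier R. \<forall>Q. primeideal Q R \<and> I \<subseteq> Q \<and> f \<notin> Q \<longrightarrow> G Q}"
  fix r a assume "r \<in> carrier R" "a \<in> ?H"
  then show "r \<otimes> a \<in> ?H" using ideal_mult_left[OF prime_ideal, of _ a r] by auto
qed blast

lemma powers_submonoid:
  assumes "f \<in> carrier R" shows "submonoid (elem_powers R f) R"
proof (rule submonoid.intro)
  show "\<one> \<in> elem_powers R f" by (rule range_eqI[of _ _ "0::nat"]) simp
  fix x y assume "x \<in> elem_powers R f" "y \<in> elem_powers R f"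
  then obtain n m :: nat where "x = f [^] n" "y = f [^] m" by blast
  then have "x \<otimes> y = f [^] (n + m)" using assms by (simp add: nat_pow_mult)
  then show "x \<otimes> y \<in> elem_powers R f" by (rule range_eqI)
qed (use assms in auto)

text \<open>
  The local rings of the quotient of \<open>R\<^sub>f\<close> are the local rings of \<open>R/B\<close> at the primes that contain \<open>B\<close>
  and avoid \<open>f\<close>.
\<close>

lemma cohen_macaulay_localization_away:
  assumes f: "f \<in> carrier R" and B: "ideal B R"
    and cm: "\<And>Q. primeideal Q R \<Longrightarrow> B \<subseteq> Q \<Longrightarrow> f \<notin> Q \<Longrightarrow> cohen_macaulay_at R B Q"
  shows "cohen_macaulay_ring (localization_away R f Quot
    extended_ideal (localization_away R f) (loc_map R (elem_powers R f)) B)"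
proof -
  let ?L = "localization_away R f"
  let ?K = "extended_ideal ?L (loc_map R (elem_powers R f)) B"
  let ?W = "?L Quot ?K"
  interpret l: localization_data R "elem_powers R f"
    by (intro localization_data.intro localization_data_axioms.intro is_cring powers_submonoid f)
  interpret w: fraction_hom R ?W "(+>\<^bsub>?L\<^esub>) ?K \<circ> loc_map R (elem_powers R f)" "elem_powers R f" B
    using fraction_hom.fraction_hom_quotient_extension[OF l.fraction_hom_localization B]
      ideal_zero[OF B] by simp
  have "cohen_macaulay_local_ring (localization_at ?W N)" if N: "primeideal N ?W" for N
  proof -
    let ?Q = "w.contraction N"
    have Q: "primeideal ?Q R" "B \<subseteq> ?Q"
      using w.contraction_prime(1)[OF N] w.kernel_subset_contraction[OF primeideal.axioms(1)[OF N]]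
        sat_upper[OF w.submonoid B] by auto
    have "f \<in> elem_powers R f" using f by (intro range_eqI[of _ _ "1::nat"]) simp
    then have "f \<notin> ?Q" using w.contraction_prime(2)[OF N] by blast
    note lf = local_fraction_homI[OF w.fraction_hom_localization_at[OF N] noeth_cring_axioms Q]
    show ?thesis
      by (rule local_fraction_hom.cohen_macaulay_local[OF lf cm[OF Q \<open>f \<notin> ?Q\<close>]])
  qed
  then show ?thesis
    using w.noetherian[OF noeth_cring_axioms] by (simp add: cohen_macaulay_ring_def noetherian_cring_iff)
qed

theorem cohen_macaulay_powers_generic:
  assumes J2: "J2_ring R" and I: "ideal I R"
  shows "\<exists>f\<in>carrier R. f \<notin> \<Union> (minimal_primes R I) \<and>
    (\<forall>n. cohen_macaulay_ring
      (localization_away R f Quot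
        extended_ideal (localization_away R f) (loc_map R (elem_powers R f)) (ideal_power R I n)))"
proof -
  let ?H = "{f \<in> carrier R. \<forall>Q. primeideal Q R \<and> I \<subseteq> Q \<and> f \<notin> Q \<longrightarrow>
    (\<forall>n. cohen_macaulay_at R (ideal_power R I n) Q)}"
  have prime: "primeideal P R \<and> \<not> ?H \<subseteq> P" if P: "P \<in> minimal_primes R I" for P
  proof
    show "primeideal P R" using P by (simp add: minimal_primes_def)
    show "\<not> ?H \<subseteq> P" using cohen_macaulay_generic_minimal_prime[OF J2 I P] by blast
  qed
  have incomparable: "F = P" if "P \<in> minimal_primes R I" "F \<in> minimal_primes R I" "F \<subseteq> P" for P F
    using that by (simp add: minimal_primes_def)
  obtain f where f: "f \<in> ?H" "\<forall>P\<in>minimal_primes R I. f \<notin> P"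
    using prime_avoidance[OF open_locus_ideal[of I "\<lambda>Q. \<forall>n. cohen_macaulay_at R (ideal_power R I n) Q"]
        finite_minimal_primes[OF I] prime incomparable] by blast
  have "cohen_macaulay_at R (ideal_power R I n) Q"
    if "primeideal Q R" "ideal_power R I n \<subseteq> Q" "f \<notin> Q" for Q n
    using f(1) that ideal_power_subset_prime[OF that(1) I that(2)] by blast
  then show ?thesis
    using f by (intro bexI[of _ f] conjI allI cohen_macaulay_localization_away ideal_power_ideal I) auto
qed

end

theorem corollary11:
  fixes R :: "('a, 'b) ring_scheme" and I :: "'a set"
  assumes "excellent_ring R"
    and "locally_equidimensional R"
    and "ideal I R"
  shows "\<exists>f\<in>carrier R. f \<notin> \<Union> (Minh R I) \<and>
    (\<forall>n\<ge>1. cohen_macaulay_ring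
      (localization_away R f Quot
        extended_ideal (localization_away R f) (loc_map R (elem_powers R f)) (ideal_power R I n)))"
proof -
  have J2: "J2_ring R" and "noeth_cring R"
    using assms(1) by (simp_all add: excellent_ring_def noetherian_cring_iff)
  interpret noeth_cring R by fact
  have "Minh R I \<subseteq> minimal_primes R I" by (auto simp: Minh_def)
  then show ?thesis using cohen_macaulay_powers_generic[OF J2 assms(3)] by blast
qed

end
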